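(* Let $S=\{R_0,\dots,R_d\}$ be an association scheme of class $d$ on a nonempty finite set $X$, let $x\in X$, let $\mathbb{F}$ be a field of positive characteristic $p$, and let $T=T(x)$ be the modular Terwilliger algebra of $S$ over $\mathbb{F}$ with respect to $x$. The following statements are equivalent: (i) $S$ is a $p'$-valenced scheme; (ii) The $\mathbb{F}$-subalgebra $B_0$ of $T$ is unital, and its identity element is central in $T$; (iii) There exists a two-sided ideal $D$ of $T$ such that $T$ is a direct sum of $B_0$ and $D$; (iv) The $\mathbb{F}$-subalgebra $B_0$ of $T$ is isomorphic, as an $\mathbb{F}$-algebra, to a full matrix algebra over a division $\mathbb{F}$-algebra; (v) If $Z\in\mathrm{Ann}_T(W_0)$, then $E_i^*Z=ZE_i^*=O$ for every $R_i\in O_\vartheta(S)$; (vi) If $\tilde Z\in\mathrm{Rad}(T)$, then $E_i^*\tilde Z=\tilde Z E_i^*=O$ for every $R_i\in O_\vartheta(S)$; (vii) For every decomposition of ${}_TT$ into a direct sum of indecomposable $T$-modules, there exist exactly $d+1$ indecomposable direct summands isomorphic to $W_0$ as $T$-modules; (viii) $W_0$ is an irreducible $T$-module; (ix) $W_0$ is a self-contragredient $T$-module; (x) For every $T$-module $U$: $U$ is an irreducible $T$-module satisfying $\dim_{\mathbb{F}}E_j^*U>0$ for some $R_j\in O_\vartheta(S)$ if and only if $U\cong W_0$ as $T$-modules; (xi) For every $T$-module $U$: $U$ satisfies $\dim_{\mathbb{F}}U=d+1\ge\dim_{\mathbb{F}}E_{j}^*U>0$ for some $R_{j}\in O_\vartheta(S)$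 if and only if $U\cong W_0$ as $T$-modules.
   Context: Conventions: $\mathbb{N}_0=\{0,1,2,\dots\}$, $[a,b]=\{c\in\mathbb{N}_0: a\le c\le b\}$; $\langle Y\rangle_{\mathbb{F}}$ is the $\mathbb{F}$-span of $Y$. All modules are finitely generated left modules. Scheme: an association scheme of class $d$ on $X$ is a partition $S=\{R_0,\dots,R_d\}$ of $X\times X$ (into $d+1$ nonempty parts) such that $R_0=\{(y,y):y\in X\}$; for each $i\in[0,d]$ there is $i'\in[0,d]$ with $R_{i'}=\{(y,z):(z,y)\in R_i\}$; and for all $i,j,\ell\in[0,d]$ the number $p_{ij}^{\ell}=|\{w\in X:(y,w)\in R_i,\ (w,z)\in R_j\}|$ does not depend on the choice of $(y,z)\in R_\ell$. The valency of $R_i$ is $k_i=p_{ii'}^0>0$. $S$ is $p'$-valenced if $p\nmid k_i$ for every $i\in[0,d]$. $O_\vartheta(S)=\{R_j\in S:k_j=1\}$. Terwilliger algebra: in the algebra $M_X(\mathbb{F})$ of matrices with rows and columns indexed by $X$, $A_i$ is the $\{0,1\}$-matrix whose $(y,z)$-entry is $1$ iff $(y,z)\in R_i$, and $E_i^*$ is the diagonal $\{0,1\}$-matrix whose $(y,y)$-entry is $1$ iff $(x,y)\in R_i$. $J$ is the all-one matrix and $O$ the zero matrix. $T$ is the unital $\mathbb{F}$-subalgebra of $M_X(\mathbb{F})$ generated by $A_0,\dots,A_d,E_0^*,\dots,E_d^*$. It acts by left multiplication on the space $\mathbb{F}^X$ of column vectors; $\mathbf{1}\in\mathbb{F}^X$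 is the all-one vector. ${}_TT$ denotes $T$ as a left $T$-module under left multiplication; $\mathrm{Rad}(T)$ is the Jacobson radical; $\mathrm{Ann}_T(V)=\{a\in T:av=0\ \forall v\in V\}$ for a $T$-module $V$. $W_0=\langle\{E_i^*\mathbf{1}:i\in[0,d]\}\rangle_{\mathbb{F}}$ is a $T$-module, called the primary module of $T$. $B_0=\langle\{E_i^*JE_j^*:i,j\in[0,d]\}\rangle_{\mathbb{F}}$ is a two-sided ideal of $T$ and hence an $\mathbb{F}$-subalgebra of $T$ (not assumed to have an identity). For a $T$-module $U$ and $i\in[0,d]$, $E_i^*U=\{E_i^*u:u\in U\}$. The algebra $T$ is closed under matrix transpose $Z\mapsto Z^t$; the contragredient $U^\circ$ of a $T$-module $U$ is $\mathrm{Hom}_{\mathbb{F}}(U,\mathbb{F})$ with action $(Z\psi)(u)=\psi(Z^tu)$ for $Z\in T$, $\psi\in\mathrm{Hom}_{\mathbb{F}}(U,\mathbb{F})$, $u\in U$. $U$ is self-contragredient if $U\cong U^\circ$ as $T$-modules. *)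

theory Defs
  imports
    "HOL-Analysis.Analysis"
    "HOL-Algebra.Algebraic_Closure_Type"
    "Jordan_Normal_Form.Missing_VectorSpace"
begin

section \<open>Association schemes\<close>

text \<open>
  The underlying set \<open>X\<close> is the finite type \<open>'x\<close>. A scheme of class \<open>d\<close> is given by its relations
  \<open>R 0, \<dots>, R d\<close>; the values \<open>R i\<close> with \<open>i > d\<close> are irrelevant.
\<close>

definition association_scheme :: "nat \<Rightarrow> (nat \<Rightarrow> ('x::finite \<times> 'x) set) \<Rightarrow> bool" where
  "association_scheme d R \<longleftrightarrow>
     partition_on UNIV (R ` {..d}) \<and> inj_on R {..d} \<and>
     R 0 = {(y, y) | y. True} \<and>
     (\<forall>i\<le>d. \<exists>i'\<le>d. R i' = {(y, z). (z, y) \<in> R i}) \<and>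
     (\<forall>i\<le>d. \<forall>j\<le>d. \<forall>l\<le>d. \<exists>n. \<forall>(y, z)\<in>R l. card {w. (y, w) \<in> R i \<and> (w, z) \<in> R j} = n)"

definition intersection_number :: "(nat \<Rightarrow> ('x::finite \<times> 'x) set) \<Rightarrow> nat \<Rightarrow> nat \<Rightarrow> nat \<Rightarrow> nat" where
  "intersection_number R i j l =
     (THE n. \<forall>(y, z)\<in>R l. card {w. (y, w) \<in> R i \<and> (w, z) \<in> R j} = n)"

definition transpose_index :: "nat \<Rightarrow> (nat \<Rightarrow> ('x \<times> 'x) set) \<Rightarrow> nat \<Rightarrow> nat" where
  "transpose_index d R i = (THE i'. i' \<le> d \<and> R i' = {(y, z). (z, y) \<in> R i})"

definition valency :: "nat \<Rightarrow> (nat \<Rightarrow> ('x::finite \<times> 'x) set) \<Rightarrow> nat \<Rightarrow> nat" where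
  "valency d R i = intersection_number R i (transpose_index d R i) 0"

definition p'_valenced :: "nat \<Rightarrow> nat \<Rightarrow> (nat \<Rightarrow> ('x::finite \<times> 'x) set) \<Rightarrow> bool" where
  "p'_valenced p d R \<longleftrightarrow> (\<forall>i\<le>d. \<not> p dvd valency d R i)"

definition thin_radical :: "nat \<Rightarrow> (nat \<Rightarrow> ('x::finite \<times> 'x) set) \<Rightarrow> ('x \<times> 'x) set set" where
  "thin_radical d R = {R j | j. j \<le> d \<and> valency d R j = 1}"


section \<open>The Terwilliger algebra\<close>

definition mat_scale :: "'f::field \<Rightarrow> 'f^'n^'m \<Rightarrow> 'f^'n^'m" where
  "mat_scale c Z = (\<chi> y z. c * Z $ y $ z)"

interpretation mat_space: vector_space "mat_scale :: 'f::field \<Rightarrow> 'f^'n^'m \<Rightarrow> 'f^'n^'m"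
  by unfold_locales (simp_all add: mat_scale_def vec_eq_iff algebra_simps)

definition adjacency_mat :: "(nat \<Rightarrow> ('x::finite \<times> 'x) set) \<Rightarrow> nat \<Rightarrow> 'f::field^'x^'x" where
  "adjacency_mat R i = (\<chi> y z. if (y, z) \<in> R i then 1 else 0)"

definition dual_idempotent :: "(nat \<Rightarrow> ('x::finite \<times> 'x) set) \<Rightarrow> 'x \<Rightarrow> nat \<Rightarrow> 'f::field^'x^'x" where
  "dual_idempotent R x i = (\<chi> y z. if y = z \<and> (x, y) \<in> R i then 1 else 0)"

definition all_one_mat :: "'f::field^'x^'x" where
  "all_one_mat = (\<chi> y z. 1)"

definition all_one_vec :: "'f::field^'x" where
  "all_one_vec = (\<chi> y. 1)"

definition unital_subalgebra :: "('f::field^'x^'x) set \<Rightarrow> bool" where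
  "unital_subalgebra A \<longleftrightarrow> mat_space.subspace A \<and> mat 1 \<in> A \<and> (\<forall>Y\<in>A. \<forall>Z\<in>A. Y ** Z \<in> A)"

definition terwilliger :: "nat \<Rightarrow> (nat \<Rightarrow> ('x::finite \<times> 'x) set) \<Rightarrow> 'x \<Rightarrow> ('f::field^'x^'x) set" where
  "terwilliger d R x =
     unital_subalgebra hull (adjacency_mat R ` {..d} \<union> dual_idempotent R x ` {..d})"

definition primary_space :: "nat \<Rightarrow> (nat \<Rightarrow> ('x::finite \<times> 'x) set) \<Rightarrow> 'x \<Rightarrow> ('f::field^'x) set" where
  "primary_space d R x = vec.span {dual_idempotent R x i *v all_one_vec | i. i \<le> d}"

definition primary_ideal :: "nat \<Rightarrow> (nat \<Rightarrow> ('x::finite \<times> 'x) set) \<Rightarrow> 'x \<Rightarrow> ('f::field^'x^'x) set" where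
  "primary_ideal d R x = mat_space.span
     {dual_idempotent R x i ** all_one_mat ** dual_idempotent R x j | i j. i \<le> d \<and> j \<le> d}"

text \<open>
  A set of matrices closed under the algebra operations, as a HOL-Algebra structure over the field.
  The field \<open>one\<close> is meaningful only if the set contains the identity matrix, so it must be ignored
  for the primary ideal.
\<close>

definition mat_algebra :: "('f::field^'x^'x) set \<Rightarrow> ('f, 'f^'x^'x) module" where
  "mat_algebra A =
     \<lparr>carrier = A, mult = (**), one = mat 1, zero = 0, add = (+), smult = mat_scale\<rparr>"


section \<open>Modules over noncommutative rings\<close>

text \<open>
  The locale \<open>module\<close> of HOL-Algebra requires a commutative ring, so left modules are introduced
  here, on the same record type; its fields \<open>mult\<close> and \<open>one\<close> play no role for modules. The locale
  \<open>Module.submodule\<close> and the set \<open>module_hom\<close> involve no commutativity and are reused (the locale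
  \<open>LinearCombinations.submodule\<close> does presuppose a commutative ring).
\<close>

locale left_module = R?: ring R + M?: abelian_group M
  for R :: "('a, 'c) ring_scheme" (structure) and M :: "('a, 'b, 'm) module_scheme" (structure) +
  assumes smult_closed: "\<lbrakk>a \<in> carrier R; u \<in> carrier M\<rbrakk> \<Longrightarrow> a \<odot>\<^bsub>M\<^esub> u \<in> carrier M"
    and smult_l_distr: "\<lbrakk>a \<in> carrier R; b \<in> carrier R; u \<in> carrier M\<rbrakk> \<Longrightarrow>
      (a \<oplus>\<^bsub>R\<^esub> b) \<odot>\<^bsub>M\<^esub> u = a \<odot>\<^bsub>M\<^esub> u \<oplus>\<^bsub>M\<^esub> b \<odot>\<^bsub>M\<^esub> u"
    and smult_r_distr: "\<lbrakk>a \<in> carrier R; u \<in> carrier M; v \<in> carrier M\<rbrakk> \<Longrightarrow>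
      a \<odot>\<^bsub>M\<^esub> (u \<oplus>\<^bsub>M\<^esub> v) = a \<odot>\<^bsub>M\<^esub> u \<oplus>\<^bsub>M\<^esub> a \<odot>\<^bsub>M\<^esub> v"
    and smult_assoc: "\<lbrakk>a \<in> carrier R; b \<in> carrier R; u \<in> carrier M\<rbrakk> \<Longrightarrow>
      (a \<otimes>\<^bsub>R\<^esub> b) \<odot>\<^bsub>M\<^esub> u = a \<odot>\<^bsub>M\<^esub> (b \<odot>\<^bsub>M\<^esub> u)"
    and smult_one: "u \<in> carrier M \<Longrightarrow> \<one>\<^bsub>R\<^esub> \<odot>\<^bsub>M\<^esub> u = u"

definition fg_left_module :: "('a, 'c) ring_scheme \<Rightarrow> ('a, 'b, 'm) module_scheme \<Rightarrow> bool" where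
  "fg_left_module R M \<longleftrightarrow> left_module R M \<and>
     (\<exists>G. finite G \<and> G \<subseteq> carrier M \<and>
        (\<forall>N. Module.submodule N R M \<and> G \<subseteq> N \<longrightarrow> N = carrier M))"

definition modules_isomorphic ::
  "('a, 'c) ring_scheme \<Rightarrow> ('a, 'b, 'm) module_scheme \<Rightarrow> ('a, 'e, 'n) module_scheme \<Rightarrow> bool" where
  "modules_isomorphic R M N \<longleftrightarrow> (\<exists>f\<in>module_hom R M N. bij_betw f (carrier M) (carrier N))"

definition irreducible_module :: "('a, 'c) ring_scheme \<Rightarrow> ('a, 'b, 'm) module_scheme \<Rightarrow> bool" where
  "irreducible_module R M \<longleftrightarrow> left_module R M \<and> carrier M \<noteq> {\<zero>\<^bsub>M\<^esub>} \<and>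
     (\<forall>N. Module.submodule N R M \<longrightarrow> N = {\<zero>\<^bsub>M\<^esub>} \<or> N = carrier M)"

definition internal_direct_sum ::
  "('a, 'c) ring_scheme \<Rightarrow> ('a, 'b, 'm) module_scheme \<Rightarrow> 'i set \<Rightarrow> ('i \<Rightarrow> 'b set) \<Rightarrow> bool" where
  "internal_direct_sum R M I V \<longleftrightarrow> finite I \<and> (\<forall>i\<in>I. Module.submodule (V i) R M) \<and>
     (\<forall>u\<in>carrier M. \<exists>!v. v \<in> Pi\<^sub>E I V \<and> u = finsum M v I)"

definition indecomposable_module :: "('a, 'c) ring_scheme \<Rightarrow> ('a, 'b, 'm) module_scheme \<Rightarrow> bool" where
  "indecomposable_module R M \<longleftrightarrow> left_module R M \<and> carrier M \<noteq> {\<zero>\<^bsub>M\<^esub>} \<and>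
     (\<forall>N1 N2. Module.submodule N1 R M \<and> Module.submodule N2 R M \<and>
        N1 \<inter> N2 = {\<zero>\<^bsub>M\<^esub>} \<and> N1 <+>\<^bsub>M\<^esub> N2 = carrier M \<longrightarrow>
        N1 = {\<zero>\<^bsub>M\<^esub>} \<or> N2 = {\<zero>\<^bsub>M\<^esub>})"

definition annihilator :: "('a, 'c) ring_scheme \<Rightarrow> ('a, 'b, 'm) module_scheme \<Rightarrow> 'a set" where
  "annihilator R M = {a \<in> carrier R. \<forall>u\<in>carrier M. a \<odot>\<^bsub>M\<^esub> u = \<zero>\<^bsub>M\<^esub>}"

definition regular_module :: "('a, 'c) ring_scheme \<Rightarrow> ('a, 'a) module" where
  "regular_module R = \<lparr>carrier = carrier R, mult = mult R, one = one R,
     zero = zero R, add = add R, smult = mult R\<rparr>"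

definition maximal_left_ideal :: "('a, 'c) ring_scheme \<Rightarrow> 'a set \<Rightarrow> bool" where
  "maximal_left_ideal R I \<longleftrightarrow> Module.submodule I R (regular_module R) \<and> I \<noteq> carrier R \<and>
     (\<forall>K. Module.submodule K R (regular_module R) \<and> I \<subseteq> K \<longrightarrow> K = I \<or> K = carrier R)"

definition jacobson_radical :: "('a, 'c) ring_scheme \<Rightarrow> 'a set" where
  "jacobson_radical R = carrier R \<inter> \<Inter>{I. maximal_left_ideal R I}"


section \<open>Modules over an algebra of matrices\<close>

text \<open>
  A module over a unital algebra of matrices is a vector space over the field through the scalar
  matrices \<open>mat c\<close>. The second argument below is a subspace of the module.
\<close>

definition scalar_space ::
  "('f::field^'x^'x, 'u) module \<Rightarrow> 'u set \<Rightarrow> ('f, 'u) module" where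
  "scalar_space U N = \<lparr>carrier = N, mult = mult U, one = one U, zero = zero U, add = add U,
     smult = (\<lambda>c u. mat c \<odot>\<^bsub>U\<^esub> u)\<rparr>"

definition scalar_dim :: "('f::field^'x^'x, 'u) module \<Rightarrow> 'u set \<Rightarrow> nat" where
  "scalar_dim U N = vectorspace.dim (ring_of_type_algebra :: 'f ring) (scalar_space U N)"

definition linear_functionals :: "('f::field^'x^'x, 'u) module \<Rightarrow> ('u \<Rightarrow> 'f) set" where
  "linear_functionals U = {\<psi> \<in> carrier U \<rightarrow>\<^sub>E UNIV.
     (\<forall>u\<in>carrier U. \<forall>v\<in>carrier U. \<psi> (u \<oplus>\<^bsub>U\<^esub> v) = \<psi> u + \<psi> v) \<and>
     (\<forall>c. \<forall>u\<in>carrier U. \<psi> (mat c \<odot>\<^bsub>U\<^esub> u) = c * \<psi> u)}"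

definition contragredient :: "('f::field^'x^'x, 'u) module \<Rightarrow> ('f^'x^'x, 'u \<Rightarrow> 'f) module" where
  "contragredient U = \<lparr>carrier = linear_functionals U,
     mult = (\<lambda>\<phi> \<psi>. \<lambda>u\<in>carrier U. 0), one = (\<lambda>u\<in>carrier U. 0),
     zero = (\<lambda>u\<in>carrier U. 0), add = (\<lambda>\<phi> \<psi>. \<lambda>u\<in>carrier U. \<phi> u + \<psi> u),
     smult = (\<lambda>Z \<psi>. \<lambda>u\<in>carrier U. \<psi> (transpose Z \<odot>\<^bsub>U\<^esub> u))\<rparr>"

definition vec_module :: "('f::field^'x) set \<Rightarrow> ('f^'x^'x, 'f^'x) module" where
  "vec_module W = \<lparr>carrier = W, mult = (\<lambda>u v. 0), one = 0, zero = 0, add = (+), smult = (*v)\<rparr>"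


section \<open>Matrix algebras over division algebras\<close>

locale division_algebra = D?: ring D + vectorspace "ring_of_type_algebra :: 'f ring" D
  for D :: "('f::field, 'b, 'm) module_scheme" (structure) +
  assumes units: "Units D = carrier D - {\<zero>\<^bsub>D\<^esub>}"
    and scale_mult: "\<lbrakk>a \<in> carrier D; b \<in> carrier D\<rbrakk> \<Longrightarrow>
      (c \<odot>\<^bsub>D\<^esub> a) \<otimes>\<^bsub>D\<^esub> b = c \<odot>\<^bsub>D\<^esub> (a \<otimes>\<^bsub>D\<^esub> b)"
    and mult_scale: "\<lbrakk>a \<in> carrier D; b \<in> carrier D\<rbrakk> \<Longrightarrow>
      a \<otimes>\<^bsub>D\<^esub> (c \<odot>\<^bsub>D\<^esub> b) = c \<odot>\<^bsub>D\<^esub> (a \<otimes>\<^bsub>D\<^esub> b)"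

definition full_matrix_algebra ::
  "nat \<Rightarrow> ('f, 'b, 'm) module_scheme \<Rightarrow> ('f, nat \<times> nat \<Rightarrow> 'b) module" where
  "full_matrix_algebra n D = \<lparr>carrier = {..<n} \<times> {..<n} \<rightarrow>\<^sub>E carrier D,
     mult = (\<lambda>Y Z. \<lambda>(i, k)\<in>{..<n} \<times> {..<n}.
       finsum D (\<lambda>j. Y (i, j) \<otimes>\<^bsub>D\<^esub> Z (j, k)) {..<n}),
     one = (\<lambda>(i, k)\<in>{..<n} \<times> {..<n}. if i = k then \<one>\<^bsub>D\<^esub> else \<zero>\<^bsub>D\<^esub>),
     zero = (\<lambda>(i, k)\<in>{..<n} \<times> {..<n}. \<zero>\<^bsub>D\<^esub>),
     add = (\<lambda>Y Z. \<lambda>(i, k)\<in>{..<n} \<times> {..<n}. Y (i, k) \<oplus>\<^bsub>D\<^esub> Z (i, k)),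
     smult = (\<lambda>c Z. \<lambda>(i, k)\<in>{..<n} \<times> {..<n}. c \<odot>\<^bsub>D\<^esub> Z (i, k))\<rparr>"

text \<open>Preservation of \<open>one\<close> is not required, since the first algebra need not be unital.\<close>

definition algebras_isomorphic ::
  "('f, 'a, 'm) module_scheme \<Rightarrow> ('f, 'b, 'n) module_scheme \<Rightarrow> bool" where
  "algebras_isomorphic A B \<longleftrightarrow> (\<exists>f. bij_betw f (carrier A) (carrier B) \<and>
     (\<forall>a\<in>carrier A. \<forall>b\<in>carrier A.
        f (a \<oplus>\<^bsub>A\<^esub> b) = f a \<oplus>\<^bsub>B\<^esub> f b \<and> f (a \<otimes>\<^bsub>A\<^esub> b) = f a \<otimes>\<^bsub>B\<^esub> f b) \<and>
     (\<forall>c. \<forall>a\<in>carrier A. f (c \<odot>\<^bsub>A\<^esub> a) = c \<odot>\<^bsub>B\<^esub> f a))"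


section \<open>Equivalence of several statements\<close>

definition all_equivalent :: "bool list \<Rightarrow> bool" where
  "all_equivalent Ps \<longleftrightarrow> (\<forall>P\<in>set Ps. \<forall>Q\<in>set Ps. P \<longleftrightarrow> Q)"

end

theory Submission
  imports Defs
begin

(* Below, $ selects components of vectors, not coefficients of power series. *)
unbundle no Formal_Power_Series.fps_syntax

text \<open>
  Write \<open>X\<^sub>i\<close> for the set of \<open>y\<close> with \<open>(x, y) \<in> R i\<close> (a shell), \<open>w i\<close> for its indicator vector and
  \<open>k i\<close> for its size, the valency. The primary module \<open>W\<close> consists of the vectors that are constant on
  shells, and the primary ideal \<open>B\<close> is spanned by the rank one matrices \<open>outer u v = u v\<^sup>t\<close> with
  \<open>u, v \<in> W\<close>. Since \<open>T\<close> is closed under transposition and preserves \<open>W\<close>, everything is governed by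
  the standard bilinear form \<open>dot\<close> on \<open>W\<close>: its adjoints are the transposes, the \<open>w i\<close> are orthogonal,
  and \<open>dot (w i) (w i) = k i\<close>. Hence the scheme is \<open>p'\<close>-valenced if and only if this form is
  nondegenerate, and each of the other statements is shown to be equivalent to nondegeneracy.

  If the form is nondegenerate, the \<open>outer (w i) (w j)\<close> are matrix units up to the invertible scalars
  \<open>k j\<close>. So \<open>B\<close> is a matrix algebra over the field, its identity is central because \<open>B\<close> is an ideal,
  a complement is the annihilator of that identity, \<open>W\<close> is irreducible, and the form identifies \<open>W\<close>
  with its contragredient. If instead \<open>k i = 0\<close> in the field, the matrix \<open>outer (w 0) (w i)\<close> is the
  universal counterexample: it is nonzero, kills \<open>W\<close> and \<open>B\<close> from the left, generates a left ideal of square zero,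
  and is fixed by left multiplication with \<open>E 0 = outer (w 0) (w 0)\<close>.

  For a thin relation \<open>R j\<close> the shell is a single point and \<open>E j = outer (w j) (w j)\<close>, so the left ideal
  \<open>T E j\<close> is a copy of \<open>W\<close>. Therefore every vector \<open>u\<close> of a \<open>T\<close>-module with \<open>E j u = u\<close> is the image
  of \<open>w j\<close> under a homomorphism from \<open>W\<close>, which is injective for a nondegenerate form if \<open>u \<noteq> 0\<close>
  (\<open>hom_from_primary_module\<close>). This gives the characterisations of \<open>W\<close> among all modules. They fail
  in the degenerate case: there \<open>W\<close> is reducible, and the contragredient of \<open>W\<close> has the same
  dimensions as \<open>W\<close> but is not isomorphic to it.

  For the decompositions of \<open>T\<close>, multiplication by \<open>E 0\<close> turns \<open>T = \<Oplus> V i\<close> into a decomposition of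
  \<open>E 0 T\<close>, which has dimension \<open>d + 1\<close>. Every copy of \<open>W\<close> contributes exactly one dimension. In the
  nondegenerate case an indecomposable \<open>V i\<close> with \<open>E 0 V i \<noteq> 0\<close> is a copy of \<open>W\<close>
  (\<open>indecomposable_summand_isomorphic\<close>), so there are exactly \<open>d + 1\<close> copies. Conversely, if there are
  \<open>d + 1\<close> copies, then \<open>E 0\<close> kills the other summands; as the copies lie in \<open>B\<close>, the matrix
  \<open>outer (w 0) (w i)\<close> with \<open>k i = 0\<close> would kill all of \<open>T\<close>.
\<close>

section \<open>Left modules\<close>

context left_module
begin

lemma smult_zero_right: "a \<in> carrier R \<Longrightarrow> a \<odot>\<^bsub>M\<^esub> \<zero>\<^bsub>M\<^esub> = \<zero>\<^bsub>M\<^esub>"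
  by (metis M.add.r_cancel_one M.zero_closed M.l_zero smult_closed smult_r_distr)

lemma smult_zero_left: "u \<in> carrier M \<Longrightarrow> \<zero>\<^bsub>R\<^esub> \<odot>\<^bsub>M\<^esub> u = \<zero>\<^bsub>M\<^esub>"
  by (metis M.add.r_cancel_one R.zero_closed R.l_zero smult_closed smult_l_distr)

lemma minus_eq_smult: "u \<in> carrier M \<Longrightarrow> \<ominus>\<^bsub>M\<^esub> u = (\<ominus>\<^bsub>R\<^esub> \<one>\<^bsub>R\<^esub>) \<odot>\<^bsub>M\<^esub> u"
  by (metis M.minus_equality R.add.inv_closed R.l_neg R.one_closed smult_closed smult_l_distr
      smult_one smult_zero_left)

text \<open>Closure under negation comes from multiplication by \<open>- 1\<close>.\<close>

lemma submodule_iff: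
  "Module.submodule N R M \<longleftrightarrow> N \<subseteq> carrier M \<and> \<zero>\<^bsub>M\<^esub> \<in> N \<and>
     (\<forall>u\<in>N. \<forall>v\<in>N. u \<oplus>\<^bsub>M\<^esub> v \<in> N) \<and> (\<forall>a\<in>carrier R. \<forall>u\<in>N. a \<odot>\<^bsub>M\<^esub> u \<in> N)"
  (is "?L \<longleftrightarrow> ?R")
proof
  assume ?L
  then interpret N: Module.submodule N R M .
  show ?R
    using N.subset N.one_closed N.m_closed N.smult_closed by auto
next
  assume r: ?R
  have "\<ominus>\<^bsub>M\<^esub> u \<in> N" if "u \<in> N" for u
    using r that minus_eq_smult[of u] by auto
  then show ?L
    using r unfolding Module.submodule_def Module.submodule_axioms_def
    by (auto intro!: subgroup.intro simp: a_inv_def)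
qed

lemma left_module_submodule:
  assumes "Module.submodule N R M"
  shows "left_module R (M\<lparr>carrier := N\<rparr>)"
proof -
  have N: "N \<subseteq> carrier M" "\<zero>\<^bsub>M\<^esub> \<in> N" "\<And>u v. u \<in> N \<Longrightarrow> v \<in> N \<Longrightarrow> u \<oplus>\<^bsub>M\<^esub> v \<in> N"
    "\<And>a u. a \<in> carrier R \<Longrightarrow> u \<in> N \<Longrightarrow> a \<odot>\<^bsub>M\<^esub> u \<in> N"
    using assms by (auto simp: submodule_iff)
  have "\<exists>v\<in>N. v \<oplus>\<^bsub>M\<^esub> u = \<zero>\<^bsub>M\<^esub>" if "u \<in> N" for u
    using N minus_eq_smult[of u] that by (metis M.l_neg R.add.inv_closed R.one_closed subsetD)
  then have "abelian_group (M\<lparr>carrier := N\<rparr>)"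
    by (intro abelian_groupI) (use N in \<open>auto simp: subset_iff M.add.m_assoc intro: M.add.m_comm\<close>)
  then show ?thesis
    using N R.ring_axioms unfolding left_module_def left_module_axioms_def
    by (auto simp: smult_l_distr smult_r_distr smult_assoc smult_one subset_iff)
qed

end

lemma submodule_subset: "Module.submodule N R M \<Longrightarrow> N \<subseteq> carrier M"
  using subgroup.subset[of N "add_monoid M"] by (simp add: Module.submodule_def)

lemma irreducible_moduleD:
  assumes "irreducible_module R M" "Module.submodule N R M"
  shows "N = {\<zero>\<^bsub>M\<^esub>} \<or> N = carrier M"
  using assms by (auto simp: irreducible_module_def)

subsection \<open>Homomorphisms and isomorphisms\<close>

lemma module_hom_zero:
  assumes "left_module R M" "left_module R N" "f \<in> module_hom R M N"
  shows "f \<zero>\<^bsub>M\<^esub> = \<zero>\<^bsub>N\<^esub>"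
proof -
  interpret M: left_module R M by fact
  interpret N: left_module R N by fact
  have "f \<zero>\<^bsub>M\<^esub> = f (\<zero>\<^bsub>R\<^esub> \<odot>\<^bsub>M\<^esub> \<zero>\<^bsub>M\<^esub>)"
    by (simp add: M.smult_zero_left)
  also have "\<dots> = \<zero>\<^bsub>R\<^esub> \<odot>\<^bsub>N\<^esub> f \<zero>\<^bsub>M\<^esub>"
    using assms(3) by (auto simp: module_hom_def)
  finally show ?thesis
    using assms(3) by (auto simp: module_hom_def N.smult_zero_left Pi_iff)
qed

lemma submodule_image:
  assumes "left_module R M" "left_module R N" "f \<in> module_hom R M N"
  shows "Module.submodule (f ` carrier M) R N"
proof -
  interpret M: left_module R M by fact
  interpret N: left_module R N by fact
  have f: "\<And>u. u \<in> carrier M \<Longrightarrow> f u \<in> carrier N"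
    "\<And>u v. u \<in> carrier M \<Longrightarrow> v \<in> carrier M \<Longrightarrow> f u \<oplus>\<^bsub>N\<^esub> f v = f (u \<oplus>\<^bsub>M\<^esub> v)"
    "\<And>a u. a \<in> carrier R \<Longrightarrow> u \<in> carrier M \<Longrightarrow> a \<odot>\<^bsub>N\<^esub> f u = f (a \<odot>\<^bsub>M\<^esub> u)"
    using assms(3) by (auto simp: module_hom_def)
  show ?thesis
    unfolding N.submodule_iff using f module_hom_zero[OF assms] M.smult_closed
    by (auto intro!: image_eqI[of "\<zero>\<^bsub>N\<^esub>" f "\<zero>\<^bsub>M\<^esub>"])
qed

lemma submodule_vimage:
  assumes "left_module R M" "left_module R N" "f \<in> module_hom R M N" "Module.submodule N' R N"
  shows "Module.submodule {u \<in> carrier M. f u \<in> N'} R M"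
proof -
  interpret M: left_module R M by fact
  interpret N: left_module R N by fact
  show ?thesis
    using assms(3,4) module_hom_zero[OF assms(1-3)] M.smult_closed
    unfolding N.submodule_iff M.submodule_iff module_hom_def by auto
qed

lemma modules_isomorphic_sym:
  assumes "left_module R M" "modules_isomorphic R M N"
  shows "modules_isomorphic R N M"
proof -
  interpret M: left_module R M by fact
  obtain f where f: "f \<in> module_hom R M N" "bij_betw f (carrier M) (carrier N)"
    using assms by (auto simp: modules_isomorphic_def)
  let ?g = "inv_into (carrier M) f"
  have inv: "?g (f u) = u" if "u \<in> carrier M" for u
    using f(2) that by (rule bij_betw_inv_into_left)
  have surj: "\<exists>u\<in>carrier M. v = f u" if "v \<in> carrier N" for v
    using f(2) that by (auto simp: bij_betw_def)
  have hom_add: "f u \<oplus>\<^bsub>N\<^esub> f v = f (u \<oplus>\<^bsub>M\<^esub> v)" if "u \<in> carrier M" "v \<in> carrier M" for u v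
    using f(1) that by (auto simp: module_hom_def)
  have hom_smult: "a \<odot>\<^bsub>N\<^esub> f u = f (a \<odot>\<^bsub>M\<^esub> u)" if "a \<in> carrier R" "u \<in> carrier M" for a u
    using f(1) that by (auto simp: module_hom_def)
  have add: "?g (v \<oplus>\<^bsub>N\<^esub> w) = ?g v \<oplus>\<^bsub>M\<^esub> ?g w" if "v \<in> carrier N" "w \<in> carrier N" for v w
    using surj[OF that(1)] surj[OF that(2)] hom_add by (auto simp: inv)
  have smult: "?g (a \<odot>\<^bsub>N\<^esub> v) = a \<odot>\<^bsub>M\<^esub> ?g v" if "a \<in> carrier R" "v \<in> carrier N" for a v
    using surj[OF that(2)] that(1) hom_smult by (auto simp: inv M.smult_closed)
  have "?g \<in> module_hom R N M"
    using add smult bij_betwE[OF bij_betw_inv_into[OF f(2)]] by (auto simp: module_hom_def)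
  then show ?thesis
    unfolding modules_isomorphic_def using bij_betw_inv_into[OF f(2)] by blast
qed

lemma modules_isomorphic_trans:
  assumes "modules_isomorphic R L M" "modules_isomorphic R M N"
  shows "modules_isomorphic R L N"
proof -
  obtain f g where f: "f \<in> module_hom R L M" "bij_betw f (carrier L) (carrier M)"
    and g: "g \<in> module_hom R M N" "bij_betw g (carrier M) (carrier N)"
    using assms by (auto simp: modules_isomorphic_def)
  have "g \<circ> f \<in> module_hom R L N"
    using f(1) g(1) by (auto simp: module_hom_def Pi_iff)
  then show ?thesis
    unfolding modules_isomorphic_def using bij_betw_trans[OF f(2) g(2)] by blast
qed

lemma irreducible_module_isomorphic:
  assumes "irreducible_module R M" "left_module R N" "modules_isomorphic R M N"
  shows "irreducible_module R N"
proof -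
  have M: "left_module R M" "carrier M \<noteq> {\<zero>\<^bsub>M\<^esub>}"
    using assms(1) by (auto simp: irreducible_module_def)
  obtain f where f: "f \<in> module_hom R M N" "bij_betw f (carrier M) (carrier N)"
    using assms by (auto simp: modules_isomorphic_def)
  have f0: "f \<zero>\<^bsub>M\<^esub> = \<zero>\<^bsub>N\<^esub>"
    using module_hom_zero[OF M(1) assms(2) f(1)] .
  have im: "carrier N = f ` carrier M"
    using f(2) by (simp add: bij_betw_def)
  have zM: "\<zero>\<^bsub>M\<^esub> \<in> carrier M"
    using M(1) by (simp add: left_module_def abelian_group_def abelian_monoid.zero_closed)
  have "N' = {\<zero>\<^bsub>N\<^esub>} \<or> N' = carrier N" if "Module.submodule N' R N" for N'
  proof -
    have "N' \<subseteq> carrier N"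
      using that(1) by (rule submodule_subset)
    then have "N' = f ` {u \<in> carrier M. f u \<in> N'}"
      unfolding im by auto
    moreover have "{u \<in> carrier M. f u \<in> N'} = {\<zero>\<^bsub>M\<^esub>} \<or> {u \<in> carrier M. f u \<in> N'} = carrier M"
      using irreducible_moduleD[OF assms(1) submodule_vimage[OF M(1) assms(2) f(1) that]] .
    ultimately show ?thesis
      using im f0 by (elim disjE) simp_all
  qed
  moreover have "carrier N \<noteq> {\<zero>\<^bsub>N\<^esub>}"
  proof
    assume "carrier N = {\<zero>\<^bsub>N\<^esub>}"
    moreover have "f u \<in> carrier N" if "u \<in> carrier M" for u
      using that im by simp
    ultimately have "f u = f \<zero>\<^bsub>M\<^esub>" if "u \<in> carrier M" for u
      using that f0 by simp
    then have "u = \<zero>\<^bsub>M\<^esub>" if "u \<in> carrier M" for u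
      using that zM bij_betw_imp_inj_on[OF f(2)] by (meson inj_onD)
    then show False
      using M(2) zM by blast
  qed
  ultimately show ?thesis
    using assms(2) by (auto simp: irreducible_module_def)
qed

lemma fg_left_module_isomorphic:
  assumes "fg_left_module R M" "left_module R N" "modules_isomorphic R M N"
  shows "fg_left_module R N"
proof -
  obtain G where M: "left_module R M" and G: "finite G" "G \<subseteq> carrier M"
    and gen: "\<And>M'. Module.submodule M' R M \<Longrightarrow> G \<subseteq> M' \<Longrightarrow> M' = carrier M"
    using assms(1) by (auto simp: fg_left_module_def)
  obtain f where f: "f \<in> module_hom R M N" "bij_betw f (carrier M) (carrier N)"
    using assms by (auto simp: modules_isomorphic_def)
  have im: "carrier N = f ` carrier M"
    using f(2) by (simp add: bij_betw_def)
  have "N' = carrier N" if "Module.submodule N' R N" "f ` G \<subseteq> N'" for N'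
  proof -
    have "G \<subseteq> {u \<in> carrier M. f u \<in> N'}"
      using that(2) G(2) by auto
    with submodule_vimage[OF M assms(2) f(1) that(1)] have "{u \<in> carrier M. f u \<in> N'} = carrier M"
      by (rule gen)
    moreover have "N' \<subseteq> carrier N"
      using that(1) by (rule submodule_subset)
    ultimately show ?thesis
      using im by auto
  qed
  then show ?thesis
    using assms(2) G im unfolding fg_left_module_def by (intro conjI exI[of _ "f ` G"]) auto
qed

text \<open>An injection of the carrier into another type carries the module structure along. This
  produces copies of given modules on a prescribed type.\<close>

definition transport_module ::
  "('b \<Rightarrow> 'u) \<Rightarrow> ('a, 'b) module \<Rightarrow> ('a, 'u) module" where
  "transport_module h M = (let g = inv_into (carrier M) h in
     \<lparr>carrier = h ` carrier M, mult = (\<lambda>u v. h (mult M (g u) (g v))), one = h (one M),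
      zero = h (zero M), add = (\<lambda>u v. h (add M (g u) (g v))),
      smult = (\<lambda>a u. h (smult M a (g u)))\<rparr>)"

lemma transport_module:
  assumes "left_module R M" and inj: "inj_on h (carrier M)"
  shows "left_module R (transport_module h M)"
    and "modules_isomorphic R M (transport_module h M)"
proof -
  interpret M: left_module R M by fact
  have inv: "inv_into (carrier M) h (h u) = u" if "u \<in> carrier M" for u
    using inj that by simp
  let ?U = "transport_module h M"
  have add: "h u \<oplus>\<^bsub>?U\<^esub> h v = h (u \<oplus>\<^bsub>M\<^esub> v)" if "u \<in> carrier M" "v \<in> carrier M" for u v
    using that by (simp add: transport_module_def Let_def inv)
  have smult: "a \<odot>\<^bsub>?U\<^esub> h u = h (a \<odot>\<^bsub>M\<^esub> u)" if "u \<in> carrier M" for a u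
    using that by (simp add: transport_module_def Let_def inv)
  have U: "carrier ?U = h ` carrier M" "\<zero>\<^bsub>?U\<^esub> = h \<zero>\<^bsub>M\<^esub>"
    by (simp_all add: transport_module_def Let_def)
  have "abelian_group ?U"
  proof (intro abelian_groupI, unfold U ball_simps, goal_cases)
    case (6 u)
    then show ?case
      using M.l_neg by (auto simp: add intro!: bexI[of _ "\<ominus>\<^bsub>M\<^esub> _"])
  next
    case (4 u v)
    then show ?case by (auto simp: add M.add.m_comm)
  qed (auto simp: add M.add.m_assoc)
  moreover have "left_module_axioms R ?U"
  proof (rule left_module_axioms.intro, unfold U, goal_cases)
    case (1 a u) then show ?case by (auto simp: smult M.smult_closed)
  next
    case (2 a b u) then show ?case by (auto simp: smult add M.smult_closed M.smult_l_distr)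
  next
    case (3 a u v) then show ?case by (auto simp: smult add M.smult_closed M.smult_r_distr)
  next
    case (4 a b u) then show ?case by (auto simp: smult M.smult_closed M.smult_assoc)
  next
    case (5 u) then show ?case by (auto simp: smult M.smult_one)
  qed
  ultimately show "left_module R ?U"
    using M.R.ring_axioms by (simp add: left_module_def)
  have "h \<in> module_hom R M (transport_module h M)"
    using U add smult by (auto simp: module_hom_def)
  moreover have "bij_betw h (carrier M) (carrier (transport_module h M))"
    using inj U by (simp add: bij_betw_def)
  ultimately show "modules_isomorphic R M (transport_module h M)"
    by (auto simp: modules_isomorphic_def)
qed

section \<open>Dimensions over the field of scalars\<close>

abbreviation scalar_field :: "'f::field ring" where
  "scalar_field \<equiv> ring_of_type_algebra"

lemma scalar_field_simps [simp]:
  "carrier scalar_field = UNIV" "\<zero>\<^bsub>scalar_field\<^esub> = (0::'f::field)" "\<one>\<^bsub>scalar_field\<^esub> = (1::'f)"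
  "a \<oplus>\<^bsub>scalar_field\<^esub> b = (a + b::'f)" "a \<otimes>\<^bsub>scalar_field\<^esub> b = (a * b::'f)"
  by (simp_all add: ring_of_type_algebra_def)

lemma scale_eq_mat_mult: "mat_scale c Z = mat c ** (Z :: 'f::field^'x^'x)"
  by (simp add: mat_scale_def vec_eq_iff matrix_matrix_mult_def mat_def if_distrib[of "\<lambda>t. t * _"]
      cong: if_cong)

lemma mat_eq_scale: "mat c = mat_scale c (mat 1 :: 'f::field^'x^'x)"
  by (simp add: scale_eq_mat_mult)

lemma mat_mult_mat: "mat a ** mat b = (mat (a * b) :: 'f::field^'x^'x)"
  by (metis scale_eq_mat_mult mat_eq_scale mat_space.scale_scale)

lemma mat_add: "mat (a + b) = (mat a + mat b :: 'f::field^'x^'x)"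
  by (metis mat_eq_scale mat_space.scale_left_distrib)

lemma mat_mem: "unital_subalgebra A \<Longrightarrow> mat c \<in> A"
  by (metis mat_eq_scale mat_space.subspace_scale unital_subalgebra_def)

lemma mat_algebra_simps [simp]:
  "carrier (mat_algebra A) = A" "\<zero>\<^bsub>mat_algebra A\<^esub> = 0" "\<one>\<^bsub>mat_algebra A\<^esub> = mat 1"
  "Y \<oplus>\<^bsub>mat_algebra A\<^esub> Z = Y + Z" "Y \<otimes>\<^bsub>mat_algebra A\<^esub> Z = Y ** Z"
  "c \<odot>\<^bsub>mat_algebra A\<^esub> Z = mat_scale c Z"
  by (simp_all add: mat_algebra_def)

definition scalar_subspace :: "('f::field^'x^'x, 'u) module \<Rightarrow> 'u set \<Rightarrow> bool" where
  "scalar_subspace U N \<longleftrightarrow> N \<subseteq> carrier U \<and> \<zero>\<^bsub>U\<^esub> \<in> N \<and>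
     (\<forall>u\<in>N. \<forall>v\<in>N. u \<oplus>\<^bsub>U\<^esub> v \<in> N) \<and> (\<forall>c. \<forall>u\<in>N. mat c \<odot>\<^bsub>U\<^esub> u \<in> N)"

lemma scalar_space_simps [simp]:
  "carrier (scalar_space U N) = N" "\<zero>\<^bsub>scalar_space U N\<^esub> = \<zero>\<^bsub>U\<^esub>"
  "u \<oplus>\<^bsub>scalar_space U N\<^esub> v = u \<oplus>\<^bsub>U\<^esub> v" "c \<odot>\<^bsub>scalar_space U N\<^esub> u = mat c \<odot>\<^bsub>U\<^esub> u"
  by (simp_all add: scalar_space_def)

lemma vectorspace_scalar_space:
  assumes A: "unital_subalgebra A" and U: "left_module (mat_algebra A) U"
    and N: "scalar_subspace U N"
  shows "vectorspace scalar_field (scalar_space U N)"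
proof -
  interpret U: left_module "mat_algebra A" U by fact
  have NU: "\<And>u. u \<in> N \<Longrightarrow> u \<in> carrier U"
    and N': "\<And>u v. u \<in> N \<Longrightarrow> v \<in> N \<Longrightarrow> u \<oplus>\<^bsub>U\<^esub> v \<in> N" "\<And>c u. u \<in> N \<Longrightarrow> mat c \<odot>\<^bsub>U\<^esub> u \<in> N" "\<zero>\<^bsub>U\<^esub> \<in> N"
    using N by (auto simp: scalar_subspace_def)
  have mem: "mat c \<in> carrier (mat_algebra A)" for c
    using mat_mem[OF A] by simp
  have neg: "\<exists>v\<in>N. u \<oplus>\<^bsub>U\<^esub> v = \<zero>\<^bsub>U\<^esub>" if "u \<in> N" for u
  proof
    show "mat (- 1) \<odot>\<^bsub>U\<^esub> u \<in> N"
      using N' that by simp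
    have "mat (1 + - 1) \<odot>\<^bsub>U\<^esub> u = mat 1 \<odot>\<^bsub>U\<^esub> u \<oplus>\<^bsub>U\<^esub> mat (- 1) \<odot>\<^bsub>U\<^esub> u"
      unfolding mat_add using U.smult_l_distr[OF mem mem] NU[OF that] by simp
    moreover have "mat (1 + - 1) \<odot>\<^bsub>U\<^esub> u = \<zero>\<^bsub>U\<^esub>"
      using U.smult_zero_left[OF NU[OF that]] by (simp add: mat_0)
    ultimately show "u \<oplus>\<^bsub>U\<^esub> mat (- 1) \<odot>\<^bsub>U\<^esub> u = \<zero>\<^bsub>U\<^esub>"
      using U.smult_one[OF NU[OF that]] by simp
  qed
  show ?thesis
  proof (rule vs_criteria, goal_cases)
    case 1 then show ?case by blast
  next
    case 9 then show ?case
      using U.smult_assoc[OF mem mem] NU by (simp add: mat_mult_mat)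
  next
    case 11 then show ?case
      using U.smult_l_distr[OF mem mem] NU by (simp add: mat_add)
  next
    case 12 then show ?case
      using U.smult_r_distr[OF mem] NU by simp
  next
    case 10 then show ?case
      using U.smult_one NU by simp
  next
    case 6 then show ?case
      using U.M.a_comm NU by simp
  qed (use N' neg NU in \<open>auto simp: U.M.a_assoc\<close>)
qed

text \<open>Coordinate functionals dual to a family of vectors make it a basis as soon as they separate
  points.\<close>

lemma dim_eq_card_coordinates:
  fixes g :: "nat \<Rightarrow> 'v \<Rightarrow> 'f::field"
  assumes "vectorspace scalar_field V"
    and b: "\<And>i. i < n \<Longrightarrow> b i \<in> carrier V"
    and add: "\<And>i u v. i < n \<Longrightarrow> u \<in> carrier V \<Longrightarrow> v \<in> carrier V \<Longrightarrow> g i (u \<oplus>\<^bsub>V\<^esub> v) = g i u + g i v"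
    and smult: "\<And>i c u. i < n \<Longrightarrow> u \<in> carrier V \<Longrightarrow> g i (c \<odot>\<^bsub>V\<^esub> u) = c * g i u"
    and dual: "\<And>i j. i < n \<Longrightarrow> j < n \<Longrightarrow> g i (b j) = (if i = j then 1 else 0)"
    and sep: "\<And>u. u \<in> carrier V \<Longrightarrow> (\<And>i. i < n \<Longrightarrow> g i u = 0) \<Longrightarrow> u = \<zero>\<^bsub>V\<^esub>"
  shows "vectorspace.fin_dim scalar_field V" "vectorspace.dim scalar_field V = n"
proof -
  interpret V: vectorspace scalar_field V by fact
  let ?A = "b ` {..<n}"
  have inj: "inj_on b {..<n}"
  proof (rule inj_onI)
    fix i j assume "i \<in> {..<n}" "j \<in> {..<n}" "b i = b j"
    then show "i = j"
      using dual[of i i] dual[of i j] by (auto split: if_splits)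
  qed
  have A: "?A \<subseteq> carrier V" "finite ?A" "card ?A = n"
    using b inj by (auto simp: card_image)
  have g0: "g i \<zero>\<^bsub>V\<^esub> = 0" if "i < n" for i
    using smult[OF that, of "\<zero>\<^bsub>V\<^esub>" 0] by simp
  have lincomb: "g i (V.lincomb a S) = (\<Sum>v\<in>S. a v * g i v)"
    if "finite S" "S \<subseteq> carrier V" "i < n" for a S i
    using that
  proof (induction S)
    case empty
    then show ?case by (simp add: V.lincomb_def g0)
  next
    case (insert v S)
    have "V.lincomb a (insert v S) = a v \<odot>\<^bsub>V\<^esub> v \<oplus>\<^bsub>V\<^esub> V.lincomb a S"
      using insert by (intro V.lincomb_insert2) auto
    moreover have "V.lincomb a S \<in> carrier V"
      using insert by (intro V.lincomb_closed) auto
    ultimately show ?case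
      using insert by (simp add: add smult)
  qed
  have coord: "g i (V.lincomb a ?A) = a (b i)" if "i < n" for a i
  proof -
    have "g i (V.lincomb a ?A) = (\<Sum>j<n. a (b j) * g i (b j))"
      using lincomb[OF A(2,1) that] by (simp add: sum.reindex[OF inj])
    also have "\<dots> = (\<Sum>j<n. if i = j then a (b j) else 0)"
      by (intro sum.cong) (auto simp: dual that)
    finally show ?thesis
      using that by simp
  qed
  have "V.lin_indpt ?A"
  proof (rule V.finite_lin_indpt2[OF A(2,1)])
    fix a assume "V.lincomb a ?A = \<zero>\<^bsub>V\<^esub>"
    then show "\<forall>v\<in>?A. a v = \<zero>\<^bsub>scalar_field\<^esub>"
      using coord[of _ a] g0 by auto
  qed
  moreover have "V.gen_set ?A"
  proof (intro equalityI subsetI)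
    show "u \<in> carrier V" if "u \<in> V.span ?A" for u
      using that V.span_is_subset2[OF A(1)] by auto
  next
    fix u assume u: "u \<in> carrier V"
    define s where "s = V.lincomb (\<lambda>v. g (inv_into {..<n} b v) u) ?A"
    have s: "s \<in> carrier V"
      unfolding s_def using A by (intro V.lincomb_closed) auto
    have "g i s = g i u" if "i < n" for i
      unfolding s_def using coord[OF that] inj that by simp
    then have "g i (u \<oplus>\<^bsub>V\<^esub> (- 1) \<odot>\<^bsub>V\<^esub> s) = 0" if "i < n" for i
      using u s that by (simp add: add smult)
    then have "u \<oplus>\<^bsub>V\<^esub> (- 1) \<odot>\<^bsub>V\<^esub> s = \<zero>\<^bsub>V\<^esub>"
      using u s by (intro sep) auto
    moreover have "s \<oplus>\<^bsub>V\<^esub> (- 1) \<odot>\<^bsub>V\<^esub> s = \<zero>\<^bsub>V\<^esub>"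
      using V.smult_l_distr[of 1 "- 1" s] V.smult_one[OF s] V.lmult_0[OF s] s by simp
    ultimately have "u = s"
      using u s by (metis V.add.right_cancel V.smult_closed UNIV_I scalar_field_simps(1))
    then show "u \<in> V.span ?A"
      unfolding s_def using A(2) by (auto simp: V.span_def)
  qed
  ultimately have "V.basis ?A"
    using A by (simp add: V.basis_def)
  then show "V.fin_dim" "V.dim = n"
    using V.dim_basis[OF A(2)] A unfolding V.fin_dim_def V.basis_def by auto
qed

lemma scalar_dim_zero:
  assumes A: "unital_subalgebra A" and U: "left_module (mat_algebra A) U"
  shows "scalar_dim U {\<zero>\<^bsub>U\<^esub>} = 0"
proof -
  interpret U: left_module "mat_algebra A" U by fact
  have "scalar_subspace U {\<zero>\<^bsub>U\<^esub>}"
    using U.smult_zero_right mat_mem[OF A] by (auto simp: scalar_subspace_def)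
  from vectorspace_scalar_space[OF A U this] show ?thesis
    unfolding scalar_dim_def by (rule dim_eq_card_coordinates) auto
qed

lemma linear_map_scalar_space:
  assumes A: "unital_subalgebra A" and M: "left_module (mat_algebra A) M"
    and U: "left_module (mat_algebra A) U" and f: "f \<in> module_hom (mat_algebra A) M U"
    and N: "scalar_subspace M N" and N': "scalar_subspace U N'" and "f ` N \<subseteq> N'"
  shows "linear_map scalar_field (scalar_space M N) (scalar_space U N') f"
proof -
  have "N \<subseteq> carrier M"
    using N by (simp add: scalar_subspace_def)
  then have "f \<in> module_hom scalar_field (scalar_space M N) (scalar_space U N')"
    using f mat_mem[OF A] assms(7) by (auto simp: module_hom_def subset_iff)
  then show ?thesis
    using vectorspace_scalar_space[OF A M N] vectorspace_scalar_space[OF A U N']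
    by (simp add: linear_map_def mod_hom_def mod_hom_axioms_def vectorspace_def)
qed

lemma scalar_dim_image:
  assumes A: "unital_subalgebra A" and M: "left_module (mat_algebra A) M"
    and U: "left_module (mat_algebra A) U" and f: "f \<in> module_hom (mat_algebra A) M U"
    and N: "scalar_subspace M N" and inj: "inj_on f N"
    and fin: "vectorspace.fin_dim scalar_field (scalar_space M N)"
  shows "scalar_dim U (f ` N) = scalar_dim M N"
proof -
  have NM: "u \<in> carrier M" if "u \<in> N" for u
    using N that by (auto simp: scalar_subspace_def)
  have "scalar_subspace U (f ` N)"
    unfolding scalar_subspace_def
  proof (intro conjI ballI allI)
    show "f ` N \<subseteq> carrier U"
      using f NM by (auto simp: module_hom_def)
    show "\<zero>\<^bsub>U\<^esub> \<in> f ` N"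
      using module_hom_zero[OF M U f] N by (metis image_eqI scalar_subspace_def)
  next
    fix v w assume "v \<in> f ` N" "w \<in> f ` N"
    then obtain v' w' where vw: "v' \<in> N" "v = f v'" "w' \<in> N" "w = f w'"
      by auto
    then have "v \<oplus>\<^bsub>U\<^esub> w = f (v' \<oplus>\<^bsub>M\<^esub> w')"
      using module_hom_add[OF f] NM by simp
    moreover have "v' \<oplus>\<^bsub>M\<^esub> w' \<in> N"
      using N vw by (simp add: scalar_subspace_def)
    ultimately show "v \<oplus>\<^bsub>U\<^esub> w \<in> f ` N"
      by simp
  next
    fix c v assume "v \<in> f ` N"
    then obtain v' where v: "v' \<in> N" "v = f v'"
      by auto
    then have "mat c \<odot>\<^bsub>U\<^esub> v = f (mat c \<odot>\<^bsub>M\<^esub> v')"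
      using module_hom_smult[OF f] NM mat_mem[OF A] by simp
    moreover have "mat c \<odot>\<^bsub>M\<^esub> v' \<in> N"
      using N v by (simp add: scalar_subspace_def)
    ultimately show "mat c \<odot>\<^bsub>U\<^esub> v \<in> f ` N"
      by simp
  qed
  from linear_map.dim_eq[OF linear_map_scalar_space[OF A M U f N this] fin] inj
  show ?thesis
    by (simp add: scalar_dim_def)
qed

text \<open>An injective homomorphism between modules of the same finite dimension is onto, since it maps
  a basis to a linearly independent set of maximal size.\<close>

lemma injective_hom_surjective:
  assumes A: "unital_subalgebra A" and M: "left_module (mat_algebra A) M"
    and U: "left_module (mat_algebra A) U" and f: "f \<in> module_hom (mat_algebra A) M U"
    and inj: "inj_on f (carrier M)"
    and finM: "vectorspace.fin_dim scalar_field (scalar_space M (carrier M))"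
    and finU: "vectorspace.fin_dim scalar_field (scalar_space U (carrier U))"
    and dim: "scalar_dim M (carrier M) = scalar_dim U (carrier U)"
  shows "f ` carrier M = carrier U"
proof -
  interpret Mm: left_module "mat_algebra A" M by fact
  interpret Um: left_module "mat_algebra A" U by fact
  have sub: "scalar_subspace M (carrier M)" "scalar_subspace U (carrier U)"
    using mat_mem[OF A] Mm.smult_closed Um.smult_closed by (auto simp: scalar_subspace_def)
  let ?V = "scalar_space M (carrier M)" and ?W = "scalar_space U (carrier U)"
  have im: "f ` carrier M \<subseteq> carrier U"
    using f by (auto simp: module_hom_def)
  interpret V: vectorspace scalar_field ?V
    using vectorspace_scalar_space[OF A M sub(1)] .
  interpret W: vectorspace scalar_field ?W
    using vectorspace_scalar_space[OF A U sub(2)] .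
  interpret L: linear_map scalar_field ?V ?W f
    using linear_map_scalar_space[OF A M U f sub im] .
  obtain S where S: "finite S" "V.basis S"
    using V.finite_basis_exists finM by blast
  have SV: "S \<subseteq> carrier ?V" "V.lin_indpt S"
    using S by (auto simp: V.basis_def)
  have injS: "inj_on f S" and inj': "inj_on f (carrier ?V)"
    using inj SV by (auto intro: inj_on_subset)
  have fS: "f ` S \<subseteq> carrier ?W"
    using SV im by auto
  have lin: "W.lincomb a (f ` S) = f (V.lincomb (a \<circ> f) S)" for a
    using L.lincomb_linear_image[OF inj' SV(1) _ S(1)] by simp
  have "W.lin_indpt (f ` S)"
  proof (rule W.finite_lin_indpt2[OF _ fS])
    fix a assume "W.lincomb a (f ` S) = \<zero>\<^bsub>?W\<^esub>"
    then have "f (V.lincomb (a \<circ> f) S) = f \<zero>\<^bsub>?V\<^esub>"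
      by (simp add: lin module_hom_zero[OF M U f])
    moreover have "V.lincomb (a \<circ> f) S \<in> carrier ?V"
      using SV by (intro V.lincomb_closed) auto
    ultimately have "V.lincomb (a \<circ> f) S = \<zero>\<^bsub>?V\<^esub>"
      using inj by (simp add: inj_on_def)
    then show "\<forall>v\<in>f ` S. a v = \<zero>\<^bsub>scalar_field\<^esub>"
      using V.lin_dep_crit[OF S(1) subset_refl, of "a \<circ> f"] SV(2) by auto
  qed (use S in auto)
  moreover have "card (f ` S) = W.dim"
    using card_image[OF injS] V.dim_basis[OF S] dim by (simp add: scalar_dim_def)
  ultimately have "W.basis (f ` S)"
    using W.dim_li_is_basis[OF finU _ fS] S(1) by simp
  then have gen: "carrier ?W = W.span (f ` S)"
    by (simp add: W.basis_def)
  have "u \<in> f ` carrier M" if "u \<in> carrier U" for u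
  proof -
    have "u \<in> W.span (f ` S)"
      using gen that by simp
    then obtain a where "u = W.lincomb a (f ` S)"
      using W.finite_in_span[OF _ fS] S(1) by blast
    then have "u = f (V.lincomb (a \<circ> f) S)"
      by (simp add: lin)
    moreover have "V.lincomb (a \<circ> f) S \<in> carrier ?V"
      using SV by (intro V.lincomb_closed) auto
    ultimately show ?thesis
      by simp
  qed
  with im show ?thesis by auto
qed

text \<open>The matrix units span the space of all matrices, so independent sets of matrices are finite.\<close>

lemma finite_spanning_subset:
  fixes A :: "('f::field^'x::finite^'x) set"
  obtains S where "finite S" "S \<subseteq> A" "A \<subseteq> mat_space.span S"
proof -
  let ?e = "\<lambda>p. \<chi> y z. if p = (y, z) then 1 else 0 :: 'f^'x^'x"
  let ?G = "range ?e"
  have span: "Z \<in> mat_space.span ?G" for Z :: "'f^'x^'x"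
  proof -
    have "Z = (\<Sum>p\<in>UNIV. mat_scale (Z $ fst p $ snd p) (?e p))"
      by (simp add: vec_eq_iff mat_scale_def if_distrib[of "\<lambda>t. _ * t"] cong: if_cong)
    also have "\<dots> \<in> mat_space.span ?G"
      by (intro mat_space.span_sum mat_space.span_scale mat_space.span_base) auto
    finally show ?thesis .
  qed
  obtain S where S: "S \<subseteq> A" "mat_space.independent S" "A \<subseteq> mat_space.span S"
    by (rule mat_space.maximal_independent_subset)
  then have "finite S"
    using mat_space.independent_span_bound[of ?G S] span by auto
  with S that show ?thesis by blast
qed

text \<open>The products of the elements of a finite spanning set of the algebra with finitely many module
  generators span a subspace that is stable under the algebra, hence everything. Finite
  dimensionality has to be known before \<open>dim\<close>, a least element, carries any information.\<close>

lemma fin_dim_fg_left_module: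
  fixes A :: "('f::field^'x::finite^'x) set"
  assumes A: "unital_subalgebra A" and fg: "fg_left_module (mat_algebra A) U"
  shows "vectorspace.fin_dim scalar_field (scalar_space U (carrier U))"
proof -
  interpret U: left_module "mat_algebra A" U
    using fg by (simp add: fg_left_module_def)
  obtain G where G: "finite G" "G \<subseteq> carrier U"
    "\<And>N. Module.submodule N (mat_algebra A) U \<Longrightarrow> G \<subseteq> N \<Longrightarrow> N = carrier U"
    using fg by (auto simp: fg_left_module_def)
  obtain S where S: "finite S" "S \<subseteq> A" "A \<subseteq> mat_space.span S"
    by (rule finite_spanning_subset)
  have "scalar_subspace U (carrier U)"
    using mat_mem[OF A] U.smult_closed by (auto simp: scalar_subspace_def)
  then interpret V: vectorspace scalar_field "scalar_space U (carrier U)"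
    using vectorspace_scalar_space[OF A U.left_module_axioms] by simp
  let ?P = "(\<lambda>(s, u). s \<odot>\<^bsub>U\<^esub> u) ` (S \<times> G)"
  have P: "finite ?P" "?P \<subseteq> carrier (scalar_space U (carrier U))"
    using S(1,2) G(1,2) U.smult_closed by (auto simp: subset_iff)
  have sub: "LinearCombinations.submodule scalar_field (V.span ?P) (scalar_space U (carrier U))"
    using V.span_is_submodule[OF P(2)] .
  have span: "\<zero>\<^bsub>U\<^esub> \<in> V.span ?P" "V.span ?P \<subseteq> carrier U"
    "\<And>u v. u \<in> V.span ?P \<Longrightarrow> v \<in> V.span ?P \<Longrightarrow> u \<oplus>\<^bsub>U\<^esub> v \<in> V.span ?P"
    "\<And>c u. u \<in> V.span ?P \<Longrightarrow> mat c \<odot>\<^bsub>U\<^esub> u \<in> V.span ?P"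
    using LinearCombinations.submodule.zero_closed[OF sub] LinearCombinations.submodule.subset[OF sub]
      LinearCombinations.submodule.m_closed[OF sub] LinearCombinations.submodule.smult_closed[OF sub]
    by auto
  define N where "N = {u \<in> carrier U. \<forall>a\<in>A. a \<odot>\<^bsub>U\<^esub> u \<in> V.span ?P}"
  have A': "0 \<in> A" "\<And>a b. a \<in> A \<Longrightarrow> b \<in> A \<Longrightarrow> a + b \<in> A" "\<And>a b. a \<in> A \<Longrightarrow> b \<in> A \<Longrightarrow> a ** b \<in> A"
    "\<And>c a. a \<in> A \<Longrightarrow> mat_scale c a \<in> A" "mat 1 \<in> A"
    using A by (auto simp: unital_subalgebra_def mat_space.subspace_def)
  have "Module.submodule N (mat_algebra A) U"
    unfolding U.submodule_iff
  proof (intro conjI ballI)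
    show "\<zero>\<^bsub>U\<^esub> \<in> N"
      using span(1) U.smult_zero_right by (simp add: N_def)
  next
    fix u v assume "u \<in> N" "v \<in> N"
    then show "u \<oplus>\<^bsub>U\<^esub> v \<in> N"
      using U.smult_r_distr span(3) by (simp add: N_def)
  next
    fix a u assume "a \<in> carrier (mat_algebra A)" "u \<in> N"
    moreover from this have "b \<odot>\<^bsub>U\<^esub> (a \<odot>\<^bsub>U\<^esub> u) = (b ** a) \<odot>\<^bsub>U\<^esub> u" if "b \<in> A" for b
      using U.smult_assoc that by (simp add: N_def)
    ultimately show "a \<odot>\<^bsub>U\<^esub> u \<in> N"
      using U.smult_closed A'(3) by (simp add: N_def)
  qed (auto simp: N_def)
  moreover have "G \<subseteq> N"
  proof
    fix u assume u: "u \<in> G"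
    have "a \<odot>\<^bsub>U\<^esub> u \<in> V.span ?P" if a: "a \<in> A" for a
    proof -
      have sp: "mat_space.subspace {a \<in> A. a \<odot>\<^bsub>U\<^esub> u \<in> V.span ?P}"
        unfolding mat_space.subspace_def
      proof (intro conjI ballI allI)
        show "0 \<in> {a \<in> A. a \<odot>\<^bsub>U\<^esub> u \<in> V.span ?P}"
          using A' U.smult_zero_left G(2) u span(1) by auto
      next
        fix a b assume "a \<in> {a \<in> A. a \<odot>\<^bsub>U\<^esub> u \<in> V.span ?P}" "b \<in> {a \<in> A. a \<odot>\<^bsub>U\<^esub> u \<in> V.span ?P}"
        then show "a + b \<in> {a \<in> A. a \<odot>\<^bsub>U\<^esub> u \<in> V.span ?P}"
          using A' U.smult_l_distr G(2) u span(3) by (auto simp: subset_iff)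
      next
        fix c a assume "a \<in> {a \<in> A. a \<odot>\<^bsub>U\<^esub> u \<in> V.span ?P}"
        moreover from this have "(mat c ** a) \<odot>\<^bsub>U\<^esub> u = mat c \<odot>\<^bsub>U\<^esub> (a \<odot>\<^bsub>U\<^esub> u)"
          using U.smult_assoc[of "mat c" a u] mat_mem[OF A] G(2) u by auto
        ultimately show "mat_scale c a \<in> {a \<in> A. a \<odot>\<^bsub>U\<^esub> u \<in> V.span ?P}"
          using A' span(4) by (auto simp: scale_eq_mat_mult)
      qed
      have "S \<subseteq> {a \<in> A. a \<odot>\<^bsub>U\<^esub> u \<in> V.span ?P}"
        using S(2) V.in_own_span[OF P(2)] u by auto
      then have "mat_space.span S \<subseteq> {a \<in> A. a \<odot>\<^bsub>U\<^esub> u \<in> V.span ?P}"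
        using sp by (rule mat_space.span_minimal)
      with a S(3) show ?thesis by blast
    qed
    then show "u \<in> N"
      using u G(2) by (auto simp: N_def)
  qed
  ultimately have "N = carrier U"
    by (rule G(3))
  then have "u \<in> V.span ?P" if "u \<in> carrier U" for u
  proof -
    have "u \<in> N"
      using \<open>N = carrier U\<close> that by simp
    then have "mat 1 \<odot>\<^bsub>U\<^esub> u \<in> V.span ?P"
      using A'(5) by (simp add: N_def)
    then show ?thesis
      using U.smult_one[OF that] by simp
  qed
  then have "V.gen_set ?P"
    using span(2) by auto
  with P show ?thesis
    unfolding V.fin_dim_def by blast
qed

section \<open>Rank one matrices\<close>

definition outer :: "'f::field^'x \<Rightarrow> 'f^'x \<Rightarrow> 'f^'x^'x" where
  "outer u v = (\<chi> y z. u $ y * v $ z)"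

definition dot :: "'f::field^'x::finite \<Rightarrow> 'f^'x \<Rightarrow> 'f" where
  "dot u v = (\<Sum>y\<in>UNIV. u $ y * v $ y)"

lemma outer_nth [simp]: "outer u v $ y $ z = u $ y * v $ z"
  by (simp add: outer_def)

lemma mat_scale_nth: "mat_scale c Z $ y $ z = c * Z $ y $ z"
  by (simp add: mat_scale_def)

lemma mult_outer: "Z ** outer u v = outer (Z *v u) v"
  by (simp add: vec_eq_iff matrix_matrix_mult_def matrix_vector_mult_def sum_distrib_right mult.assoc)

lemma outer_mult: "outer u v ** Z = outer u (transpose Z *v v)"
  by (simp add: vec_eq_iff matrix_matrix_mult_def matrix_vector_mult_def transpose_def
      sum_distrib_left mult_ac)

lemma outer_mult_vec: "outer u v *v a = dot v a *s u"
  by (simp add: vec_eq_iff matrix_vector_mult_def dot_def sum_distrib_left mult_ac)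

lemma outer_add_left: "outer (u + v) a = outer u a + outer v a"
  by (simp add: vec_eq_iff algebra_simps)

lemma outer_scale_left: "outer (c *s u) v = mat_scale c (outer u v)"
  by (simp add: vec_eq_iff mat_scale_def algebra_simps)

lemma outer_outer: "outer u v ** outer u' v' = mat_scale (dot v u') (outer u v')"
  by (simp add: mult_outer outer_mult_vec outer_scale_left)

lemma transpose_outer: "transpose (outer u v) = outer v u"
  by (simp add: vec_eq_iff transpose_def mult.commute)

lemma dot_commute: "dot u v = dot v u"
  by (simp add: dot_def mult.commute)

lemma dot_add_right: "dot u (v + a) = dot u v + dot u a"
  by (simp add: dot_def algebra_simps sum.distrib)

lemma dot_scale_right: "dot u (c *s v) = c * dot u v"
  by (simp add: dot_def sum_distrib_left mult_ac)

lemma dot_add_left: "dot (u + v) a = dot u a + dot v a"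
  by (simp add: dot_commute[of _ a] dot_add_right)

lemma dot_scale_left: "dot (c *s u) v = c * dot u v"
  by (simp add: dot_commute[of _ v] dot_scale_right)

lemma dot_adjoint:
  fixes u v :: "'f::field^'x::finite"
  shows "dot (Z *v u) v = dot u (transpose Z *v v)"
proof -
  \<comment> \<open>Both scalars arise from \<open>outer u v ** Z ** outer u v\<close>, bracketed in two ways.\<close>
  have "mat_scale (dot (Z *v u) v) (outer u v) = mat_scale (dot u (transpose Z *v v)) (outer u v)"
    if "u \<noteq> 0" "v \<noteq> 0"
    by (metis outer_outer outer_mult mult_outer matrix_mul_assoc dot_commute)
  moreover have "dot (Z *v u) v = dot u (transpose Z *v v)" if "u = 0 \<or> v = 0"
    using that by (auto simp: dot_def matrix_vector_mult_def)
  moreover have "outer u v \<noteq> 0" if "u \<noteq> 0" "v \<noteq> 0"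
    using that by (auto simp: vec_eq_iff)
  ultimately show ?thesis by (metis mat_space.scale_cancel_right)
qed

lemma scalar_mat_mult_vec: "mat c *v u = c *s (u :: 'f::field^'x::finite)"
  by (simp add: vec_eq_iff matrix_vector_mult_def mat_def if_distrib[of "\<lambda>t. t * _"] cong: if_cong)

lemma mat_add_mult: "(Y + Y') ** Z = Y ** Z + Y' ** (Z :: 'f::field^'x^'x::finite)"
  by (simp add: vec_eq_iff matrix_matrix_mult_def algebra_simps sum.distrib)

lemma mat_scale_mult_left: "mat_scale c Y ** Z = mat_scale c (Y ** (Z :: 'f::field^'x^'x::finite))"
  by (simp add: vec_eq_iff mat_scale_def matrix_matrix_mult_def sum_distrib_left mult_ac)

lemma mat_scale_mult_right: "Y ** mat_scale c Z = mat_scale c (Y ** (Z :: 'f::field^'x::finite^'x))"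
  by (simp add: vec_eq_iff mat_scale_def matrix_matrix_mult_def sum_distrib_left mult_ac)

lemma transpose_add: "transpose (Y + Z) = transpose Y + (transpose Z :: 'f::field^'x^'x)"
  by (simp add: vec_eq_iff transpose_def)

lemma transpose_mat_scale: "transpose (mat_scale c Z) = mat_scale c (transpose Z)"
  by (simp add: vec_eq_iff transpose_def mat_scale_def)

lemma transpose_matrix_mult: "transpose (Y ** Z) = transpose Z ** (transpose Y :: 'f::field^'x::finite^'x)"
  by (rule matrix_transpose_mul)

section \<open>The primary module and the primary ideal\<close>

locale terwilliger_algebra =
  fixes d :: nat and R :: "nat \<Rightarrow> ('x::finite \<times> 'x) set" and x :: 'x
    and E :: "nat \<Rightarrow> 'f::field^'x^'x"
  assumes scheme: "association_scheme d R" and E_def: "E = dual_idempotent R x"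
begin

abbreviation T :: "('f^'x^'x) set" where "T \<equiv> terwilliger d R x"
abbreviation W :: "('f^'x) set" where "W \<equiv> primary_space d R x"
abbreviation B :: "('f^'x^'x) set" where "B \<equiv> primary_ideal d R x"

subsection \<open>The shells around the base point\<close>

definition shell :: "'x \<Rightarrow> nat" where
  "shell y = (THE i. i \<le> d \<and> (x, y) \<in> R i)"

definition rep :: "nat \<Rightarrow> 'x" where
  "rep i = (SOME y. shell y = i)"

definition k :: "nat \<Rightarrow> nat" where
  "k i = card {y. shell y = i}"

definition w :: "nat \<Rightarrow> 'f^'x" where
  "w i = (\<chi> y. if shell y = i then 1 else 0)"

lemma relation_unique: "\<exists>!i. i \<le> d \<and> (y, z) \<in> R i"
proof -
  have part: "\<Union> (R ` {..d}) = UNIV" "disjoint (R ` {..d})" and inj: "inj_on R {..d}"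
    using scheme by (simp_all add: association_scheme_def partition_on_def)
  have "(y, z) \<in> \<Union> (R ` {..d})"
    using part(1) by simp
  then obtain i where i: "i \<le> d" "(y, z) \<in> R i"
    by blast
  have "j = i" if "j \<le> d" "(y, z) \<in> R j" for j
  proof -
    have "R j = R i"
      using disjointD[OF part(2), of "R j" "R i"] i that by blast
    then show ?thesis
      using inj i that by (simp add: inj_on_def)
  qed
  with i show ?thesis by blast
qed

lemma shell [simp]: "shell y \<le> d" "(x, y) \<in> R (shell y)"
  using theI'[OF relation_unique[of x y]] by (auto simp: shell_def)

lemma shell_eq_iff: "i \<le> d \<Longrightarrow> (x, y) \<in> R i \<longleftrightarrow> shell y = i"
  using shell relation_unique[of x y] by blast

lemma diagonal: "(y, z) \<in> R 0 \<longleftrightarrow> y = z"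
  using scheme by (auto simp: association_scheme_def)

lemma shell_eq_0_iff: "shell y = 0 \<longleftrightarrow> y = x"
  using shell_eq_iff[of 0 y] by (auto simp: diagonal)

lemma intersection_number_ex:
  assumes "i \<le> d" "j \<le> d" "l \<le> d"
  obtains n where "\<And>y z. (y, z) \<in> R l \<Longrightarrow> card {w. (y, w) \<in> R i \<and> (w, z) \<in> R j} = n"
proof -
  have "\<exists>n. \<forall>(y, z)\<in>R l. card {w. (y, w) \<in> R i \<and> (w, z) \<in> R j} = n"
    using assms scheme by (simp add: association_scheme_def)
  then obtain n where "\<forall>(y, z)\<in>R l. card {w. (y, w) \<in> R i \<and> (w, z) \<in> R j} = n" ..
  then have "\<And>y z. (y, z) \<in> R l \<Longrightarrow> card {w. (y, w) \<in> R i \<and> (w, z) \<in> R j} = n"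
    by blast
  then show ?thesis by (rule that)
qed

lemma transpose_ex:
  assumes "i \<le> d"
  obtains i' where "i' \<le> d" "\<And>y z. (y, z) \<in> R i' \<longleftrightarrow> (z, y) \<in> R i"
proof -
  have "\<exists>i'\<le>d. R i' = {(y, z). (z, y) \<in> R i}"
    using assms scheme by (simp add: association_scheme_def)
  then obtain i' where "i' \<le> d" "R i' = {(y, z). (z, y) \<in> R i}"
    by blast
  with that[of i'] show ?thesis by simp
qed

lemma transpose_index: "i \<le> d \<Longrightarrow> (y, z) \<in> R (transpose_index d R i) \<longleftrightarrow> (z, y) \<in> R i"
proof -
  assume i: "i \<le> d"
  have inj: "inj_on R {..d}"
    using scheme by (auto simp: association_scheme_def)
  have "\<exists>i'\<le>d. R i' = {(y, z). (z, y) \<in> R i}"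
    using i scheme by (simp add: association_scheme_def)
  then obtain i' where i': "i' \<le> d" "R i' = {(y, z). (z, y) \<in> R i}"
    by blast
  have "transpose_index d R i = i'"
    unfolding transpose_index_def
  proof (rule the_equality)
    fix j assume "j \<le> d \<and> R j = {(y, z). (z, y) \<in> R i}"
    then show "j = i'"
      using inj_onD[OF inj, of j i'] i' by simp
  qed (use i' in simp)
  then show ?thesis
    using i'(2) by simp
qed

lemma valency_eq:
  assumes "i \<le> d"
  shows "valency d R i = k i"
proof -
  obtain i' where i': "i' \<le> d" "\<And>y z. (y, z) \<in> R i' \<longleftrightarrow> (z, y) \<in> R i"
    using assms by (rule transpose_ex) auto
  obtain n where n: "\<And>y z. (y, z) \<in> R 0 \<Longrightarrow> card {w. (y, w) \<in> R i \<and> (w, z) \<in> R i'} = n"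
    using intersection_number_ex[OF assms i'(1), of 0] by auto
  have n': "card {w. (y, w) \<in> R i} = n" for y
    using n[of y y] by (simp add: diagonal i')
  have "valency d R i = n"
    unfolding valency_def intersection_number_def
  proof (rule the_equality)
    fix m
    assume "\<forall>(y, z)\<in>R 0. card {w. (y, w) \<in> R i \<and> (w, z) \<in> R (transpose_index d R i)} = m"
    moreover have "(x, x) \<in> R 0"
      by (simp add: diagonal)
    ultimately have "card {w. (x, w) \<in> R i \<and> (w, x) \<in> R (transpose_index d R i)} = m"
      by blast
    then show "m = n"
      by (simp add: transpose_index[OF assms] n')
  qed (auto simp: diagonal transpose_index[OF assms] n')
  moreover have "k i = n"
    using n'[of x] shell_eq_iff[OF assms] by (simp add: k_def)
  ultimately show ?thesis by simp
qed

lemma rep [simp]: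
  assumes "i \<le> d"
  shows "shell (rep i) = i"
proof -
  obtain i' where i': "i' \<le> d" "\<And>y z. (y, z) \<in> R i' \<longleftrightarrow> (z, y) \<in> R i"
    using assms by (rule transpose_ex) auto
  obtain n where n: "\<And>y z. (y, z) \<in> R 0 \<Longrightarrow> card {w. (y, w) \<in> R i \<and> (w, z) \<in> R i'} = n"
    using intersection_number_ex[OF assms i'(1), of 0] by auto
  have n': "card {w. (y, w) \<in> R i} = n" for y
    using n[of y y] by (simp add: diagonal i')
  have "R i \<noteq> {}"
    using scheme assms by (auto simp: association_scheme_def partition_on_def)
  then obtain y z where "(y, z) \<in> R i"
    by auto
  then have "n \<noteq> 0"
    using n'[of y] by (auto simp: card_gt_0_iff)
  have "\<exists>y. shell y = i"
  proof (rule ccontr)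
    assume "\<nexists>y. shell y = i"
    then have "{w. (x, w) \<in> R i} = {}"
      using shell_eq_iff[OF assms] by simp
    then show False
      using n'[of x] \<open>n \<noteq> 0\<close> by simp
  qed
  then show ?thesis
    unfolding rep_def by (rule someI_ex)
qed

lemma rep_0: "rep 0 = x"
  using rep[of 0] unfolding shell_eq_0_iff by simp

lemma p'_valenced_iff:
  "p'_valenced CHAR('f) d R \<longleftrightarrow> (\<forall>i\<le>d. (of_nat (k i) :: 'f) \<noteq> 0)"
  by (auto simp: p'_valenced_def valency_eq of_nat_eq_0_iff_char_dvd)

lemma k_0: "k 0 = 1"
  by (simp add: k_def shell_eq_0_iff)

lemma thin_iff:
  assumes "i \<le> d"
  shows "R i \<in> thin_radical d R \<longleftrightarrow> k i = 1"
proof -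
  have "inj_on R {..d}"
    using scheme by (auto simp: association_scheme_def)
  then show ?thesis
    using assms valency_eq unfolding thin_radical_def by (auto dest: inj_onD[of R "{..d}" i])
qed

lemma shell_thin:
  assumes "i \<le> d" "k i = 1"
  shows "shell y = i \<longleftrightarrow> y = rep i"
proof -
  have "\<exists>a. {y. shell y = i} = {a}"
    using assms(2) by (simp add: k_def card_1_singleton_iff)
  then obtain a where "{y. shell y = i} = {a}" ..
  then have a: "shell y = i \<longleftrightarrow> y = a" for y
    by (simp add: set_eq_iff)
  with rep[OF assms(1)] have "rep i = a"
    by blast
  with a show ?thesis
    by blast
qed

subsection \<open>Vectors constant on shells\<close>

lemma w_nth [simp]: "w i $ y = (if shell y = i then 1 else 0)"
  by (simp add: w_def)

lemma E_nth: "i \<le> d \<Longrightarrow> E i $ y $ z = (if y = z \<and> shell y = i then 1 else 0)"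
  by (simp add: E_def dual_idempotent_def shell_eq_iff)

lemma E_mult_vec: "i \<le> d \<Longrightarrow> E i *v v = (\<chi> y. if shell y = i then v $ y else 0)"
proof -
  assume i: "i \<le> d"
  have "(\<Sum>z\<in>UNIV. E i $ y $ z * v $ z) = (\<Sum>z\<in>UNIV. if y = z then (if shell y = i then v $ y else 0) else 0)"
    for y
    by (intro sum.cong) (auto simp: E_nth[OF i])
  then show ?thesis
    by (simp add: vec_eq_iff matrix_vector_mult_def)
qed

lemma transpose_E: "i \<le> d \<Longrightarrow> transpose (E i) = E i"
  by (auto simp: vec_eq_iff transpose_def E_nth)

lemma all_one_mat_eq: "all_one_mat = outer all_one_vec all_one_vec"
  by (simp add: vec_eq_iff all_one_mat_def all_one_vec_def)

lemma E_all_one: "i \<le> d \<Longrightarrow> E i *v all_one_vec = w i"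
  by (simp add: E_mult_vec vec_eq_iff all_one_vec_def)

lemma E_all_one_E: "i \<le> d \<Longrightarrow> j \<le> d \<Longrightarrow> E i ** all_one_mat ** E j = outer (w i) (w j)"
  by (simp add: all_one_mat_eq mult_outer outer_mult transpose_E E_all_one)

lemma W_eq_span: "W = vec.span (w ` {..d})"
  unfolding primary_space_def E_def[symmetric]
  by (rule arg_cong[of _ _ vec.span]) (force simp: E_all_one)

lemma B_eq_span: "B = mat_space.span {outer (w i) (w j) | i j. i \<le> d \<and> j \<le> d}"
  unfolding primary_ideal_def E_def[symmetric]
  by (rule arg_cong[of _ _ mat_space.span]) (force simp: E_all_one_E)

lemma expand:
  fixes v :: "'f^'x"
  assumes "\<And>y z. shell y = shell z \<Longrightarrow> v $ y = v $ z"
  shows "v = (\<Sum>i\<le>d. v $ rep i *s w i)"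
proof -
  have entry: "v $ y = (\<Sum>i\<le>d. v $ rep i * w i $ y)" for y
  proof -
    have "(\<Sum>i\<le>d. v $ rep i * w i $ y) = (\<Sum>i\<le>d. if shell y = i then v $ rep i else 0)"
      by (intro sum.cong) auto
    then show ?thesis
      using assms[of y "rep (shell y)"] by simp
  qed
  show ?thesis
    unfolding vec_eq_iff
  proof
    show "v $ y = (\<Sum>i\<le>d. v $ rep i *s w i) $ y" for y
      using entry[of y] by simp
  qed
qed

lemma mem_W_iff: "v \<in> W \<longleftrightarrow> (\<forall>y z. shell y = shell z \<longrightarrow> v $ y = v $ z)"
proof
  let ?S = "{v :: 'f^'x. \<forall>y z. shell y = shell z \<longrightarrow> v $ y = v $ z}"
  have D: "v $ y = v $ z" if "v \<in> ?S" "shell y = shell z" for v y z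
    using that by blast
  assume "v \<in> W"
  moreover have "vec.subspace ?S"
  proof (rule vec.subspaceI)
    show "u + v \<in> ?S" if "u \<in> ?S" "v \<in> ?S" for u v
    proof (intro CollectI allI impI)
      show "(u + v) $ y = (u + v) $ z" if "shell y = shell z" for y z
        using D[OF \<open>u \<in> ?S\<close> that] D[OF \<open>v \<in> ?S\<close> that] by simp
    qed
    show "c *s v \<in> ?S" if "v \<in> ?S" for c v
    proof (intro CollectI allI impI)
      show "(c *s v) $ y = (c *s v) $ z" if "shell y = shell z" for y z
        using D[OF \<open>v \<in> ?S\<close> that] by simp
    qed
  qed simp
  moreover have "w ` {..d} \<subseteq> ?S"
    by auto
  ultimately have "v \<in> ?S"
    unfolding W_eq_span using vec.span_minimal by blast
  then show "\<forall>y z. shell y = shell z \<longrightarrow> v $ y = v $ z"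
    by blast
next
  assume v: "\<forall>y z. shell y = shell z \<longrightarrow> v $ y = v $ z"
  have "(\<Sum>i\<le>d. v $ rep i *s w i) \<in> W"
    unfolding W_eq_span by (intro vec.span_sum vec.span_scale vec.span_base) auto
  then show "v \<in> W"
    using expand[of v] v by metis
qed

lemma W_cong: "v \<in> W \<Longrightarrow> shell y = shell z \<Longrightarrow> v $ y = v $ z"
  unfolding mem_W_iff by blast

lemma W_nth: "v \<in> W \<Longrightarrow> v $ y = v $ rep (shell y)"
  by (rule W_cong) simp_all

lemma W_eqI: "u \<in> W \<Longrightarrow> v \<in> W \<Longrightarrow> (\<And>i. i \<le> d \<Longrightarrow> u $ rep i = v $ rep i) \<Longrightarrow> u = v"
proof -
  assume uv: "u \<in> W" "v \<in> W" and eq: "\<And>i. i \<le> d \<Longrightarrow> u $ rep i = v $ rep i"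
  have "u $ y = v $ y" for y
    using W_nth[OF uv(1), of y] W_nth[OF uv(2), of y] eq[of "shell y"] by simp
  then show "u = v"
    by (simp add: vec_eq_iff)
qed

lemma w_in_W [simp]: "w i \<in> W"
  by (simp add: mem_W_iff)

lemma W_expand: "v \<in> W \<Longrightarrow> v = (\<Sum>i\<le>d. v $ rep i *s w i)"
  by (rule expand) (rule W_cong)

lemma subspace_W: "vec.subspace W"
  by (simp add: primary_space_def)

lemma W_closed:
  "0 \<in> W" "u \<in> W \<Longrightarrow> v \<in> W \<Longrightarrow> u + v \<in> W" "u \<in> W \<Longrightarrow> c *s u \<in> W" "u \<in> W \<Longrightarrow> v \<in> W \<Longrightarrow> u - v \<in> W"
  using subspace_W by (auto simp: vec.subspace_def vec.subspace_diff)

lemma mem_B_iff: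
  "Z \<in> B \<longleftrightarrow> (\<forall>y z y' z'. shell y = shell y' \<and> shell z = shell z' \<longrightarrow> Z $ y $ z = Z $ y' $ z')"
  (is "_ \<longleftrightarrow> ?P Z")
proof
  have D: "Z $ y $ z = Z $ y' $ z'" if "Z \<in> Collect ?P" "shell y = shell y'" "shell z = shell z'"
    for Z y z y' z'
    using that by blast
  assume Z: "Z \<in> B"
  have sub: "mat_space.subspace (Collect ?P)"
  proof (rule mat_space.subspaceI)
    show "Y + Z \<in> Collect ?P" if "Y \<in> Collect ?P" "Z \<in> Collect ?P" for Y Z
    proof (intro CollectI allI impI, elim conjE)
      show "(Y + Z) $ y $ z = (Y + Z) $ y' $ z'" if "shell y = shell y'" "shell z = shell z'" for y z y' z'
        using D[OF \<open>Y \<in> Collect ?P\<close> that] D[OF \<open>Z \<in> Collect ?P\<close> that] by simp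
    qed
    show "mat_scale c Z \<in> Collect ?P" if "Z \<in> Collect ?P" for c Z
    proof (intro CollectI allI impI, elim conjE)
      show "mat_scale c Z $ y $ z = mat_scale c Z $ y' $ z'" if "shell y = shell y'" "shell z = shell z'" for y z y' z'
        using D[OF \<open>Z \<in> Collect ?P\<close> that] by (simp add: mat_scale_nth)
    qed
  qed simp
  have "{outer (w i) (w j) | i j. i \<le> d \<and> j \<le> d} \<subseteq> Collect ?P"
    by auto
  from mat_space.span_minimal[OF this sub] Z have "Z \<in> Collect ?P"
    unfolding B_eq_span by (rule subsetD)
  then show "?P Z"
    by (rule CollectD)
next
  assume Z: "?P Z"
  have entry: "Z $ y $ z = (\<Sum>i\<le>d. \<Sum>j\<le>d. Z $ rep i $ rep j * (w i $ y * w j $ z))" for y z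
  proof -
    have "(\<Sum>i\<le>d. \<Sum>j\<le>d. Z $ rep i $ rep j * (w i $ y * w j $ z)) =
        (\<Sum>i\<le>d. \<Sum>j\<le>d. if shell z = j then (if shell y = i then Z $ rep i $ rep j else 0) else 0)"
      by (intro sum.cong) auto
    also have "\<dots> = Z $ rep (shell y) $ rep (shell z)"
      by simp
    also have "\<dots> = Z $ y $ z"
      by (rule Z[rule_format]) simp
    finally show ?thesis ..
  qed
  have "Z = (\<Sum>i\<le>d. \<Sum>j\<le>d. mat_scale (Z $ rep i $ rep j) (outer (w i) (w j)))"
    unfolding vec_eq_iff
  proof (intro allI)
    show "Z $ y $ z = (\<Sum>i\<le>d. \<Sum>j\<le>d. mat_scale (Z $ rep i $ rep j) (outer (w i) (w j))) $ y $ z" for y z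
      using entry[of y z] by (simp add: mat_scale_def)
  qed
  also have "\<dots> \<in> B"
    unfolding B_eq_span
    by (intro mat_space.span_sum mat_space.span_scale mat_space.span_base) auto
  finally show "Z \<in> B" .
qed

lemma subspace_B: "mat_space.subspace B"
  by (simp add: primary_ideal_def)

lemma outer_in_B: "u \<in> W \<Longrightarrow> v \<in> W \<Longrightarrow> outer u v \<in> B"
  unfolding mem_B_iff outer_nth
  by (intro allI impI arg_cong2[of _ _ _ _ "(*)"]; elim conjE; rule W_cong)

lemma dot_w:
  assumes "v \<in> W"
  shows "dot (w i) v = of_nat (k i) * v $ rep i"
proof -
  have "dot (w i) v = (\<Sum>y\<in>UNIV. if shell y = i then v $ rep i else 0)"
    unfolding dot_def using assms by (intro sum.cong) (auto intro: W_nth)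
  then show ?thesis
    by (simp add: sum.If_cases k_def)
qed

lemma dot_w_w: "i \<le> d \<Longrightarrow> j \<le> d \<Longrightarrow> dot (w j) (w i) = (if i = j then of_nat (k i) else 0)"
  by (auto simp: dot_w)

lemma dot_W:
  assumes "u \<in> W" "v \<in> W"
  shows "dot u v = (\<Sum>i\<le>d. of_nat (k i) * u $ rep i * v $ rep i)"
proof -
  have "dot (\<Sum>i\<in>I. u $ rep i *s w i) v = (\<Sum>i\<in>I. u $ rep i * dot (w i) v)" for I
    by (induction I rule: infinite_finite_induct) (simp_all add: dot_add_left dot_scale_left, simp_all add: dot_def)
  from this[of "{..d}"] have "dot u v = (\<Sum>i\<le>d. u $ rep i * dot (w i) v)"
    unfolding W_expand[OF assms(1), symmetric] .
  then show ?thesis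
    by (simp add: dot_w[OF assms(2)] mult_ac)
qed

lemma E_thin: "i \<le> d \<Longrightarrow> k i = 1 \<Longrightarrow> E i = outer (w i) (w i)"
  by (auto simp: vec_eq_iff E_nth shell_thin)

lemma E_0: "E 0 = outer (w 0) (w 0)"
  using E_thin[of 0] by (simp add: k_0)

lemma dot_w_0: "dot (w 0) v = v $ x"
  by (simp add: dot_def shell_eq_0_iff if_distrib[of "\<lambda>t. t * _"] cong: if_cong)

subsection \<open>The action of the Terwilliger algebra\<close>

lemma unital_T: "unital_subalgebra T"
  unfolding terwilliger_def
  by (rule hull_in) (auto simp: unital_subalgebra_def intro!: mat_space.subspace_Inter)

lemma T_closed:
  "0 \<in> T" "mat c \<in> T" "Y \<in> T \<Longrightarrow> Z \<in> T \<Longrightarrow> Y + Z \<in> T" "Z \<in> T \<Longrightarrow> mat_scale c Z \<in> T"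
  "Y \<in> T \<Longrightarrow> Z \<in> T \<Longrightarrow> Y ** Z \<in> T" "Y \<in> T \<Longrightarrow> Z \<in> T \<Longrightarrow> Y - Z \<in> T" "Z \<in> T \<Longrightarrow> - Z \<in> T"
  using unital_T mat_mem[OF unital_T]
  by (auto simp: unital_subalgebra_def mat_space.subspace_0 mat_space.subspace_add
      mat_space.subspace_scale mat_space.subspace_diff mat_space.subspace_neg)

lemma generators_in_T: "i \<le> d \<Longrightarrow> adjacency_mat R i \<in> T" "i \<le> d \<Longrightarrow> E i \<in> T"
  using hull_subset[of "adjacency_mat R ` {..d} \<union> dual_idempotent R x ` {..d}" unital_subalgebra]
  unfolding terwilliger_def E_def by auto

lemma T_least:
  assumes "unital_subalgebra S" "\<And>i. i \<le> d \<Longrightarrow> adjacency_mat R i \<in> S" "\<And>i. i \<le> d \<Longrightarrow> E i \<in> S"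
  shows "T \<subseteq> S"
  unfolding terwilliger_def using assms by (intro hull_minimal) (auto simp: E_def)

lemma transpose_in_T:
  assumes "Z \<in> T"
  shows "transpose Z \<in> T"
proof -
  have "T \<subseteq> {Z. transpose Z \<in> T}"
  proof (rule T_least)
    show "unital_subalgebra {Z. transpose Z \<in> T}"
      using T_closed unfolding unital_subalgebra_def mat_space.subspace_def
      by (auto simp: transpose_add transpose_mat_scale transpose_matrix_mult transpose_mat)
         (simp add: transpose_def zero_vec_def[symmetric])
  next
    fix i assume i: "i \<le> d"
    then obtain i' where i': "i' \<le> d" "\<And>y z. (y, z) \<in> R i' \<longleftrightarrow> (z, y) \<in> R i"
      by (rule transpose_ex) auto
    have "transpose (adjacency_mat R i) = (adjacency_mat R i' :: 'f^'x^'x)"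
      by (simp add: vec_eq_iff transpose_def adjacency_mat_def i')
    then show "adjacency_mat R i \<in> {Z. transpose Z \<in> T}"
      using generators_in_T(1)[OF i'(1)] by simp
    show "E i \<in> {Z. transpose Z \<in> T}"
      using generators_in_T i by (simp add: transpose_E)
  qed
  with assms show ?thesis by auto
qed

text \<open>For the adjacency matrix of \<open>R l\<close> this is the defining property of the intersection numbers:
  the number of \<open>z\<close> in the \<open>i\<close>-th shell with \<open>(y, z) \<in> R l\<close> depends only on the shell of \<open>y\<close>.\<close>

lemma T_mult_W:
  assumes "Z \<in> T" "v \<in> W"
  shows "Z *v v \<in> W"
proof -
  have "T \<subseteq> {Z. \<forall>v\<in>W. Z *v v \<in> W}"
  proof (rule T_least)
    show "unital_subalgebra {Z. \<forall>v\<in>W. Z *v v \<in> W}"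
      unfolding unital_subalgebra_def mat_space.subspace_def
      by (auto simp: W_closed matrix_vector_mult_add_rdistrib scale_eq_mat_mult
          scalar_mat_mult_vec matrix_vector_mul_assoc[symmetric])
  next
    fix l assume l: "l \<le> d"
    obtain l' where l': "l' \<le> d" "\<And>y z. (y, z) \<in> R l' \<longleftrightarrow> (z, y) \<in> R l"
      using l by (rule transpose_ex) auto
    let ?A = "adjacency_mat R l :: 'f^'x^'x"
    have "?A *v w i \<in> W" if i: "i \<le> d" for i
    proof -
      have entry: "(?A *v w i) $ y = of_nat (card {z. (x, z) \<in> R i \<and> (z, y) \<in> R l'})" for y
      proof -
        have "(?A *v w i) $ y = (\<Sum>z\<in>UNIV. if (x, z) \<in> R i \<and> (z, y) \<in> R l' then 1 else 0)"
          unfolding matrix_vector_mult_def vec_lambda_beta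
          by (intro sum.cong) (auto simp: adjacency_mat_def l' shell_eq_iff[OF i])
        then show ?thesis
          by (simp add: sum.If_cases)
      qed
      have "(?A *v w i) $ y = (?A *v w i) $ y'" if "shell y = shell y'" for y y'
      proof -
        obtain n where "\<And>a b. (a, b) \<in> R (shell y) \<Longrightarrow>
            card {z. (a, z) \<in> R i \<and> (z, b) \<in> R l'} = n"
          by (rule intersection_number_ex[OF i l'(1) shell(1)[of y]]) auto
        then show ?thesis
          using shell(2)[of y] shell(2)[of y'] that by (simp add: entry)
      qed
      then show ?thesis
        unfolding mem_W_iff by blast
    qed
    then have "w ` {..d} \<subseteq> {v. ?A *v v \<in> W}"
      by auto
    moreover have "vec.subspace {v. ?A *v v \<in> W}"
      by (auto simp: vec.subspace_def W_closed matrix_vector_right_distrib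
          vector_scalar_commute)
    ultimately have "W \<subseteq> {v. ?A *v v \<in> W}"
      unfolding W_eq_span by (rule vec.span_minimal)
    then show "?A \<in> {Z. \<forall>v\<in>W. Z *v v \<in> W}"
      by auto
    show "E l \<in> {Z. \<forall>v\<in>W. Z *v v \<in> W}"
    proof (intro CollectI ballI, unfold mem_W_iff E_mult_vec[OF l] vec_lambda_beta, intro allI impI)
      fix v :: "'f^'x" and y z assume "\<forall>y z. shell y = shell z \<longrightarrow> v $ y = v $ z" "shell y = shell z"
      then have "v $ y = v $ z"
        by blast
      with \<open>shell y = shell z\<close>
      show "(if shell y = l then v $ y else 0) = (if shell z = l then v $ z else (0 :: 'f))"
        by simp
    qed
  qed
  with assms show ?thesis by auto
qed

lemma transpose_T_mult_W: "Z \<in> T \<Longrightarrow> v \<in> W \<Longrightarrow> transpose Z *v v \<in> W"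
  by (rule T_mult_W[OF transpose_in_T])

lemma all_one_mat_in_T: "(all_one_mat :: 'f^'x^'x) \<in> T"
proof -
  have "(all_one_mat :: 'f^'x^'x) $ y $ z = (\<Sum>i\<le>d. adjacency_mat R i) $ y $ z" for y z
  proof -
    obtain j where j: "j \<le> d" "(y, z) \<in> R j"
      using relation_unique[of y z] by blast
    then have "(\<Sum>i\<le>d. adjacency_mat R i $ y $ z :: 'f) = (\<Sum>i\<le>d. if i = j then 1 else 0)"
      using relation_unique[of y z] by (intro sum.cong) (auto simp: adjacency_mat_def)
    then show ?thesis
      using j by (simp add: all_one_mat_def)
  qed
  then have "(all_one_mat :: 'f^'x^'x) = (\<Sum>i\<le>d. adjacency_mat R i)"
    by (simp add: vec_eq_iff)
  also have "\<dots> \<in> T"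
    using unital_T generators_in_T by (intro mat_space.subspace_sum) (auto simp: unital_subalgebra_def)
  finally show ?thesis .
qed

lemma B_subset_T: "B \<subseteq> T"
  unfolding B_eq_span
proof (rule mat_space.span_minimal)
  show "mat_space.subspace T"
    using unital_T by (simp add: unital_subalgebra_def)
  have "outer (w i) (w j) \<in> T" if "i \<le> d" "j \<le> d" for i j
    using T_closed(5)[OF T_closed(5)[OF generators_in_T(2)[OF that(1)] all_one_mat_in_T]
        generators_in_T(2)[OF that(2)]] by (simp add: E_all_one_E that)
  then show "{outer (w i) (w j) | i j. i \<le> d \<and> j \<le> d} \<subseteq> T"
    by auto
qed

lemma outer_in_T: "u \<in> W \<Longrightarrow> v \<in> W \<Longrightarrow> outer u v \<in> T"
  using outer_in_B B_subset_T by blast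

text \<open>A product of \<open>Y\<close> with \<open>outer u v\<close> is \<open>outer (Y *v u) v\<close> or \<open>outer u (transpose Y *v v)\<close>, and \<open>T\<close> and its
  transposes preserve \<open>W\<close>.\<close>

lemma B_ideal:
  assumes "Y \<in> T" "Z \<in> B"
  shows "Y ** Z \<in> B" "Z ** Y \<in> B"
proof -
  have gen: "\<And>i j. outer (w i) (w j) \<in> {Z. Y ** Z \<in> B \<and> Z ** Y \<in> B}"
    using T_mult_W[OF assms(1)] transpose_T_mult_W[OF assms(1)]
    by (simp add: mult_outer outer_mult outer_in_B del: transpose_matrix_vector)
  have "mat_space.subspace {Z. Y ** Z \<in> B \<and> Z ** Y \<in> B}"
    using subspace_B unfolding mat_space.subspace_def
    by (auto simp: matrix_add_ldistrib mat_add_mult mat_scale_mult_left mat_scale_mult_right)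
  then have "B \<subseteq> {Z. Y ** Z \<in> B \<and> Z ** Y \<in> B}"
    using gen unfolding B_eq_span by (intro mat_space.span_minimal) auto
  with assms(2) show "Y ** Z \<in> B" "Z ** Y \<in> B"
    by auto
qed

end

section \<open>Matrix algebras as rings and modules\<close>

lemma ring_mat_algebra:
  assumes "unital_subalgebra A"
  shows "ring (mat_algebra A)"
proof (rule ringI)
  have A: "0 \<in> A" "\<And>Y Z. Y \<in> A \<Longrightarrow> Z \<in> A \<Longrightarrow> Y + Z \<in> A" "\<And>Z. Z \<in> A \<Longrightarrow> - Z \<in> A"
    "\<And>Y Z. Y \<in> A \<Longrightarrow> Z \<in> A \<Longrightarrow> Y ** Z \<in> A" "mat 1 \<in> A"
    using assms by (auto simp: unital_subalgebra_def mat_space.subspace_0 mat_space.subspace_add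
        mat_space.subspace_neg)
  show "abelian_group (mat_algebra A)"
    by (rule abelian_groupI) (use A in \<open>auto intro!: bexI[of _ "- _"]\<close>)
  show "Group.monoid (mat_algebra A)"
    by (rule monoidI) (use A in \<open>auto simp: matrix_mul_assoc\<close>)
qed (simp_all add: mat_add_mult matrix_add_ldistrib)

lemma regular_module_simps [simp]:
  "carrier (regular_module R) = carrier R" "\<zero>\<^bsub>regular_module R\<^esub> = \<zero>\<^bsub>R\<^esub>"
  "u \<oplus>\<^bsub>regular_module R\<^esub> v = u \<oplus>\<^bsub>R\<^esub> v" "a \<odot>\<^bsub>regular_module R\<^esub> u = a \<otimes>\<^bsub>R\<^esub> u"
  by (simp_all add: regular_module_def)

lemma left_module_regular_module:
  assumes "ring R"
  shows "left_module R (regular_module R)"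
proof -
  interpret ring R by fact
  have "abelian_group (regular_module R)"
  proof (rule abelian_groupI)
    show "\<exists>v\<in>carrier (regular_module R). v \<oplus>\<^bsub>regular_module R\<^esub> u = \<zero>\<^bsub>regular_module R\<^esub>"
      if "u \<in> carrier (regular_module R)" for u
      using that by (intro bexI[of _ "\<ominus>\<^bsub>R\<^esub> u"]) (simp_all add: l_neg)
  qed (simp add: a_assoc | simp add: a_comm)+
  then show ?thesis
    using ring_axioms
    by (simp add: left_module_def left_module_axioms_def l_distr r_distr m_assoc)
qed

lemma vec_module_simps [simp]:
  "carrier (vec_module N) = N" "\<zero>\<^bsub>vec_module N\<^esub> = 0"
  "u \<oplus>\<^bsub>vec_module N\<^esub> v = u + v" "Z \<odot>\<^bsub>vec_module N\<^esub> u = Z *v u"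
  by (simp_all add: vec_module_def)

lemma mat_mult_diff: "Y ** (Z - Z') = Y ** Z - Y ** (Z' :: 'f::field^'x::finite^'x)"
  by (simp add: vec_eq_iff matrix_matrix_mult_def algebra_simps sum_subtractf)

lemma set_add_mat_algebra: "N <+>\<^bsub>mat_algebra A\<^esub> D = {Y + Z | Y Z. Y \<in> N \<and> Z \<in> D}"
  by (auto simp: set_add_def set_mult_def)

context terwilliger_algebra
begin

abbreviation TA :: "('f, 'f^'x^'x) module" where "TA \<equiv> mat_algebra T"
abbreviation W0 :: "('f^'x^'x, 'f^'x) module" where "W0 \<equiv> vec_module W"

lemma ring_TA: "ring TA"
  by (rule ring_mat_algebra[OF unital_T])

lemma left_module_TA: "left_module TA (regular_module TA)"
  by (rule left_module_regular_module[OF ring_TA])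

lemma left_ideal_iff:
  "Module.submodule N TA (regular_module TA) \<longleftrightarrow> N \<subseteq> T \<and> 0 \<in> N \<and>
     (\<forall>u\<in>N. \<forall>v\<in>N. u + v \<in> N) \<and> (\<forall>a\<in>T. \<forall>u\<in>N. a ** u \<in> N)"
  unfolding left_module.submodule_iff[OF left_module_TA] by simp

lemma left_module_W0: "left_module TA W0"
proof -
  have "abelian_group W0"
  proof (rule abelian_groupI)
    show "\<exists>v\<in>carrier W0. v \<oplus>\<^bsub>W0\<^esub> u = \<zero>\<^bsub>W0\<^esub>" if "u \<in> carrier W0" for u
      using that W_closed(3)[of u "- 1"] by (intro bexI[of _ "- u"]) auto
  qed (auto simp: W_closed add.assoc add.commute)
  then show ?thesis
    using ring_TA T_mult_W
    by (simp add: left_module_def left_module_axioms_def matrix_vector_mult_add_rdistrib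
        matrix_vector_right_distrib matrix_vector_mul_assoc)
qed

lemma submodule_W0_iff:
  "Module.submodule N TA W0 \<longleftrightarrow> N \<subseteq> W \<and> 0 \<in> N \<and>
     (\<forall>u\<in>N. \<forall>v\<in>N. u + v \<in> N) \<and> (\<forall>a\<in>T. \<forall>u\<in>N. a *v u \<in> N)"
  unfolding left_module.submodule_iff[OF left_module_W0] by simp

text \<open>In the basis of the \<open>w i\<close>, the form \<open>dot\<close> on \<open>W\<close> has the diagonal Gram matrix with entries \<open>k i\<close>.\<close>

definition nondegenerate :: bool where
  "nondegenerate \<longleftrightarrow> (\<forall>i\<le>d. (of_nat (k i) :: 'f) \<noteq> 0)"

lemma nondegenerateD: "nondegenerate \<Longrightarrow> i \<le> d \<Longrightarrow> (of_nat (k i) :: 'f) \<noteq> 0"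
  by (simp add: nondegenerate_def)

lemma not_nondegenerateE:
  assumes "\<not> nondegenerate"
  obtains i where "i \<le> d" "(of_nat (k i) :: 'f) = 0"
  using assms by (auto simp: nondegenerate_def)

lemma nondegenerate_dot:
  assumes "nondegenerate" "v \<in> W" "\<And>i. i \<le> d \<Longrightarrow> dot (w i) v = 0"
  shows "v = 0"
proof (rule W_eqI)
  fix i assume "i \<le> d"
  then show "v $ rep i = 0 $ rep i"
    using assms(3)[of i] nondegenerateD[OF assms(1), of i] by (simp add: dot_w[OF assms(2)])
qed (simp_all add: assms W_closed)

lemma degenerate_dot: "(of_nat (k i) :: 'f) = 0 \<Longrightarrow> v \<in> W \<Longrightarrow> dot (w i) v = 0"
  by (simp add: dot_w)

lemma w_ne_0: "i \<le> d \<Longrightarrow> w i \<noteq> 0"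
  by (metis rep w_nth zero_index zero_neq_one)

lemma outer_w_0_ne_0: "i \<le> d \<Longrightarrow> outer (w 0) (w i) \<noteq> 0"
proof -
  assume "i \<le> d"
  then have "outer (w 0) (w i) $ x $ rep i = 1"
    by (simp add: shell_eq_0_iff)
  then show ?thesis by (metis zero_index zero_neq_one)
qed

lemma R_0_thin: "R 0 \<in> thin_radical d R"
  by (simp add: thin_iff k_0)

section \<open>The identity of the primary ideal\<close>

text \<open>The sum of the \<open>outer (w i) (w i) / k i\<close>.\<close>

definition unit_B :: "'f^'x^'x" where
  "unit_B = (\<chi> y z. if shell y = shell z then 1 / of_nat (k (shell y)) else 0)"

lemma unit_B_in_B: "unit_B \<in> B"
  by (simp add: mem_B_iff unit_B_def)

lemma column_B: "Z \<in> B \<Longrightarrow> (\<chi> z. Z $ z $ y) \<in> W"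
  unfolding mem_B_iff mem_W_iff vec_lambda_beta by blast

lemma transpose_B: "Z \<in> B \<Longrightarrow> transpose Z \<in> B"
  unfolding mem_B_iff transpose_def vec_lambda_beta by blast

lemma unit_B_mult:
  assumes "nondegenerate" "Z \<in> B"
  shows "unit_B ** Z = Z" "Z ** unit_B = Z"
proof -
  have *: "unit_B ** Z = Z" if "Z \<in> B" for Z
  proof -
    have "(unit_B ** Z) $ y $ z = Z $ y $ z" for y z
    proof -
      have "(unit_B ** Z) $ y $ z = (1 / of_nat (k (shell y))) * dot (w (shell y)) (\<chi> y'. Z $ y' $ z)"
        unfolding matrix_matrix_mult_def dot_def sum_distrib_left vec_lambda_beta
        by (intro sum.cong) (auto simp: unit_B_def)
      also have "\<dots> = Z $ rep (shell y) $ z"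
        using nondegenerateD[OF assms(1) shell(1)[of y]] by (simp add: dot_w[OF column_B[OF that]])
      also have "\<dots> = Z $ y $ z"
        using W_nth[OF column_B[OF that, of z], of y] by simp
      finally show ?thesis .
    qed
    then show ?thesis
      by (simp add: vec_eq_iff)
  qed
  show "unit_B ** Z = Z"
    by (rule *) fact
  have "transpose unit_B = unit_B"
    by (simp add: vec_eq_iff transpose_def unit_B_def)
  then have "transpose (Z ** unit_B) = transpose Z"
    using *[OF transpose_B[OF assms(2)]] by (simp add: matrix_transpose_mul)
  then show "Z ** unit_B = Z"
    by (metis transpose_transpose)
qed

text \<open>Both products lie in the ideal \<open>B\<close>, so both agree with \<open>unit_B ** Z ** unit_B\<close>.\<close>

lemma unit_B_central:
  assumes "nondegenerate" "Z \<in> T"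
  shows "unit_B ** Z = Z ** unit_B"
proof -
  have "unit_B ** Z = (unit_B ** Z) ** unit_B"
    using unit_B_mult[OF assms(1) B_ideal(2)[OF assms(2) unit_B_in_B]] by simp
  also have "\<dots> = unit_B ** (Z ** unit_B)"
    by (simp add: matrix_mul_assoc)
  also have "\<dots> = Z ** unit_B"
    using unit_B_mult[OF assms(1) B_ideal(1)[OF assms(2) unit_B_in_B]] by simp
  finally show ?thesis .
qed

text \<open>The columns of \<open>Z \<in> B\<close> lie in \<open>W\<close>, and \<open>w i\<close> is orthogonal to \<open>W\<close> when \<open>k i = 0\<close>.\<close>

lemma degenerate_mult_B:
  assumes i: "(of_nat (k i) :: 'f) = 0" and Z: "Z \<in> B"
  shows "outer u (w i) ** Z = 0"
proof -
  have "(transpose Z *v w i) $ y = dot (w i) (\<chi> z. Z $ z $ y)" for y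
    by (simp add: matrix_vector_mult_def transpose_def dot_def mult.commute del: transpose_matrix_vector)
  then have "transpose Z *v w i = 0"
    using degenerate_dot[OF i column_B[OF Z]]
    by (simp add: vec_eq_iff del: transpose_matrix_vector)
  then show ?thesis
    unfolding outer_mult by (simp add: vec_eq_iff)
qed

text \<open>If \<open>k i = 0\<close>, the nonzero element \<open>outer (w 0) (w i)\<close> of \<open>B\<close> has product zero with everything in
  \<open>B\<close>, in particular with a right identity.\<close>

lemma nondegenerate_if_right_unit:
  assumes "e \<in> B" "\<And>b. b \<in> B \<Longrightarrow> b ** e = b"
  shows "nondegenerate"
proof (rule ccontr)
  assume "\<not> nondegenerate"
  then obtain i where i: "i \<le> d" "(of_nat (k i) :: 'f) = 0"
    by (rule not_nondegenerateE)
  then have "outer (w 0) (w i) ** e = 0"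
    using degenerate_mult_B assms(1) by blast
  then show False
    using assms(2)[OF outer_in_B[OF w_in_W w_in_W], of 0 i] outer_w_0_ne_0[OF i(1)] by simp
qed

lemma nondegenerate_iff_unital:
  "nondegenerate \<longleftrightarrow>
    (\<exists>e\<in>B. (\<forall>b\<in>B. e ** b = b \<and> b ** e = b) \<and> (\<forall>Z\<in>carrier TA. e ** Z = Z ** e))"
proof
  assume nondegenerate
  then show "\<exists>e\<in>B. (\<forall>b\<in>B. e ** b = b \<and> b ** e = b) \<and> (\<forall>Z\<in>carrier TA. e ** Z = Z ** e)"
    using unit_B_in_B unit_B_mult unit_B_central by auto
qed (auto intro: nondegenerate_if_right_unit)

lemma ideal_iff:
  "ideal D TA \<longleftrightarrow> Module.submodule D TA (regular_module TA) \<and> (\<forall>Z\<in>D. \<forall>a\<in>T. Z ** a \<in> D)"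
proof -
  have "subgroup D (add_monoid (regular_module TA)) \<longleftrightarrow> subgroup D (add_monoid TA)"
    by (simp add: subgroup_def m_inv_def regular_module_def mat_algebra_def)
  then show ?thesis
    using ring_TA
    unfolding ideal_def ideal_axioms_def Module.submodule_def Module.submodule_axioms_def
      additive_subgroup_def
    by auto
qed

text \<open>A complement of \<open>B\<close> is the annihilator of its central identity. Conversely, if \<open>1 = e + f\<close> is the
  decomposition of the identity, then \<open>B f \<subseteq> B \<inter> D = 0\<close>, so \<open>e\<close> is a right identity of \<open>B\<close>.\<close>

lemma nondegenerate_iff_complement:
  "nondegenerate \<longleftrightarrow> (\<exists>D. ideal D TA \<and> B \<inter> D = {\<zero>\<^bsub>TA\<^esub>} \<and> B <+>\<^bsub>TA\<^esub> D = carrier TA)"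
proof
  assume H: nondegenerate
  let ?D = "{Z \<in> T. unit_B ** Z = 0}"
  have "ideal ?D TA"
    unfolding ideal_iff left_ideal_iff
  proof (intro conjI ballI)
    fix a Z assume aZ: "a \<in> T" "Z \<in> ?D"
    have "unit_B ** (a ** Z) = a ** (unit_B ** Z)"
      by (simp add: matrix_mul_assoc unit_B_central[OF H aZ(1)])
    then show "a ** Z \<in> ?D"
      using aZ by (simp add: T_closed)
  next
    fix a Z assume "Z \<in> ?D" "a \<in> T"
    then show "Z ** a \<in> ?D"
      by (simp add: T_closed matrix_mul_assoc)
  qed (auto simp: T_closed matrix_add_ldistrib)
  moreover have "B \<inter> ?D = {0}"
    using unit_B_mult(1)[OF H] subspace_B by (auto simp: T_closed mat_space.subspace_0)
  moreover have "Z \<in> B <+>\<^bsub>TA\<^esub> ?D" if "Z \<in> T" for Z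
  proof -
    have BZ: "unit_B ** Z \<in> B"
      using B_ideal(2)[OF that unit_B_in_B] .
    have "unit_B ** (Z - unit_B ** Z) = 0"
      using unit_B_mult(1)[OF H BZ] by (simp add: mat_mult_diff)
    moreover have "Z - unit_B ** Z \<in> T"
      using BZ B_subset_T that by (blast intro: T_closed)
    ultimately have "Z = unit_B ** Z + (Z - unit_B ** Z)" "Z - unit_B ** Z \<in> ?D"
      by simp_all
    with BZ show ?thesis
      unfolding set_add_mat_algebra by blast
  qed
  moreover have "B <+>\<^bsub>TA\<^esub> ?D \<subseteq> T"
    using B_subset_T by (auto simp: set_add_mat_algebra T_closed)
  ultimately have "ideal ?D TA \<and> B \<inter> ?D = {\<zero>\<^bsub>TA\<^esub>} \<and> B <+>\<^bsub>TA\<^esub> ?D = carrier TA"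
    by auto
  then show "\<exists>D. ideal D TA \<and> B \<inter> D = {\<zero>\<^bsub>TA\<^esub>} \<and> B <+>\<^bsub>TA\<^esub> D = carrier TA"
    by (rule exI)
next
  assume "\<exists>D. ideal D TA \<and> B \<inter> D = {\<zero>\<^bsub>TA\<^esub>} \<and> B <+>\<^bsub>TA\<^esub> D = carrier TA"
  then obtain D where D: "ideal D TA" "B \<inter> D = {0}" "B <+>\<^bsub>TA\<^esub> D = T"
    by auto
  have D': "D \<subseteq> T" "\<And>a Z. a \<in> T \<Longrightarrow> Z \<in> D \<Longrightarrow> a ** Z \<in> D"
    using D(1) unfolding ideal_iff left_ideal_iff by blast+
  have "mat 1 \<in> B <+>\<^bsub>TA\<^esub> D"
    unfolding D(3) by (rule T_closed)
  then obtain e f where ef: "mat 1 = e + f" "e \<in> B" "f \<in> D"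
    by (auto simp: set_add_mat_algebra)
  show nondegenerate
  proof (rule nondegenerate_if_right_unit[OF ef(2)])
    fix b assume b: "b \<in> B"
    have "b ** f \<in> B" "b ** f \<in> D"
      using B_ideal(2) D' ef(3) b B_subset_T by blast+
    then have "b ** f = 0"
      using D(2) by blast
    moreover have "b = b ** (e + f)"
      unfolding ef(1)[symmetric] by simp
    ultimately show "b ** e = b"
      by (simp add: matrix_add_ldistrib)
  qed
qed

section \<open>Annihilator and radical\<close>

lemma mem_annihilator_iff: "Z \<in> annihilator TA W0 \<longleftrightarrow> Z \<in> T \<and> (\<forall>v\<in>W. Z *v v = 0)"
  by (simp add: annihilator_def)

text \<open>Multiplication by \<open>E i\<close> extracts a row or a column of \<open>Z\<close>. The column is \<open>Z *v w i = 0\<close>.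
  The row is \<open>transpose Z *v w i \<in> W\<close>, which is orthogonal to \<open>W\<close> because \<open>Z\<close> kills \<open>W\<close>.\<close>

lemma annihilator_kills_thin:
  assumes H: "nondegenerate" and Z: "Z \<in> annihilator TA W0" and i: "i \<le> d" "R i \<in> thin_radical d R"
  shows "E i ** Z = 0 \<and> Z ** E i = 0"
proof
  have Ei: "E i = outer (w i) (w i)"
    using i by (simp add: thin_iff E_thin)
  have ZW: "Z *v v = 0" if "v \<in> W" for v
    using Z that by (simp add: mem_annihilator_iff)
  have "transpose Z *v w i = 0"
  proof (rule nondegenerate_dot[OF H])
    show "transpose Z *v w i \<in> W"
      using Z by (intro transpose_T_mult_W) (simp_all add: mem_annihilator_iff)
    show "dot (w j) (transpose Z *v w i) = 0" for j
      unfolding dot_adjoint[symmetric] using ZW[of "w j"] by (simp add: dot_def)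
  qed
  then show "E i ** Z = 0"
    unfolding Ei outer_mult by (simp add: vec_eq_iff)
  show "Z ** E i = 0"
    unfolding Ei mult_outer using ZW[of "w i"] by (simp add: vec_eq_iff)
qed

lemma E_0_outer: "E 0 ** outer (w 0) v = outer (w 0) v"
  by (simp add: E_0 outer_outer dot_w_w k_0)

lemma nondegenerate_iff_annihilator:
  "nondegenerate \<longleftrightarrow> (\<forall>Z\<in>annihilator TA W0. \<forall>i\<le>d. R i \<in> thin_radical d R \<longrightarrow> E i ** Z = 0 \<and> Z ** E i = 0)"
proof
  assume r: "\<forall>Z\<in>annihilator TA W0. \<forall>i\<le>d. R i \<in> thin_radical d R \<longrightarrow> E i ** Z = 0 \<and> Z ** E i = 0"
  show nondegenerate
  proof (rule ccontr)
    assume "\<not> nondegenerate"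
    then obtain i where i: "i \<le> d" "(of_nat (k i) :: 'f) = 0"
      by (rule not_nondegenerateE)
    have "outer (w 0) (w i) \<in> annihilator TA W0"
      using degenerate_dot[OF i(2)] by (simp add: mem_annihilator_iff outer_mult_vec outer_in_T)
    then have "outer (w 0) (w i) = 0"
      using r R_0_thin E_0_outer by (metis le0)
    then show False
      using outer_w_0_ne_0[OF i(1)] by simp
  qed
qed (use annihilator_kills_thin in blast)

text \<open>If \<open>dot (w i) v \<noteq> 0\<close>, the matrices \<open>outer u (w i)\<close> move \<open>v\<close> to a nonzero multiple of any \<open>u \<in> W\<close>.\<close>

lemma submodule_W0_nonzero:
  assumes H: "nondegenerate" and N: "Module.submodule N TA W0" and v: "v \<in> N" "v \<noteq> 0"
  shows "N = W"
proof -
  have N': "N \<subseteq> W" "\<And>a u. a \<in> T \<Longrightarrow> u \<in> N \<Longrightarrow> a *v u \<in> N"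
    using N unfolding submodule_W0_iff by blast+
  then have "v \<in> W"
    using v by blast
  then obtain i where i: "i \<le> d" "dot (w i) v \<noteq> 0"
    using nondegenerate_dot[OF H] v(2) by blast
  have "u \<in> N" if "u \<in> W" for u
  proof -
    have "outer ((1 / dot (w i) v) *s u) (w i) *v v \<in> N"
      by (intro N'(2) v(1) outer_in_T W_closed that w_in_W)
    then show ?thesis
      using i(2) by (simp add: outer_mult_vec vector_smult_assoc)
  qed
  with N' show ?thesis by blast
qed

text \<open>The radical of the form is a submodule of \<open>W\<close>. It never contains \<open>w 0\<close>, since \<open>k 0 = 1\<close>, and it
  contains \<open>w i\<close> if \<open>k i = 0\<close>.\<close>

lemma nondegenerate_iff_irreducible: "nondegenerate \<longleftrightarrow> irreducible_module TA W0"
proof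
  assume H: nondegenerate
  have "N = {0} \<or> N = W" if N: "Module.submodule N TA W0" for N
  proof (cases "\<exists>v\<in>N. v \<noteq> 0")
    case True
    then show ?thesis
      using submodule_W0_nonzero[OF H N] by blast
  next
    case False
    moreover have "0 \<in> N"
      using N unfolding submodule_W0_iff by blast
    ultimately show ?thesis by blast
  qed
  moreover have "W \<noteq> {0}"
    using w_in_W[of 0] w_ne_0[of 0] by (metis le0 singletonD)
  ultimately show "irreducible_module TA W0"
    using left_module_W0 by (auto simp: irreducible_module_def)
next
  assume irr: "irreducible_module TA W0"
  show nondegenerate
  proof (rule ccontr)
    assume "\<not> nondegenerate"
    then obtain i where i: "i \<le> d" "(of_nat (k i) :: 'f) = 0"
      by (rule not_nondegenerateE)
    let ?N = "{v \<in> W. \<forall>u\<in>W. dot u v = 0}"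
    have "Module.submodule ?N TA W0"
      unfolding submodule_W0_iff
    proof (intro conjI ballI)
      fix Z v assume Z: "Z \<in> T" and v: "v \<in> ?N"
      have "dot u (Z *v v) = 0" if "u \<in> W" for u
        using dot_adjoint[of "transpose Z" u v] v transpose_T_mult_W[OF Z that]
        by (simp add: transpose_transpose del: transpose_matrix_vector)
      then show "Z *v v \<in> ?N"
        using v T_mult_W[OF Z] by simp
    qed (auto simp: W_closed dot_add_right, simp add: dot_def)
    then have "?N = {0} \<or> ?N = W"
      using irreducible_moduleD[OF irr] by simp
    moreover have "w i \<in> ?N"
      using degenerate_dot[OF i(2)] by (simp add: dot_commute)
    moreover have "w i \<noteq> 0"
      using w_ne_0[OF i(1)] .
    moreover have "w 0 \<notin> ?N"
    proof
      assume "w 0 \<in> ?N"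
      then have "dot (w 0) (w 0) = 0"
        using w_in_W[of 0] by blast
      then show False
        using dot_w_w[of 0 0] by (simp add: k_0)
    qed
    ultimately show False
      using w_in_W[of 0] by blast
  qed
qed

text \<open>The quotient by the annihilator of \<open>v\<close> is \<open>T v\<close>, which is the irreducible module \<open>W\<close>.\<close>

lemma maximal_left_ideal_annihilator:
  assumes H: "nondegenerate" and v: "v \<in> W" "v \<noteq> 0"
  shows "maximal_left_ideal TA {Z \<in> T. Z *v v = 0}"
proof -
  let ?I = "{Z \<in> T. Z *v v = 0}"
  have "Module.submodule ?I TA (regular_module TA)"
    unfolding left_ideal_iff
    by (auto simp: T_closed matrix_vector_mult_add_rdistrib matrix_vector_mul_assoc[symmetric])
  moreover have "?I \<noteq> T"
  proof -
    have "mat 1 \<notin> ?I"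
      using v by simp
    then show ?thesis
      using T_closed(2)[of 1] by blast
  qed
  moreover have "K = T" if K: "Module.submodule K TA (regular_module TA)" "?I \<subseteq> K" "K \<noteq> ?I" for K
  proof -
    have K': "K \<subseteq> T" "0 \<in> K" "\<And>Y Z. Y \<in> K \<Longrightarrow> Z \<in> K \<Longrightarrow> Y + Z \<in> K"
      "\<And>Y Z. Y \<in> T \<Longrightarrow> Z \<in> K \<Longrightarrow> Y ** Z \<in> K"
      using K(1) unfolding left_ideal_iff by blast+
    obtain Y where Y: "Y \<in> K" "Y *v v \<noteq> 0"
      using K(2,3) K'(1) by blast
    have sub: "Module.submodule ((\<lambda>Z. Z *v v) ` K) TA W0"
      unfolding submodule_W0_iff
    proof (intro conjI ballI)
      show "(\<lambda>Z. Z *v v) ` K \<subseteq> W"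
        using K'(1) T_mult_W v(1) by auto
      show "0 \<in> (\<lambda>Z. Z *v v) ` K"
        using K'(2) by (intro image_eqI[of _ _ 0]) simp_all
    next
      fix a b assume "a \<in> (\<lambda>Z. Z *v v) ` K" "b \<in> (\<lambda>Z. Z *v v) ` K"
      then obtain Z Z' where "Z \<in> K" "a = Z *v v" "Z' \<in> K" "b = Z' *v v"
        by blast
      then show "a + b \<in> (\<lambda>Z. Z *v v) ` K"
        using K'(3) by (intro image_eqI[of _ _ "Z + Z'"]) (simp_all add: matrix_vector_mult_add_rdistrib)
    next
      fix Z a assume "Z \<in> T" "a \<in> (\<lambda>Z. Z *v v) ` K"
      then obtain Z' where "Z \<in> T" "Z' \<in> K" "a = Z' *v v"
        by blast
      then show "Z *v a \<in> (\<lambda>Z. Z *v v) ` K"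
        using K'(4) by (intro image_eqI[of _ _ "Z ** Z'"]) (simp_all add: matrix_vector_mul_assoc)
    qed
    have "v \<in> (\<lambda>Z. Z *v v) ` K"
      using submodule_W0_nonzero[OF H sub imageI[OF Y(1)] Y(2)] v(1) by simp
    then obtain Z where Z: "Z \<in> K" "Z *v v = v"
      by auto
    have "mat 1 - Z \<in> T"
      using Z(1) K'(1) by (blast intro: T_closed)
    then have "mat 1 - Z \<in> ?I"
      using Z(2) by (simp add: matrix_vector_mult_diff_rdistrib)
    then have "(mat 1 - Z) + Z \<in> K"
      using Z(1) K(2) by (blast intro: K'(3))
    then have one: "mat 1 \<in> K"
      by simp
    have "Y \<in> K" if "Y \<in> T" for Y
      using K'(4)[OF that one] by simp
    with K'(1) show ?thesis by blast
  qed
  ultimately show ?thesis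
    unfolding maximal_left_ideal_def mat_algebra_simps by blast
qed

lemma radical_in_annihilator:
  assumes H: "nondegenerate" and Z: "Z \<in> jacobson_radical TA"
  shows "Z \<in> annihilator TA W0"
proof -
  have "Z *v v = 0" if "v \<in> W" for v
  proof (cases "v = 0")
    case False
    then show ?thesis
      using maximal_left_ideal_annihilator[OF H that] Z unfolding jacobson_radical_def by blast
  qed simp
  then show ?thesis
    using Z by (simp add: mem_annihilator_iff jacobson_radical_def)
qed

text \<open>If \<open>k i = 0\<close> in the field, the left ideal of all \<open>outer v (w i)\<close> with \<open>v \<in> W\<close> has square zero, so
  it lies in every maximal left ideal.\<close>

lemma degenerate_in_radical:
  assumes i: "(of_nat (k i) :: 'f) = 0"
  shows "outer (w 0) (w i) \<in> jacobson_radical TA"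
proof -
  let ?Z = "outer (w 0) (w i)"
  have "?Z \<in> I" if I: "maximal_left_ideal TA I" for I
  proof (rule ccontr)
    assume Z: "?Z \<notin> I"
    have I': "I \<subseteq> T" "0 \<in> I" "\<And>Y Z. Y \<in> I \<Longrightarrow> Z \<in> I \<Longrightarrow> Y + Z \<in> I"
      "\<And>Y Z. Y \<in> T \<Longrightarrow> Z \<in> I \<Longrightarrow> Y ** Z \<in> I"
      and max: "\<And>K. Module.submodule K TA (regular_module TA) \<Longrightarrow> I \<subseteq> K \<Longrightarrow> K = I \<or> K = T"
      using I unfolding maximal_left_ideal_def left_ideal_iff mat_algebra_simps by blast+
    let ?K = "{Y + outer v (w i) | Y v. Y \<in> I \<and> v \<in> W}"
    have "Module.submodule ?K TA (regular_module TA)"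
      unfolding left_ideal_iff
    proof (intro conjI ballI)
      show "?K \<subseteq> T"
        using I'(1) by (auto intro!: T_closed outer_in_T)
      have "0 = 0 + outer 0 (w i)"
        by (simp add: vec_eq_iff)
      then show "0 \<in> ?K"
        using I'(2) W_closed(1) by blast
    next
      fix a b assume "a \<in> ?K" "b \<in> ?K"
      then obtain Y v Y' v' where *: "Y \<in> I" "v \<in> W" "a = Y + outer v (w i)"
        "Y' \<in> I" "v' \<in> W" "b = Y' + outer v' (w i)"
        by blast
      then have "a + b = (Y + Y') + outer (v + v') (w i)"
        by (simp add: outer_add_left)
      then show "a + b \<in> ?K"
        using I'(3) W_closed(2) * by blast
    next
      fix A a assume "A \<in> T" "a \<in> ?K"
      then obtain Y v where *: "A \<in> T" "Y \<in> I" "v \<in> W" "a = Y + outer v (w i)"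
        by blast
      then have "A ** a = A ** Y + outer (A *v v) (w i)"
        by (simp add: matrix_add_ldistrib mult_outer)
      then show "A ** a \<in> ?K"
        using I'(4) T_mult_W * by blast
    qed
    moreover have "I \<subseteq> ?K"
    proof
      fix Y assume "Y \<in> I"
      moreover have "Y = Y + outer 0 (w i)"
        by (simp add: vec_eq_iff)
      ultimately show "Y \<in> ?K"
        using W_closed(1) by blast
    qed
    moreover have "?Z \<in> ?K"
    proof -
      have "?Z = 0 + outer (w 0) (w i)"
        by simp
      then show ?thesis
        using I'(2) w_in_W by blast
    qed
    ultimately have "?K = T"
      using max[of ?K] Z by blast
    then have "mat 1 \<in> ?K"
      using T_closed(2)[of 1] by simp
    then obtain Y v where Y: "Y \<in> I" "v \<in> W" "mat 1 = Y + outer v (w i)"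
      by blast
    have "?Z = ?Z ** (Y + outer v (w i))"
      unfolding Y(3)[symmetric] by simp
    also have "\<dots> = ?Z ** Y"
      using degenerate_dot[OF i Y(2)] by (simp add: matrix_add_ldistrib outer_outer)
    also have "\<dots> \<in> I"
      using I'(4) Y(1) outer_in_T by simp
    finally show False
      using Z by simp
  qed
  then show ?thesis
    using outer_in_T by (simp add: jacobson_radical_def)
qed

lemma nondegenerate_iff_radical:
  "nondegenerate \<longleftrightarrow> (\<forall>Z\<in>jacobson_radical TA. \<forall>i\<le>d. R i \<in> thin_radical d R \<longrightarrow> E i ** Z = 0 \<and> Z ** E i = 0)"
proof
  assume r: "\<forall>Z\<in>jacobson_radical TA. \<forall>i\<le>d. R i \<in> thin_radical d R \<longrightarrow> E i ** Z = 0 \<and> Z ** E i = 0"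
  show nondegenerate
  proof (rule ccontr)
    assume "\<not> nondegenerate"
    then obtain i where i: "i \<le> d" "(of_nat (k i) :: 'f) = 0"
      by (rule not_nondegenerateE)
    then have "outer (w 0) (w i) = 0"
      using r R_0_thin E_0_outer degenerate_in_radical[OF i(2)] by (metis le0)
    then show False
      using outer_w_0_ne_0[OF i(1)] by simp
  qed
qed (use annihilator_kills_thin radical_in_annihilator in blast)

end

section \<open>Copies of the field as division algebras\<close>

text \<open>For an injective \<open>h\<close>, a one-dimensional division algebra on a prescribed type.\<close>

definition field_copy :: "('f::field \<Rightarrow> 'u) \<Rightarrow> ('f, 'u) module" where
  "field_copy h = \<lparr>carrier = range h, mult = (\<lambda>a b. h (inv_into UNIV h a * inv_into UNIV h b)), one = h 1, zero = h 0,
     add = (\<lambda>a b. h (inv_into UNIV h a + inv_into UNIV h b)), smult = (\<lambda>c a. h (c * inv_into UNIV h a))\<rparr>"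

lemma field_copy_simps:
  assumes "inj h"
  shows "carrier (field_copy h) = range h" "\<one>\<^bsub>field_copy h\<^esub> = h 1" "\<zero>\<^bsub>field_copy h\<^esub> = h 0"
    "h a \<otimes>\<^bsub>field_copy h\<^esub> h b = h (a * b)" "h a \<oplus>\<^bsub>field_copy h\<^esub> h b = h (a + b)"
    "c \<odot>\<^bsub>field_copy h\<^esub> h a = h (c * a)"
  using assms by (simp_all add: field_copy_def)

lemma ring_field_copy:
  assumes "inj h"
  shows "ring (field_copy h)"
proof (rule ringI)
  note [simp] = field_copy_simps[OF assms]
  show "abelian_group (field_copy h)"
  proof (rule abelian_groupI)
    fix a assume "a \<in> carrier (field_copy h)"
    then obtain c where "a = h c"
      by auto
    then show "\<exists>b\<in>carrier (field_copy h). b \<oplus>\<^bsub>field_copy h\<^esub> a = \<zero>\<^bsub>field_copy h\<^esub>"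
      by (intro bexI[of _ "h (- c)"]) simp_all
  qed (auto simp: add_ac)
  show "Group.monoid (field_copy h)"
    by (rule monoidI) (auto simp: mult.assoc)
qed (auto simp: field_copy_simps[OF assms] distrib_left distrib_right)

lemma division_algebra_field_copy:
  assumes "inj h"
  shows "division_algebra (field_copy h)"
proof -
  note [simp] = field_copy_simps[OF assms] inj_eq[OF assms]
  interpret ring "field_copy h"
    by (rule ring_field_copy[OF assms])
  have "vectorspace scalar_field (field_copy h)"
  proof (rule vs_criteria)
    show "\<forall>v\<in>carrier (field_copy h). \<exists>b\<in>carrier (field_copy h). v \<oplus>\<^bsub>field_copy h\<^esub> b = \<zero>\<^bsub>field_copy h\<^esub>"
    proof
      fix a assume "a \<in> carrier (field_copy h)"
      then obtain c where "a = h c"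
        by auto
      then show "\<exists>b\<in>carrier (field_copy h). a \<oplus>\<^bsub>field_copy h\<^esub> b = \<zero>\<^bsub>field_copy h\<^esub>"
        by (intro bexI[of _ "h (- c)"]) simp_all
    qed
  qed (auto simp: algebra_simps)
  moreover have "Units (field_copy h) = carrier (field_copy h) - {\<zero>\<^bsub>field_copy h\<^esub>}"
  proof (intro equalityI subsetI)
    fix a assume "a \<in> carrier (field_copy h) - {\<zero>\<^bsub>field_copy h\<^esub>}"
    then obtain c where "a = h c" "c \<noteq> 0"
      by auto
    then show "a \<in> Units (field_copy h)"
      by (auto simp: Units_def intro!: exI[of _ "inverse c"])
  qed (auto simp: Units_def)
  moreover have "division_algebra_axioms (field_copy h)" if "Units (field_copy h) = carrier (field_copy h) - {\<zero>\<^bsub>field_copy h\<^esub>}"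
    by (rule division_algebra_axioms.intro[OF that]) (auto simp: mult.assoc mult.left_commute)
  ultimately show ?thesis
    using ring_axioms by (simp only: division_algebra_def)
qed

lemma finsum_field_copy:
  assumes "inj h" "finite I"
  shows "finsum (field_copy h) (\<lambda>i. h (f i)) I = h (\<Sum>i\<in>I. f i)"
proof -
  interpret ring "field_copy h"
    by (rule ring_field_copy[OF assms(1)])
  note [simp] = field_copy_simps[OF assms(1)]
  show ?thesis
    using assms(2)
  proof (induction I)
    case (insert i I)
    then have "finsum (field_copy h) (\<lambda>i. h (f i)) (insert i I) =
        h (f i) \<oplus>\<^bsub>field_copy h\<^esub> finsum (field_copy h) (\<lambda>i. h (f i)) I"
      by (intro finsum_insert) auto
    with insert show ?case by simp
  qed simp
qed

lemma full_matrix_algebra_right_unit: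
  fixes D :: "('f, 'b, 'm) module_scheme"
  assumes "ring D" and Y: "Y \<in> carrier (full_matrix_algebra n D)"
  shows "Y \<otimes>\<^bsub>full_matrix_algebra n D\<^esub> \<one>\<^bsub>full_matrix_algebra n D\<^esub> = Y"
proof -
  interpret ring D by fact
  have Ymem: "Y (i, j) \<in> carrier D" if "i < n" "j < n" for i j
    using Y that by (auto simp: full_matrix_algebra_def)
  show ?thesis
  proof (rule ext)
    fix p
    show "(Y \<otimes>\<^bsub>full_matrix_algebra n D\<^esub> \<one>\<^bsub>full_matrix_algebra n D\<^esub>) p = Y p"
    proof (cases "p \<in> {..<n} \<times> {..<n}")
      case True
      then obtain i l where p: "p = (i, l)" "i < n" "l < n"
        by auto
      have "(Y \<otimes>\<^bsub>full_matrix_algebra n D\<^esub> \<one>\<^bsub>full_matrix_algebra n D\<^esub>) p =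
          finsum D (\<lambda>j. Y (i, j) \<otimes>\<^bsub>D\<^esub> \<one>\<^bsub>full_matrix_algebra n D\<^esub> (j, l)) {..<n}"
        using p by (simp add: full_matrix_algebra_def)
      also have "\<dots> = finsum D (\<lambda>j. if l = j then Y (i, j) else \<zero>\<^bsub>D\<^esub>) {..<n}"
        using Ymem p by (intro finsum_cong') (auto simp: full_matrix_algebra_def)
      also have "\<dots> = Y p"
        using Ymem p by (subst finsum_singleton) auto
      finally show ?thesis .
    next
      case False
      then show ?thesis
        using Y by (cases p) (auto simp: full_matrix_algebra_def PiE_def extensional_def)
    qed
  qed
qed

context terwilliger_algebra
begin

section \<open>The primary ideal as a matrix algebra\<close>

lemma mult_B_nth:
  assumes "Y \<in> B" "Z \<in> B"
  shows "(Y ** Z) $ y $ z = (\<Sum>j\<le>d. of_nat (k j) * Y $ y $ rep j * Z $ rep j $ z)"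
proof -
  have "(\<chi> u. Y $ y $ u) \<in> W"
    using column_B[OF transpose_B[OF assms(1)], of y] by (simp add: transpose_def)
  from dot_W[OF this column_B[OF assms(2), of z]] show ?thesis
    by (simp add: matrix_matrix_mult_def dot_def)
qed

lemma nondegenerate_imp_matrix_algebra:
  assumes H: "nondegenerate" and h: "inj (h :: 'f \<Rightarrow> 'u)"
  shows "algebras_isomorphic (mat_algebra B) (full_matrix_algebra (Suc d) (field_copy h))"
proof -
  let ?D = "field_copy h" and ?I = "{..<Suc d} \<times> {..<Suc d}"
  note [simp] = field_copy_simps[OF h] inj_eq[OF h]
  \<comment> \<open>The product of \<open>outer (w i) (w j)\<close> and \<open>outer (w j) (w l)\<close> is \<open>k j\<close> times \<open>outer (w i) (w l)\<close>,
      so the matrix unit at \<open>(i, j)\<close> corresponds to \<open>outer (w i) (w j) / k j\<close>.\<close>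
  define f where "f = (\<lambda>Z :: 'f^'x^'x. \<lambda>(i, j)\<in>?I. h (Z $ rep i $ rep j * of_nat (k j)))"
  have "bij_betw f B (?I \<rightarrow>\<^sub>E range h)"
  proof (rule bij_betw_imageI)
    show "inj_on f B"
    proof (rule inj_onI)
      fix Y Z assume YZ: "Y \<in> B" "Z \<in> B" "f Y = f Z"
      have eq: "Y $ rep i $ rep j = Z $ rep i $ rep j" if "i \<le> d" "j \<le> d" for i j
        using fun_cong[OF YZ(3), of "(i, j)"] that nondegenerateD[OF H that(2)]
        by (simp add: f_def)
      have B_nth: "Z $ y $ z = Z $ rep (shell y) $ rep (shell z)" if "Z \<in> B" for Z y z
        using that[unfolded mem_B_iff, rule_format, of y "rep (shell y)" z "rep (shell z)"] by simp
      have "Y $ y $ z = Z $ y $ z" for y z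
        using B_nth[OF YZ(1), of y z] B_nth[OF YZ(2), of y z] eq[of "shell y" "shell z"] by simp
      then show "Y = Z"
        by (simp add: vec_eq_iff)
    qed
    show "f ` B = ?I \<rightarrow>\<^sub>E range h"
    proof (intro equalityI subsetI)
      fix m assume m: "m \<in> ?I \<rightarrow>\<^sub>E range h"
      define Z where "Z = (\<chi> y z. inv_into UNIV h (m (shell y, shell z)) / of_nat (k (shell z)))"
      have "Z \<in> B"
        by (simp add: mem_B_iff Z_def)
      moreover have "m = f Z"
      proof
        fix p show "m p = f Z p"
        proof (cases "p \<in> ?I")
          case True
          then obtain i j where p: "p = (i, j)" "i \<le> d" "j \<le> d"
            by auto
          have "m p \<in> range h"
            using m True by (rule PiE_mem)
          then show ?thesis
            using p nondegenerateD[OF H p(3)] by (simp add: f_def Z_def f_inv_into_f)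
        next
          case False
          then show ?thesis
            using PiE_arb[OF m False] by (simp add: f_def del: lessThan_Suc)
        qed
      qed
      ultimately show "m \<in> f ` B"
        by blast
    next
      fix m assume "m \<in> f ` B"
      then obtain Z where m: "m = f Z"
        by blast
      show "m \<in> ?I \<rightarrow>\<^sub>E range h"
        unfolding m f_def by (rule restrict_PiE_iff[THEN iffD2]) (simp add: split_beta)
    qed
  qed
  moreover have "f (Y + Z) = f Y \<oplus>\<^bsub>full_matrix_algebra (Suc d) ?D\<^esub> f Z" for Y Z
  proof (rule ext)
    fix p show "f (Y + Z) p = (f Y \<oplus>\<^bsub>full_matrix_algebra (Suc d) ?D\<^esub> f Z) p"
      by (cases p) (simp add: f_def full_matrix_algebra_def restrict_def distrib_right)
  qed
  moreover have "f (mat_scale c Z) = c \<odot>\<^bsub>full_matrix_algebra (Suc d) ?D\<^esub> f Z" for c Z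
  proof (rule ext)
    fix p show "f (mat_scale c Z) p = (c \<odot>\<^bsub>full_matrix_algebra (Suc d) ?D\<^esub> f Z) p"
      by (cases p) (simp add: f_def full_matrix_algebra_def restrict_def mat_scale_nth mult.assoc)
  qed
  moreover have "f (Y ** Z) = f Y \<otimes>\<^bsub>full_matrix_algebra (Suc d) ?D\<^esub> f Z" if "Y \<in> B" "Z \<in> B" for Y Z
  proof (rule ext)
    fix p
    have entry: "finsum ?D (\<lambda>j. h (Y $ rep i $ rep j * of_nat (k j)) \<otimes>\<^bsub>?D\<^esub>
          h (Z $ rep j $ rep l * of_nat (k l))) {..<Suc d} =
        h ((Y ** Z) $ rep i $ rep l * of_nat (k l))" for i l
      using finsum_field_copy[OF h, of "{..<Suc d}"
          "\<lambda>j. Y $ rep i $ rep j * of_nat (k j) * (Z $ rep j $ rep l * of_nat (k l))"]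
      by (simp add: mult_B_nth[OF that] sum_distrib_left lessThan_Suc_atMost mult_ac)
    interpret ring ?D
      by (rule ring_field_copy[OF h])
    show "f (Y ** Z) p = (f Y \<otimes>\<^bsub>full_matrix_algebra (Suc d) ?D\<^esub> f Z) p"
    proof (cases "p \<in> ?I")
      case True
      then obtain i l where p: "p = (i, l)" "i < Suc d" "l < Suc d"
        by auto
      have "(f Y \<otimes>\<^bsub>full_matrix_algebra (Suc d) ?D\<^esub> f Z) p =
          finsum ?D (\<lambda>j. f Y (i, j) \<otimes>\<^bsub>?D\<^esub> f Z (j, l)) {..<Suc d}"
        using p by (simp add: full_matrix_algebra_def)
      also have "\<dots> = finsum ?D (\<lambda>j. h (Y $ rep i $ rep j * of_nat (k j)) \<otimes>\<^bsub>?D\<^esub>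
          h (Z $ rep j $ rep l * of_nat (k l))) {..<Suc d}"
        by (rule finsum_cong') (use p in \<open>auto simp: f_def\<close>)
      also have "\<dots> = f (Y ** Z) p"
        unfolding entry using p by (simp add: f_def)
      finally show ?thesis ..
    next
      case False
      then show ?thesis
        by (simp only: f_def full_matrix_algebra_def monoid.simps restrict_apply if_False)
    qed
  qed
  moreover have "carrier (full_matrix_algebra (Suc d) ?D) = ?I \<rightarrow>\<^sub>E range h"
    by (simp add: full_matrix_algebra_def)
  ultimately show ?thesis
    unfolding algebras_isomorphic_def by (intro exI[of _ f]) simp
qed

text \<open>Full matrix algebras have an identity, which an isomorphism carries back to \<open>B\<close>.\<close>

lemma matrix_algebra_imp_nondegenerate:
  fixes D :: "('f, 'u) module"
  assumes "division_algebra D" "algebras_isomorphic (mat_algebra B) (full_matrix_algebra n D)"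
  shows "nondegenerate"
proof -
  let ?M = "full_matrix_algebra n D"
  obtain f where f: "bij_betw f B (carrier ?M)"
    and mult: "\<And>a b. a \<in> B \<Longrightarrow> b \<in> B \<Longrightarrow> f (a ** b) = f a \<otimes>\<^bsub>?M\<^esub> f b"
    using assms(2) unfolding algebras_isomorphic_def by auto
  interpret D: ring D
    using assms(1) by (simp add: division_algebra_def)
  have "\<one>\<^bsub>?M\<^esub> \<in> carrier ?M"
    by (auto simp: full_matrix_algebra_def)
  then obtain e where e: "e \<in> B" "f e = \<one>\<^bsub>?M\<^esub>"
    using f by (metis bij_betw_imp_surj_on imageE)
  show ?thesis
  proof (rule nondegenerate_if_right_unit[OF e(1)])
    fix b assume b: "b \<in> B"
    then have "f b \<in> carrier ?M"
      using f by (auto simp: bij_betw_def)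
    then have "f (b ** e) = f b"
      using full_matrix_algebra_right_unit[OF D.ring_axioms] by (simp add: mult b e)
    moreover have "b ** e \<in> B"
      using B_ideal(2)[OF _ b] e(1) B_subset_T by blast
    ultimately show "b ** e = b"
      using f b by (auto simp: bij_betw_def dest: inj_onD)
  qed
qed

lemma nondegenerate_iff_matrix_algebra:
  assumes "inj (h :: 'f \<Rightarrow> 'u)"
  shows "nondegenerate \<longleftrightarrow> (\<exists>n (D :: ('f, 'u) module). n \<ge> 1 \<and> division_algebra D \<and>
    algebras_isomorphic (mat_algebra B) (full_matrix_algebra n D))"
proof
  assume nondegenerate
  then show "\<exists>n (D :: ('f, 'u) module). n \<ge> 1 \<and> division_algebra D \<and>
    algebras_isomorphic (mat_algebra B) (full_matrix_algebra n D)"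
    using nondegenerate_imp_matrix_algebra[OF _ assms] division_algebra_field_copy[OF assms]
    by (intro exI[of _ "Suc d"] exI[of _ "field_copy h"]) simp
qed (use matrix_algebra_imp_nondegenerate in blast)

section \<open>The contragredient of the primary module\<close>

abbreviation W0' :: "('f^'x^'x, 'f^'x \<Rightarrow> 'f) module" where "W0' \<equiv> contragredient W0"

lemma contragredient_simps [simp]:
  "carrier W0' = linear_functionals W0" "\<zero>\<^bsub>W0'\<^esub> = (\<lambda>u\<in>W. 0)"
  "\<phi> \<oplus>\<^bsub>W0'\<^esub> \<psi> = (\<lambda>u\<in>W. \<phi> u + \<psi> u)"
  "Z \<odot>\<^bsub>W0'\<^esub> \<psi> = (\<lambda>u\<in>W. \<psi> (transpose Z *v u))"
  by (simp_all add: contragredient_def)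

lemma mem_linear_functionals_iff:
  "\<psi> \<in> linear_functionals W0 \<longleftrightarrow> \<psi> \<in> extensional W \<and>
     (\<forall>u\<in>W. \<forall>v\<in>W. \<psi> (u + v) = \<psi> u + \<psi> v) \<and> (\<forall>c. \<forall>u\<in>W. \<psi> (c *s u) = c * \<psi> u)"
  by (auto simp: linear_functionals_def PiE_def scalar_mat_mult_vec)

lemma left_module_contragredient: "left_module TA W0'"
proof -
  have "abelian_group W0'"
  proof (rule abelian_groupI)
    fix \<psi> assume \<psi>: "\<psi> \<in> carrier W0'"
    show "\<exists>\<phi>\<in>carrier W0'. \<phi> \<oplus>\<^bsub>W0'\<^esub> \<psi> = \<zero>\<^bsub>W0'\<^esub>"
    proof
      show "(\<lambda>u\<in>W. - \<psi> u) \<in> carrier W0'"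
        using \<psi> by (simp add: mem_linear_functionals_iff W_closed)
      show "(\<lambda>u\<in>W. - \<psi> u) \<oplus>\<^bsub>W0'\<^esub> \<psi> = \<zero>\<^bsub>W0'\<^esub>"
        by (simp add: fun_eq_iff restrict_def)
    qed
  next
    fix \<psi> assume "\<psi> \<in> carrier W0'"
    then show "\<zero>\<^bsub>W0'\<^esub> \<oplus>\<^bsub>W0'\<^esub> \<psi> = \<psi>"
      by (auto simp: mem_linear_functionals_iff extensional_def fun_eq_iff)
  qed (auto simp: mem_linear_functionals_iff W_closed fun_eq_iff algebra_simps)
  moreover have "left_module_axioms TA W0'"
  proof (rule left_module_axioms.intro)
    fix Z \<psi> assume "Z \<in> carrier TA" "\<psi> \<in> carrier W0'"
    then show "Z \<odot>\<^bsub>W0'\<^esub> \<psi> \<in> carrier W0'"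
      using transpose_T_mult_W[of Z]
      by (simp add: mem_linear_functionals_iff W_closed matrix_vector_right_distrib
          vector_scalar_commute del: transpose_matrix_vector)
  next
    fix Y Z \<psi> assume *: "Y \<in> carrier TA" "Z \<in> carrier TA" "\<psi> \<in> carrier W0'"
    show "(Y \<oplus>\<^bsub>TA\<^esub> Z) \<odot>\<^bsub>W0'\<^esub> \<psi> = Y \<odot>\<^bsub>W0'\<^esub> \<psi> \<oplus>\<^bsub>W0'\<^esub> Z \<odot>\<^bsub>W0'\<^esub> \<psi>"
      using * transpose_T_mult_W
      by (simp add: mem_linear_functionals_iff fun_eq_iff transpose_add matrix_vector_mult_add_rdistrib
          del: transpose_matrix_vector)
    show "(Y \<otimes>\<^bsub>TA\<^esub> Z) \<odot>\<^bsub>W0'\<^esub> \<psi> = Y \<odot>\<^bsub>W0'\<^esub> (Z \<odot>\<^bsub>W0'\<^esub> \<psi>)"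
      using * transpose_T_mult_W
      by (simp add: fun_eq_iff transpose_matrix_mult matrix_vector_mul_assoc[symmetric]
          del: transpose_matrix_vector)
  next
    fix Z \<phi> \<psi> assume *: "Z \<in> carrier TA" "\<phi> \<in> carrier W0'" "\<psi> \<in> carrier W0'"
    show "Z \<odot>\<^bsub>W0'\<^esub> (\<phi> \<oplus>\<^bsub>W0'\<^esub> \<psi>) = Z \<odot>\<^bsub>W0'\<^esub> \<phi> \<oplus>\<^bsub>W0'\<^esub> Z \<odot>\<^bsub>W0'\<^esub> \<psi>"
      using * transpose_T_mult_W by (simp add: fun_eq_iff del: transpose_matrix_vector)
  next
    fix \<psi> assume "\<psi> \<in> carrier W0'"
    then show "\<one>\<^bsub>TA\<^esub> \<odot>\<^bsub>W0'\<^esub> \<psi> = \<psi>"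
      by (auto simp: mem_linear_functionals_iff extensional_def fun_eq_iff)
  qed
  ultimately show ?thesis
    using ring_TA by (simp add: left_module_def)
qed

lemma linear_functional_zero: "\<psi> \<in> linear_functionals W0 \<Longrightarrow> \<psi> 0 = 0"
  unfolding mem_linear_functionals_iff using W_closed(1) by (metis mult_zero_left vec.scale_zero_left)

lemma linear_functional_expand:
  assumes \<psi>: "\<psi> \<in> linear_functionals W0" and u: "u \<in> W"
  shows "\<psi> u = (\<Sum>i\<le>d. u $ rep i * \<psi> (w i))"
proof -
  have add: "\<psi> (u + v) = \<psi> u + \<psi> v" if "u \<in> W" "v \<in> W" for u v
    using \<psi> that by (simp add: mem_linear_functionals_iff)
  have smult: "\<psi> (c *s u) = c * \<psi> u" if "u \<in> W" for u c
    using \<psi> that by (simp add: mem_linear_functionals_iff)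
  have "(\<Sum>i\<in>I. u $ rep i *s w i) \<in> W \<and> \<psi> (\<Sum>i\<in>I. u $ rep i *s w i) = (\<Sum>i\<in>I. u $ rep i * \<psi> (w i))" for I
    by (induction I rule: infinite_finite_induct)
       (simp_all add: linear_functional_zero[OF \<psi>] W_closed add smult)
  from conjunct2[OF this[of "{..d}"]] show ?thesis
    unfolding W_expand[OF u, symmetric] .
qed

lemma linear_functional_eqI:
  assumes "\<phi> \<in> linear_functionals W0" "\<psi> \<in> linear_functionals W0" "\<And>i. i \<le> d \<Longrightarrow> \<phi> (w i) = \<psi> (w i)"
  shows "\<phi> = \<psi>"
proof (rule extensionalityI)
  show "\<phi> \<in> extensional W" "\<psi> \<in> extensional W"
    using assms by (simp_all add: mem_linear_functionals_iff)
  show "\<phi> u = \<psi> u" if "u \<in> W" for u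
    by (simp add: linear_functional_expand[OF assms(1) that] linear_functional_expand[OF assms(2) that] assms(3))
qed

definition coord :: "nat \<Rightarrow> 'f^'x \<Rightarrow> 'f" where
  "coord i = (\<lambda>u\<in>W. u $ rep i)"

lemma coord_mem: "coord i \<in> linear_functionals W0"
  by (simp add: mem_linear_functionals_iff coord_def W_closed)

lemma coord_w: "i \<le> d \<Longrightarrow> coord i (w j) = (if i = j then 1 else 0)"
  by (simp add: coord_def)

text \<open>The isomorphism sends \<open>u\<close> to the functional \<open>dot u\<close>; it is a homomorphism because transposes are
  adjoints.\<close>

lemma nondegenerate_imp_self_contragredient:
  assumes H: "nondegenerate"
  shows "modules_isomorphic TA W0 W0'"
proof -
  let ?f = "\<lambda>u. \<lambda>v\<in>W. dot u v"
  have mem: "?f u \<in> linear_functionals W0" for u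
    by (simp add: mem_linear_functionals_iff W_closed dot_add_right dot_scale_right)
  have "?f \<in> module_hom TA W0 W0'"
    using mem T_mult_W transpose_T_mult_W
    by (auto simp: module_hom_def fun_eq_iff dot_add_left dot_adjoint simp del: transpose_matrix_vector)
  moreover have "bij_betw ?f W (linear_functionals W0)"
  proof (rule bij_betw_imageI)
    show "inj_on ?f W"
    proof (rule inj_onI)
      fix u v assume uv: "u \<in> W" "v \<in> W" "?f u = ?f v"
      have "u - v = 0"
      proof (rule nondegenerate_dot[OF H])
        show "u - v \<in> W"
          using uv W_closed by blast
        fix i
        have "dot u (w i) = dot v (w i)"
          using fun_cong[OF uv(3), of "w i"] by simp
        then show "dot (w i) (u - v) = 0"
          using dot_add_right[of "w i" "u - v" v] by (simp add: dot_commute)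
      qed
      then show "u = v" by simp
    qed
    have "\<psi> \<in> ?f ` W" if \<psi>: "\<psi> \<in> linear_functionals W0" for \<psi>
    proof
      define u where "u = (\<chi> y. \<psi> (w (shell y)) / of_nat (k (shell y)))"
      show u: "u \<in> W"
        by (simp add: mem_W_iff u_def)
      show "\<psi> = ?f u"
      proof (rule linear_functional_eqI[OF \<psi> mem])
        fix i assume "i \<le> d"
        then show "\<psi> (w i) = ?f u (w i)"
          using nondegenerateD[OF H, of i] by (simp add: dot_commute[of u] dot_w[OF u]) (simp add: u_def)
      qed
    qed
    then show "?f ` W = linear_functionals W0"
      using mem by auto
  qed
  ultimately show ?thesis
    unfolding modules_isomorphic_def by auto
qed

text \<open>A homomorphism to the contragredient is determined by the image \<open>\<psi>\<close> of \<open>w 0\<close>, and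
  \<open>w i = outer (w i) (w 0) *v w 0\<close> goes to the functional \<open>u \<mapsto> \<psi> (outer (w 0) (w i) *v u)\<close>. If \<open>k i = 0\<close>,
  this is zero, so the homomorphism is not injective.\<close>

lemma self_contragredient_imp_nondegenerate:
  assumes "modules_isomorphic TA W0 W0'"
  shows "nondegenerate"
proof (rule ccontr)
  assume "\<not> nondegenerate"
  then obtain i where i: "i \<le> d" "(of_nat (k i) :: 'f) = 0"
    by (rule not_nondegenerateE)
  obtain f where f: "f \<in> module_hom TA W0 W0'" "bij_betw f W (linear_functionals W0)"
    using assms by (auto simp: modules_isomorphic_def)
  have "f (w i) = f (outer (w i) (w 0) *v w 0)"
    by (simp add: outer_mult_vec dot_w_w k_0)
  also have "\<dots> = outer (w i) (w 0) \<odot>\<^bsub>W0'\<^esub> f (w 0)"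
    using module_hom_smult[OF f(1), of "outer (w i) (w 0)" "w 0"]
    by (simp add: outer_in_T del: contragredient_simps)
  also have "\<dots> = (\<lambda>u\<in>W. 0)"
  proof -
    have "f (w 0) \<in> linear_functionals W0"
      using f(2) by (auto simp: bij_betw_def)
    then show ?thesis
      by (simp add: fun_eq_iff transpose_outer outer_mult_vec degenerate_dot[OF i(2)]
          linear_functional_zero del: transpose_matrix_vector)
  qed
  also have "\<dots> = f 0"
    using module_hom_zero[OF left_module_W0 left_module_contragredient f(1)] by simp
  finally have "w i = 0"
    using f(2) W_closed(1) by (auto simp: bij_betw_def dest: inj_onD)
  then show False
    using w_ne_0[OF i(1)] by simp
qed

lemma nondegenerate_iff_self_contragredient: "nondegenerate \<longleftrightarrow> modules_isomorphic TA W0 W0'"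
  using nondegenerate_imp_self_contragredient self_contragredient_imp_nondegenerate by blast

end

context terwilliger_algebra
begin

section \<open>Modules detected by a thin relation\<close>

text \<open>A vector fixed by \<open>E j = outer (w j) (w j)\<close> is the image of \<open>w j\<close> under a homomorphism from the
  primary module, since \<open>v \<mapsto> outer v (w j)\<close> identifies \<open>W\<close> with the left ideal of all \<open>Z ** E j\<close>.
  The coefficients \<open>dot (w i) v\<close> can be recovered from the image of \<open>v\<close> by acting with
  \<open>outer (w j) (w i)\<close>, which gives injectivity for a nondegenerate form.\<close>

lemma hom_from_primary_module:
  assumes U: "left_module TA U" and j: "j \<le> d" "k j = 1" and u: "u \<in> carrier U" "E j \<odot>\<^bsub>U\<^esub> u = u"
  defines "\<phi> \<equiv> \<lambda>v. outer v (w j) \<odot>\<^bsub>U\<^esub> u"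
  shows "\<phi> \<in> module_hom TA W0 U" "\<phi> (w j) = u"
    and "nondegenerate \<Longrightarrow> u \<noteq> \<zero>\<^bsub>U\<^esub> \<Longrightarrow> inj_on \<phi> W"
proof -
  interpret U: left_module TA U by fact
  have mem: "outer v a \<in> carrier TA" if "v \<in> W" "a \<in> W" for v a
    using outer_in_T that by simp
  have closed: "\<phi> v \<in> carrier U" if "v \<in> W" for v
    unfolding \<phi>_def using that by (intro U.smult_closed mem u) simp_all
  have add: "\<phi> (v + v') = \<phi> v \<oplus>\<^bsub>U\<^esub> \<phi> v'" if "v \<in> W" "v' \<in> W" for v v'
    unfolding \<phi>_def outer_add_left
    using U.smult_l_distr[OF mem[OF that(1) w_in_W] mem[OF that(2) w_in_W] u(1)] by simp
  have smult: "\<phi> (Z *v v) = Z \<odot>\<^bsub>U\<^esub> \<phi> v" if "Z \<in> T" "v \<in> W" for Z v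
    unfolding \<phi>_def mult_outer[symmetric]
    using U.smult_assoc[OF _ mem[OF that(2) w_in_W] u(1), of Z j] that(1) by simp
  show hom: "\<phi> \<in> module_hom TA W0 U"
    using closed add smult by (simp add: module_hom_def)
  show "\<phi> (w j) = u"
    using u(2) by (simp add: \<phi>_def E_thin j)
  assume H: "nondegenerate" and u0: "u \<noteq> \<zero>\<^bsub>U\<^esub>"
  have kernel: "v = 0" if v: "v \<in> W" "\<phi> v = \<zero>\<^bsub>U\<^esub>" for v
  proof (rule nondegenerate_dot[OF H v(1)])
    fix i assume "i \<le> d"
    define c where "c = dot (w i) v"
    have "mat c \<odot>\<^bsub>U\<^esub> u = mat c \<odot>\<^bsub>U\<^esub> (E j \<odot>\<^bsub>U\<^esub> u)"
      by (simp add: u(2))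
    also have "\<dots> = (mat c ** E j) \<odot>\<^bsub>U\<^esub> u"
      using U.smult_assoc[of "mat c" "E j" u] T_closed(2) generators_in_T(2)[OF j(1)] u(1) by simp
    also have "mat c ** E j = outer (w j) (w i) ** outer v (w j)"
      by (simp add: outer_outer E_thin j scale_eq_mat_mult c_def)
    also have "\<dots> \<odot>\<^bsub>U\<^esub> u = outer (w j) (w i) \<odot>\<^bsub>U\<^esub> \<phi> v"
      unfolding \<phi>_def using U.smult_assoc[OF mem[OF w_in_W w_in_W] mem[OF v(1) w_in_W] u(1)] by simp
    also have "\<dots> = \<zero>\<^bsub>U\<^esub>"
      unfolding v(2) by (rule U.smult_zero_right[OF mem[OF w_in_W w_in_W]])
    finally have 0: "mat c \<odot>\<^bsub>U\<^esub> u = \<zero>\<^bsub>U\<^esub>" .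
    show "dot (w i) v = 0"
    proof (rule ccontr)
      assume c: "dot (w i) v \<noteq> 0"
      have "mat (inverse c) \<odot>\<^bsub>U\<^esub> (mat c \<odot>\<^bsub>U\<^esub> u) = (mat (inverse c) ** mat c) \<odot>\<^bsub>U\<^esub> u"
        using U.smult_assoc[of "mat (inverse c)" "mat c" u] T_closed(2) u(1) by simp
      also have "\<dots> = u"
        using U.smult_one[OF u(1)] c by (simp add: mat_mult_mat c_def)
      finally show False
        using u0 0 U.smult_zero_right[of "mat (inverse c)"] T_closed(2) by simp
    qed
  qed
  show "inj_on \<phi> W"
  proof (rule inj_onI)
    fix v v' assume v: "v \<in> W" "v' \<in> W" "\<phi> v = \<phi> v'"
    have "\<phi> (v - v') \<oplus>\<^bsub>U\<^esub> \<phi> v' = \<phi> v"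
      using add[of "v - v'" v'] v W_closed by simp
    then have "\<phi> (v - v') = \<zero>\<^bsub>U\<^esub>"
      using v closed[of "v - v'"] closed[of v'] W_closed(4) by (metis U.M.add.r_cancel_one')
    then show "v = v'"
      using kernel[of "v - v'"] v W_closed(4) by simp
  qed
qed

definition slice :: "('f^'x^'x, 'u) module \<Rightarrow> nat \<Rightarrow> 'u set" where
  "slice U j = (\<lambda>u. E j \<odot>\<^bsub>U\<^esub> u) ` carrier U"

lemma scalar_subspace_carrier:
  assumes "left_module TA U"
  shows "scalar_subspace U (carrier U)"
proof -
  interpret U: left_module TA U by fact
  show ?thesis
    using U.smult_closed T_closed(2) by (simp add: scalar_subspace_def)
qed

lemma scalar_subspace_slice:
  assumes U: "left_module TA U" and j: "j \<le> d"
  shows "scalar_subspace U (slice U j)"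
proof -
  interpret U: left_module TA U by fact
  have Ej: "E j \<in> carrier TA" and c: "mat c \<in> carrier TA" for c
    using generators_in_T(2)[OF j] T_closed(2) by simp_all
  have comm: "mat c ** E j = E j ** mat c" for c
    by (metis mat_eq_scale matrix_mul_rid mat_scale_mult_right scale_eq_mat_mult)
  have "mat c \<odot>\<^bsub>U\<^esub> (E j \<odot>\<^bsub>U\<^esub> u) = E j \<odot>\<^bsub>U\<^esub> (mat c \<odot>\<^bsub>U\<^esub> u)" if "u \<in> carrier U" for c u
    using U.smult_assoc[OF c Ej that] U.smult_assoc[OF Ej c that] comm by simp
  then have "mat c \<odot>\<^bsub>U\<^esub> v \<in> slice U j" if "v \<in> slice U j" for c v
    using that U.smult_closed[OF c] by (auto simp: slice_def)
  moreover have "\<zero>\<^bsub>U\<^esub> \<in> slice U j"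
    unfolding slice_def using U.smult_zero_right[OF Ej] by (intro image_eqI[of _ _ "\<zero>\<^bsub>U\<^esub>"]) simp_all
  moreover have "u \<oplus>\<^bsub>U\<^esub> v \<in> slice U j" if "u \<in> slice U j" "v \<in> slice U j" for u v
    using that U.smult_r_distr[OF Ej, symmetric] by (auto simp: slice_def)
  ultimately show ?thesis
    using U.smult_closed[OF Ej] by (auto simp: scalar_subspace_def slice_def)
qed

lemma slice_nonzero:
  assumes U: "left_module TA U" and j: "j \<le> d" "k j = 1" and dim: "scalar_dim U (slice U j) > 0"
  obtains u where "u \<in> carrier U" "E j \<odot>\<^bsub>U\<^esub> u = u" "u \<noteq> \<zero>\<^bsub>U\<^esub>"
proof -
  interpret U: left_module TA U by fact
  have Ej: "E j \<in> carrier TA"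
    using generators_in_T(2)[OF j(1)] by simp
  have "slice U j \<noteq> {\<zero>\<^bsub>U\<^esub>}"
    using dim scalar_dim_zero[OF unital_T U] by auto
  moreover have "\<zero>\<^bsub>U\<^esub> \<in> slice U j"
    using scalar_subspace_slice[OF U j(1)] by (simp add: scalar_subspace_def)
  ultimately obtain v where v: "v \<in> carrier U" "E j \<odot>\<^bsub>U\<^esub> v \<noteq> \<zero>\<^bsub>U\<^esub>"
    unfolding slice_def by blast
  have "E j ** E j = E j"
    by (simp add: E_thin j outer_outer dot_w_w)
  then have "E j \<odot>\<^bsub>U\<^esub> (E j \<odot>\<^bsub>U\<^esub> v) = E j \<odot>\<^bsub>U\<^esub> v"
    using U.smult_assoc[OF Ej Ej v(1)] by simp
  with v show ?thesis
    using that U.smult_closed[OF Ej v(1)] by blast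
qed

lemma dim_isomorphic:
  assumes M: "left_module TA M" and U: "left_module TA U" and iso: "modules_isomorphic TA U M"
    and dim: "vectorspace.fin_dim scalar_field (scalar_space M (carrier M))"
      "scalar_dim M (carrier M) = Suc d"
      "vectorspace.fin_dim scalar_field (scalar_space M (slice M 0))"
      "scalar_dim M (slice M 0) = 1"
  shows "scalar_dim U (carrier U) = Suc d" "scalar_dim U (slice U 0) = 1"
proof -
  interpret M: left_module TA M by fact
  obtain f where f: "f \<in> module_hom TA M U" "bij_betw f (carrier M) (carrier U)"
    using modules_isomorphic_sym[OF U iso] by (auto simp: modules_isomorphic_def)
  have inj: "inj_on f (carrier M)" and im: "carrier U = f ` carrier M"
    using f(2) by (auto simp: bij_betw_def)
  show "scalar_dim U (carrier U) = Suc d"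
    unfolding im using scalar_dim_image[OF unital_T M U f(1) scalar_subspace_carrier[OF M] inj dim(1)]
    by (simp add: dim)
  have sub: "slice M 0 \<subseteq> carrier M"
    using scalar_subspace_slice[OF M, of 0] by (simp add: scalar_subspace_def)
  have "slice U 0 = f ` slice M 0"
    using module_hom_smult[OF f(1), of "E 0"] generators_in_T(2)[of 0]
    by (simp add: slice_def im image_image)
  then show "scalar_dim U (slice U 0) = 1"
    using scalar_dim_image[OF unital_T M U f(1) scalar_subspace_slice[OF M, of 0] inj_on_subset[OF inj sub] dim(3)]
    by (simp add: dim)
qed

lemma E_0_mult_vec: "E 0 *v v = v $ x *s w 0"
  by (simp add: E_0 outer_mult_vec dot_w_0)

lemma dim_W0:
  "vectorspace.fin_dim scalar_field (scalar_space W0 W)" "scalar_dim W0 W = Suc d"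
  "vectorspace.fin_dim scalar_field (scalar_space W0 (slice W0 0))" "scalar_dim W0 (slice W0 0) = 1"
proof -
  let ?C = "scalar_space W0 W" and ?S = "scalar_space W0 (slice W0 0)"
  have V: "vectorspace scalar_field ?C"
    using vectorspace_scalar_space[OF unital_T left_module_W0 scalar_subspace_carrier[OF left_module_W0]]
    by simp
  have sep: "v = 0" if "v \<in> W" "\<And>i. i < Suc d \<Longrightarrow> v $ rep i = 0" for v
    using that W_closed(1) by (intro W_eqI) simp_all
  note coords = dim_eq_card_coordinates[OF V, of "Suc d" w "\<lambda>i v. v $ rep i"]
  show "vectorspace.fin_dim scalar_field ?C"
    by (rule coords) (simp_all add: scalar_mat_mult_vec sep)
  show "scalar_dim W0 W = Suc d"
    unfolding scalar_dim_def by (rule coords) (simp_all add: scalar_mat_mult_vec sep)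
  have V0: "vectorspace scalar_field ?S"
    using vectorspace_scalar_space[OF unital_T left_module_W0 scalar_subspace_slice[OF left_module_W0]]
    by simp
  have w0: "w 0 \<in> slice W0 0"
    by (auto simp: slice_def E_0_mult_vec shell_eq_0_iff intro!: image_eqI[of _ _ "w 0"])
  have sep0: "v = 0" if "v \<in> slice W0 0" "v $ x = 0" for v
    using that by (auto simp: slice_def E_0_mult_vec shell_eq_0_iff)
  note coords0 = dim_eq_card_coordinates[OF V0, of 1 "\<lambda>_. w 0" "\<lambda>_ v. v $ x"]
  show "vectorspace.fin_dim scalar_field ?S"
    by (rule coords0) (simp_all add: scalar_mat_mult_vec sep0 w0 shell_eq_0_iff)
  show "scalar_dim W0 (slice W0 0) = 1"
    unfolding scalar_dim_def by (rule coords0) (simp_all add: scalar_mat_mult_vec sep0 w0 shell_eq_0_iff)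
qed

lemma dim_contragredient:
  "vectorspace.fin_dim scalar_field (scalar_space W0' (carrier W0'))" "scalar_dim W0' (carrier W0') = Suc d"
  "vectorspace.fin_dim scalar_field (scalar_space W0' (slice W0' 0))" "scalar_dim W0' (slice W0' 0) = 1"
proof -
  let ?C = "scalar_space W0' (carrier W0')" and ?S = "scalar_space W0' (slice W0' 0)"
  have V: "vectorspace scalar_field ?C"
    by (rule vectorspace_scalar_space[OF unital_T left_module_contragredient
          scalar_subspace_carrier[OF left_module_contragredient]])
  have smult: "(mat c \<odot>\<^bsub>W0'\<^esub> \<psi>) (w i) = c * \<psi> (w i)" if "\<psi> \<in> linear_functionals W0" for c \<psi> i
    using that by (simp add: scalar_mat_mult_vec mem_linear_functionals_iff del: transpose_matrix_vector)
  have zero: "\<zero>\<^bsub>W0'\<^esub> \<in> linear_functionals W0"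
    by (simp add: mem_linear_functionals_iff W_closed)
  have sep: "\<psi> = \<zero>\<^bsub>W0'\<^esub>" if "\<psi> \<in> linear_functionals W0" "\<And>i. i < Suc d \<Longrightarrow> \<psi> (w i) = 0" for \<psi>
    using that by (intro linear_functional_eqI[OF _ zero]) simp_all
  note coords = dim_eq_card_coordinates[OF V, of "Suc d" coord "\<lambda>i \<psi>. \<psi> (w i)"]
  have *: "coord j (w i) = (if i = j then 1 else 0)" if "i < Suc d" "j < Suc d" for i j
    using that by (simp add: coord_w)
  show "vectorspace.fin_dim scalar_field ?C"
  proof (rule coords)
    show "\<psi> = \<zero>\<^bsub>?C\<^esub>"
      if "\<psi> \<in> carrier ?C" "\<And>i. i < Suc d \<Longrightarrow> \<psi> (w i) = 0" for \<psi>
      using sep that by simp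
  qed (use coord_mem smult * in \<open>simp_all del: contragredient_simps(4)\<close>)
  show "scalar_dim W0' (carrier W0') = Suc d"
    unfolding scalar_dim_def
  proof (rule coords)
    show "\<psi> = \<zero>\<^bsub>?C\<^esub>"
      if "\<psi> \<in> carrier ?C" "\<And>i. i < Suc d \<Longrightarrow> \<psi> (w i) = 0" for \<psi>
      using sep that by simp
  qed (use coord_mem smult * in \<open>simp_all del: contragredient_simps(4)\<close>)
  have V0: "vectorspace scalar_field ?S"
    by (rule vectorspace_scalar_space[OF unital_T left_module_contragredient
          scalar_subspace_slice[OF left_module_contragredient]]) simp
  have sub: "slice W0' 0 \<subseteq> linear_functionals W0"
    using scalar_subspace_slice[OF left_module_contragredient, of 0] by (simp add: scalar_subspace_def)
  have E0: "E 0 \<odot>\<^bsub>W0'\<^esub> \<psi> = (\<lambda>u\<in>W. u $ x * \<psi> (w 0))" if "\<psi> \<in> linear_functionals W0" for \<psi>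
    using that
    by (simp add: transpose_E E_0_mult_vec mem_linear_functionals_iff fun_eq_iff del: transpose_matrix_vector)
  have coord0: "coord 0 \<in> slice W0' 0"
  proof -
    have "coord 0 = E 0 \<odot>\<^bsub>W0'\<^esub> coord 0"
      unfolding E0[OF coord_mem] by (simp add: coord_def rep_0 shell_eq_0_iff fun_eq_iff)
    then show ?thesis
      unfolding slice_def using coord_mem by (intro image_eqI) simp_all
  qed
  have sep0: "\<psi> = \<zero>\<^bsub>W0'\<^esub>" if \<psi>: "\<psi> \<in> slice W0' 0" "\<psi> (w 0) = 0" for \<psi>
  proof -
    obtain \<phi> where "\<phi> \<in> linear_functionals W0" "\<psi> = E 0 \<odot>\<^bsub>W0'\<^esub> \<phi>"
      using \<psi>(1) unfolding slice_def contragredient_simps(1) by blast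
    then show ?thesis
      using \<psi>(2) by (simp add: E0 shell_eq_0_iff fun_eq_iff del: contragredient_simps(4))
  qed
  note coords0 = dim_eq_card_coordinates[OF V0, of 1 "\<lambda>_. coord 0" "\<lambda>_ \<psi>. \<psi> (w 0)"]
  have one: "coord 0 (w 0) = 1"
    by (simp add: coord_w)
  have mem: "\<psi> \<in> linear_functionals W0" if "\<psi> \<in> slice W0' 0" for \<psi>
    using that sub by blast
  show "vectorspace.fin_dim scalar_field ?S"
  proof (rule coords0)
    show "\<psi> = \<zero>\<^bsub>?S\<^esub>"
      if "\<psi> \<in> carrier ?S" "\<And>i::nat. i < 1 \<Longrightarrow> \<psi> (w 0) = 0" for \<psi>
      using sep0 that by simp
  qed (use coord0 smult[OF mem] one in \<open>simp_all del: contragredient_simps(4)\<close>)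
  show "scalar_dim W0' (slice W0' 0) = 1"
    unfolding scalar_dim_def
  proof (rule coords0)
    show "\<psi> = \<zero>\<^bsub>?S\<^esub>"
      if "\<psi> \<in> carrier ?S" "\<And>i::nat. i < 1 \<Longrightarrow> \<psi> (w 0) = 0" for \<psi>
      using sep0 that by simp
  qed (use coord0 smult[OF mem] one in \<open>simp_all del: contragredient_simps(4)\<close>)
qed

lemma fg_W0: "fg_left_module TA W0"
  unfolding fg_left_module_def
proof (intro conjI exI[of _ "{w 0}"] allI impI)
  fix N assume N: "Module.submodule N TA W0 \<and> {w 0} \<subseteq> N"
  have "v \<in> N" if "v \<in> W" for v
  proof -
    have "outer v (w 0) *v w 0 \<in> N"
      using N outer_in_T[OF that w_in_W] unfolding submodule_W0_iff by blast
    then show ?thesis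
      by (simp add: outer_mult_vec dot_w_w k_0)
  qed
  then show "N = carrier W0"
    using N unfolding submodule_W0_iff by auto
qed (simp_all add: left_module_W0)

lemma fg_contragredient: "fg_left_module TA W0'"
  unfolding fg_left_module_def
proof (intro conjI exI[of _ "coord ` {..d}"] allI impI)
  fix N assume N: "Module.submodule N TA W0' \<and> coord ` {..d} \<subseteq> N"
  then have sub: "N \<subseteq> linear_functionals W0" "\<zero>\<^bsub>W0'\<^esub> \<in> N"
    and add: "\<And>\<phi> \<psi>. \<phi> \<in> N \<Longrightarrow> \<psi> \<in> N \<Longrightarrow> \<phi> \<oplus>\<^bsub>W0'\<^esub> \<psi> \<in> N"
    and smult: "\<And>Z \<psi>. Z \<in> T \<Longrightarrow> \<psi> \<in> N \<Longrightarrow> Z \<odot>\<^bsub>W0'\<^esub> \<psi> \<in> N"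
    unfolding left_module.submodule_iff[OF left_module_contragredient] mat_algebra_simps
      contragredient_simps(1) by blast+
  have "\<psi> \<in> N" if \<psi>: "\<psi> \<in> linear_functionals W0" for \<psi>
  proof -
    have partial: "(\<lambda>u\<in>W. \<Sum>i<m. u $ rep i * \<psi> (w i)) \<in> N" if "m \<le> Suc d" for m
      using that
    proof (induction m)
      case 0
      then show ?case
        using sub(2) by (simp only: contragredient_simps lessThan_0 sum.empty)
    next
      case (Suc m)
      have "(\<lambda>u\<in>W. \<Sum>i<Suc m. u $ rep i * \<psi> (w i)) =
          (\<lambda>u\<in>W. \<Sum>i<m. u $ rep i * \<psi> (w i)) \<oplus>\<^bsub>W0'\<^esub> (mat (\<psi> (w m)) \<odot>\<^bsub>W0'\<^esub> coord m)"
        by (simp add: coord_def fun_eq_iff scalar_mat_mult_vec W_closed mult.commute del: transpose_matrix_vector)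
      also have "\<dots> \<in> N"
      proof (rule add)
        show "(\<lambda>u\<in>W. \<Sum>i<m. u $ rep i * \<psi> (w i)) \<in> N"
          by (rule Suc.IH) (use Suc.prems in simp)
        have "coord m \<in> N"
          using N Suc.prems by auto
        then show "mat (\<psi> (w m)) \<odot>\<^bsub>W0'\<^esub> coord m \<in> N"
          by (rule smult[OF T_closed(2)])
      qed
      finally show ?case .
    qed
    have "\<psi> = (\<lambda>u\<in>W. \<Sum>i<Suc d. u $ rep i * \<psi> (w i))"
    proof (rule extensionalityI)
      show "\<psi> \<in> extensional W"
        using \<psi> by (simp add: mem_linear_functionals_iff)
      show "\<psi> u = (\<lambda>u\<in>W. \<Sum>i<Suc d. u $ rep i * \<psi> (w i)) u" if "u \<in> W" for u
        using linear_functional_expand[OF \<psi> that] that by (simp add: lessThan_Suc_atMost)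
    qed simp
    then show ?thesis
      using partial[OF le_refl] by (rule ssubst[where P = "\<lambda>\<phi>. \<phi> \<in> N"])
  qed
  then show "N = carrier W0'"
    using sub(1) by auto
qed (use coord_mem in \<open>simp_all add: left_module_contragredient image_subset_iff\<close>)

text \<open>The coordinates of an element form a list over the field, and the lists embed into the prescribed
  type.\<close>

lemma copy_of_W0:
  assumes "inj (emb :: 'f list \<Rightarrow> 'u)"
  obtains U :: "('f^'x^'x, 'u) module" where "fg_left_module TA U" "modules_isomorphic TA U W0"
proof -
  let ?h = "\<lambda>v. emb (map (\<lambda>i. v $ rep i) [0..<Suc d])"
  have inj: "inj_on ?h (carrier W0)"
    using W_eqI by (auto intro!: inj_onI dest!: injD[OF assms] simp del: upt_Suc)
  note transport = transport_module[OF left_module_W0 inj]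
  show ?thesis
    using that fg_left_module_isomorphic[OF fg_W0 transport] modules_isomorphic_sym[OF left_module_W0 transport(2)]
    by blast
qed

lemma copy_of_contragredient:
  assumes "inj (emb :: 'f list \<Rightarrow> 'u)"
  obtains U :: "('f^'x^'x, 'u) module" where "fg_left_module TA U" "modules_isomorphic TA U W0'"
proof -
  let ?h = "\<lambda>\<psi>. emb (map (\<lambda>i. \<psi> (w i)) [0..<Suc d])"
  have inj: "inj_on ?h (carrier W0')"
    using linear_functional_eqI by (auto intro!: inj_onI dest!: injD[OF assms] simp del: upt_Suc)
  note transport = transport_module[OF left_module_contragredient inj]
  show ?thesis
    using that fg_left_module_isomorphic[OF fg_contragredient transport]
      modules_isomorphic_sym[OF left_module_contragredient transport(2)]
    by blast
qed

text \<open>A copy of \<open>W\<close> itself shows that the condition forces \<open>W\<close> to be irreducible.\<close>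

lemma nondegenerate_iff_irreducible_thin:
  assumes "inj (emb :: 'f list \<Rightarrow> 'u)"
  shows "nondegenerate \<longleftrightarrow> (\<forall>U :: ('f^'x^'x, 'u) module. fg_left_module TA U \<longrightarrow>
    ((irreducible_module TA U \<and> (\<exists>j\<le>d. R j \<in> thin_radical d R \<and> scalar_dim U (slice U j) > 0))
     \<longleftrightarrow> modules_isomorphic TA U W0))"
proof (intro iffI allI impI)
  fix U :: "('f^'x^'x, 'u) module"
  assume H: "nondegenerate" and "fg_left_module TA U"
  then have U: "left_module TA U"
    by (simp add: fg_left_module_def)
  have irr: "irreducible_module TA W0"
    using H nondegenerate_iff_irreducible by simp
  {
    assume "irreducible_module TA U \<and> (\<exists>j\<le>d. R j \<in> thin_radical d R \<and> scalar_dim U (slice U j) > 0)"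
    then obtain j where irrU: "irreducible_module TA U" and j: "j \<le> d" "k j = 1" "scalar_dim U (slice U j) > 0"
      using thin_iff by blast
    obtain u where u: "u \<in> carrier U" "E j \<odot>\<^bsub>U\<^esub> u = u" "u \<noteq> \<zero>\<^bsub>U\<^esub>"
      by (rule slice_nonzero[OF U j])
    let ?f = "\<lambda>v. outer v (w j) \<odot>\<^bsub>U\<^esub> u"
    note f = hom_from_primary_module[OF U j(1,2) u(1,2)]
    have "?f ` W = {\<zero>\<^bsub>U\<^esub>} \<or> ?f ` W = carrier U"
      using irreducible_moduleD[OF irrU submodule_image[OF left_module_W0 U f(1)]] by simp
    moreover have "u \<in> ?f ` W"
      using f(2) by (intro image_eqI[of _ _ "w j"]) simp_all
    ultimately have "bij_betw ?f W (carrier U)"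
      using f(3)[OF H u(3)] u(3) by (auto simp: bij_betw_def)
    then have "modules_isomorphic TA W0 U"
      using f(1) by (auto simp: modules_isomorphic_def)
    then show "modules_isomorphic TA U W0"
      by (rule modules_isomorphic_sym[OF left_module_W0])
  }
  {
    assume iso: "modules_isomorphic TA U W0"
    have "irreducible_module TA U"
      by (rule irreducible_module_isomorphic[OF irr U modules_isomorphic_sym[OF U iso]])
    moreover have "scalar_dim U (slice U 0) = 1"
      using dim_isomorphic(2)[OF left_module_W0 U iso] dim_W0 by simp
    ultimately show "irreducible_module TA U \<and> (\<exists>j\<le>d. R j \<in> thin_radical d R \<and> scalar_dim U (slice U j) > 0)"
      using R_0_thin by (intro conjI exI[of _ 0]) simp_all
  }
next
  assume r: "\<forall>U :: ('f^'x^'x, 'u) module. fg_left_module TA U \<longrightarrow>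
    ((irreducible_module TA U \<and> (\<exists>j\<le>d. R j \<in> thin_radical d R \<and> scalar_dim U (slice U j) > 0))
     \<longleftrightarrow> modules_isomorphic TA U W0)"
  obtain U :: "('f^'x^'x, 'u) module" where U: "fg_left_module TA U" "modules_isomorphic TA U W0"
    by (rule copy_of_W0[OF assms])
  then have "irreducible_module TA U"
    using r by blast
  then have "irreducible_module TA W0"
    using U(2) by (rule irreducible_module_isomorphic[OF _ left_module_W0])
  then show nondegenerate
    using nondegenerate_iff_irreducible by simp
qed

text \<open>The contragredient of \<open>W\<close> always meets the dimension condition, so the condition forces \<open>W\<close> to be
  self-contragredient.\<close>

lemma nondegenerate_iff_dim_thin:
  assumes "inj (emb :: 'f list \<Rightarrow> 'u)"
  shows "nondegenerate \<longleftrightarrow> (\<forall>U :: ('f^'x^'x, 'u) module. fg_left_module TA U \<longrightarrow>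
    ((\<exists>j\<le>d. R j \<in> thin_radical d R \<and> scalar_dim U (carrier U) = d + 1 \<and>
       d + 1 \<ge> scalar_dim U (slice U j) \<and> scalar_dim U (slice U j) > 0)
     \<longleftrightarrow> modules_isomorphic TA U W0))"
proof (intro iffI allI impI)
  fix U :: "('f^'x^'x, 'u) module"
  assume H: "nondegenerate" and fg: "fg_left_module TA U"
  then have U: "left_module TA U"
    by (simp add: fg_left_module_def)
  {
    assume "\<exists>j\<le>d. R j \<in> thin_radical d R \<and> scalar_dim U (carrier U) = d + 1 \<and>
       d + 1 \<ge> scalar_dim U (slice U j) \<and> scalar_dim U (slice U j) > 0"
    then obtain j where dim: "scalar_dim U (carrier U) = Suc d" and j: "j \<le> d" "k j = 1" "scalar_dim U (slice U j) > 0"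
      using thin_iff by auto
    obtain u where u: "u \<in> carrier U" "E j \<odot>\<^bsub>U\<^esub> u = u" "u \<noteq> \<zero>\<^bsub>U\<^esub>"
      by (rule slice_nonzero[OF U j])
    let ?f = "\<lambda>v. outer v (w j) \<odot>\<^bsub>U\<^esub> u"
    note f = hom_from_primary_module[OF U j(1,2) u(1,2)]
    have inj: "inj_on ?f (carrier W0)"
      using f(3)[OF H u(3)] by simp
    have "?f ` carrier W0 = carrier U"
      by (rule injective_hom_surjective[OF unital_T left_module_W0 U f(1) inj _ fin_dim_fg_left_module[OF unital_T fg]])
         (simp_all add: dim_W0 dim)
    then have "modules_isomorphic TA W0 U"
      using f(1) inj by (auto simp: modules_isomorphic_def bij_betw_def)
    then show "modules_isomorphic TA U W0"
      by (rule modules_isomorphic_sym[OF left_module_W0])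
  }
  {
    assume iso: "modules_isomorphic TA U W0"
    have "scalar_dim U (carrier U) = Suc d" "scalar_dim U (slice U 0) = 1"
      using dim_isomorphic[OF left_module_W0 U iso] dim_W0 by simp_all
    then show "\<exists>j\<le>d. R j \<in> thin_radical d R \<and> scalar_dim U (carrier U) = d + 1 \<and>
       d + 1 \<ge> scalar_dim U (slice U j) \<and> scalar_dim U (slice U j) > 0"
      using R_0_thin by (intro exI[of _ 0]) simp
  }
next
  assume r: "\<forall>U :: ('f^'x^'x, 'u) module. fg_left_module TA U \<longrightarrow>
    ((\<exists>j\<le>d. R j \<in> thin_radical d R \<and> scalar_dim U (carrier U) = d + 1 \<and>
       d + 1 \<ge> scalar_dim U (slice U j) \<and> scalar_dim U (slice U j) > 0)
     \<longleftrightarrow> modules_isomorphic TA U W0)"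
  obtain U :: "('f^'x^'x, 'u) module" where fg: "fg_left_module TA U" and iso: "modules_isomorphic TA U W0'"
    by (rule copy_of_contragredient[OF assms])
  then have U: "left_module TA U"
    by (simp add: fg_left_module_def)
  have "scalar_dim U (carrier U) = Suc d" "scalar_dim U (slice U 0) = 1"
    using dim_isomorphic[OF left_module_contragredient U iso dim_contragredient] by simp_all
  then have "\<exists>j\<le>d. R j \<in> thin_radical d R \<and> scalar_dim U (carrier U) = d + 1 \<and>
       d + 1 \<ge> scalar_dim U (slice U j) \<and> scalar_dim U (slice U j) > 0"
    using R_0_thin by (intro exI[of _ 0]) simp
  then have "modules_isomorphic TA U W0"
    using r fg by blast
  then have "modules_isomorphic TA W0 W0'"
    using modules_isomorphic_trans[OF modules_isomorphic_sym[OF U] iso] by blast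
  then show nondegenerate
    by (rule self_contragredient_imp_nondegenerate)
qed

end

context terwilliger_algebra
begin

section \<open>Decompositions of the regular module\<close>

abbreviation left_ideal :: "('f^'x^'x) set \<Rightarrow> bool" where
  "left_ideal N \<equiv> Module.submodule N TA (regular_module TA)"

abbreviation summand :: "('f^'x^'x) set \<Rightarrow> ('f^'x^'x, 'f^'x^'x) module" where
  "summand N \<equiv> (regular_module TA)\<lparr>carrier := N\<rparr>"

lemma left_idealD:
  assumes "left_ideal N"
  shows "N \<subseteq> T" "0 \<in> N" "u \<in> N \<Longrightarrow> v \<in> N \<Longrightarrow> u + v \<in> N" "a \<in> T \<Longrightarrow> u \<in> N \<Longrightarrow> a ** u \<in> N"
    "u \<in> N \<Longrightarrow> - u \<in> N" "u \<in> N \<Longrightarrow> v \<in> N \<Longrightarrow> u - v \<in> N" "u \<in> N \<Longrightarrow> mat_scale c u \<in> N"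
proof -
  show *: "N \<subseteq> T" "0 \<in> N" "\<And>u v. u \<in> N \<Longrightarrow> v \<in> N \<Longrightarrow> u + v \<in> N" "\<And>a u. a \<in> T \<Longrightarrow> u \<in> N \<Longrightarrow> a ** u \<in> N"
    using assms unfolding left_ideal_iff by blast+
  show scale: "mat_scale c u \<in> N" if "u \<in> N" for c u
    unfolding scale_eq_mat_mult by (rule *(4)[OF T_closed(2) that])
  show neg: "- u \<in> N" if "u \<in> N" for u
    using scale[OF that, of "- 1"] by simp
  show "u - v \<in> N" if "u \<in> N" "v \<in> N"
    using *(3)[OF that(1) neg[OF that(2)]] by simp
qed

lemma left_module_summand: "left_ideal N \<Longrightarrow> left_module TA (summand N)"
  by (rule left_module.left_module_submodule[OF left_module_TA])

lemma submodule_summand_iff: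
  assumes "left_ideal N"
  shows "Module.submodule N' TA (summand N) \<longleftrightarrow> left_ideal N' \<and> N' \<subseteq> N"
  unfolding left_module.submodule_iff[OF left_module_summand[OF assms]] left_ideal_iff
  using left_idealD(1)[OF assms] by auto

lemma set_add_summand: "N1 <+>\<^bsub>summand N\<^esub> N2 = {Y + Z | Y Z. Y \<in> N1 \<and> Z \<in> N2}"
  by (auto simp: set_add_def set_mult_def)

lemma finsum_regular_module:
  assumes "finite I" "v \<in> I \<rightarrow> T"
  shows "finsum (regular_module TA) v I = sum v I"
proof -
  interpret left_module TA "regular_module TA"
    by (rule left_module_TA)
  show ?thesis
    using assms
  proof (induction I)
    case (insert i I)
    then have "finsum (regular_module TA) v (insert i I) =
        v i \<oplus>\<^bsub>regular_module TA\<^esub> finsum (regular_module TA) v I"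
      by (intro M.finsum_insert) auto
    with insert show ?case by simp
  qed simp
qed

lemma finsum_summands:
  fixes n :: nat
  assumes "\<forall>i<n. left_ideal (V i)" "v \<in> Pi\<^sub>E {..<n} V"
  shows "finsum (regular_module TA) v {..<n} = (\<Sum>i<n. v i)"
proof (rule finsum_regular_module)
  show "v \<in> {..<n} \<rightarrow> T"
  proof
    fix i assume "i \<in> {..<n}"
    then show "v i \<in> T"
      using assms PiE_mem[OF assms(2), of i] left_idealD(1)[of "V i"] by auto
  qed
qed simp

text \<open>Directness in terms of sums of matrices, with uniqueness reduced to representations of zero.\<close>

lemma internal_direct_sum_iff:
  fixes n :: nat
  shows "internal_direct_sum TA (regular_module TA) {..<n} V \<longleftrightarrow>
    (\<forall>i<n. left_ideal (V i)) \<and>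
    (\<forall>u\<in>T. \<exists>v. (\<forall>i<n. v i \<in> V i) \<and> u = (\<Sum>i<n. v i)) \<and>
    (\<forall>v. (\<forall>i<n. v i \<in> V i) \<and> (\<Sum>i<n. v i) = 0 \<longrightarrow> (\<forall>i<n. v i = 0))" (is "?L \<longleftrightarrow> ?S \<and> ?X \<and> ?U")
proof (intro iffI conjI)
  assume L: ?L
  show S: ?S
    using L by (simp add: internal_direct_sum_def)
  have fs: "finsum (regular_module TA) v {..<n} = (\<Sum>i<n. v i)" if "v \<in> Pi\<^sub>E {..<n} V" for v
    using finsum_summands S that .
  have ex1: "\<exists>!v. v \<in> Pi\<^sub>E {..<n} V \<and> u = (\<Sum>i<n. v i)" if "u \<in> T" for u
  proof -
    have "\<exists>!v. v \<in> Pi\<^sub>E {..<n} V \<and> u = finsum (regular_module TA) v {..<n}"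
      using L that by (simp add: internal_direct_sum_def)
    then show ?thesis
      using fs by (auto intro: ex1I)
  qed
  show ?X
  proof
    fix u assume "u \<in> T"
    from ex1[OF this] obtain v where "v \<in> Pi\<^sub>E {..<n} V" "u = (\<Sum>i<n. v i)"
      by blast
    then show "\<exists>v. (\<forall>i<n. v i \<in> V i) \<and> u = (\<Sum>i<n. v i)"
      by (intro exI[of _ v]) auto
  qed
  show ?U
  proof (intro allI impI)
    fix v i assume v: "(\<forall>i<n. v i \<in> V i) \<and> (\<Sum>i<n. v i) = 0" and i: "i < n"
    let ?v = "restrict v {..<n}" and ?z = "\<lambda>i\<in>{..<n}. 0"
    have "?v \<in> Pi\<^sub>E {..<n} V \<and> 0 = (\<Sum>i<n. ?v i)"
      using v by auto
    moreover have "?z \<in> Pi\<^sub>E {..<n} V \<and> 0 = (\<Sum>i<n. ?z i)"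
      using S left_idealD(2) by auto
    ultimately have "?v = ?z"
      using ex1[OF T_closed(1)] by blast
    from fun_cong[OF this, of i] show "v i = 0"
      using i by simp
  qed
next
  assume r: "?S \<and> ?X \<and> ?U"
  have U: ?U
    by (rule conjunct2[OF conjunct2[OF r]])
  have fs: "finsum (regular_module TA) v {..<n} = (\<Sum>i<n. v i)" if "v \<in> Pi\<^sub>E {..<n} V" for v
    using finsum_summands conjunct1[OF r] that .
  have "\<exists>!v. v \<in> Pi\<^sub>E {..<n} V \<and> u = finsum (regular_module TA) v {..<n}" if u: "u \<in> T" for u
  proof -
    obtain v where v: "\<forall>i<n. v i \<in> V i" "u = (\<Sum>i<n. v i)"
      using r u by blast
    let ?v = "restrict v {..<n}"
    show ?thesis
    proof (rule ex1I[of _ ?v])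
      have v': "?v \<in> Pi\<^sub>E {..<n} V"
        using v by auto
      then show "?v \<in> Pi\<^sub>E {..<n} V \<and> u = finsum (regular_module TA) ?v {..<n}"
        using fs[OF v'] v(2) by simp
    next
      fix v' assume v': "v' \<in> Pi\<^sub>E {..<n} V \<and> u = finsum (regular_module TA) v' {..<n}"
      have "(\<Sum>i<n. v' i - v i) = 0"
        using v' fs[of v'] v(2) by (simp add: sum_subtractf)
      moreover have "\<forall>i<n. v' i - v i \<in> V i"
      proof (intro allI impI)
        fix i assume i: "i < n"
        have "v' i \<in> V i"
          using v' i by (auto dest: PiE_mem)
        then show "v' i - v i \<in> V i"
          using left_idealD(6)[of "V i"] conjunct1[OF r] v(1) i by blast
      qed
      ultimately have "\<forall>i<n. v' i - v i = 0"
        using U[THEN spec, of "\<lambda>i. v' i - v i"] by blast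
      then show "v' = ?v"
        using v' by (intro extensionalityI[of _ "{..<n}"]) (auto simp: PiE_def)
    qed
  qed
  then show ?L
    using r unfolding internal_direct_sum_def by simp
qed

lemma internal_direct_sumD:
  fixes n :: nat
  assumes ds: "internal_direct_sum TA (regular_module TA) {..<n} V"
  shows "i < n \<Longrightarrow> left_ideal (V i)"
    and "u \<in> T \<Longrightarrow> \<exists>v. (\<forall>i<n. v i \<in> V i) \<and> u = (\<Sum>i<n. v i)"
    and "(\<And>i. i < n \<Longrightarrow> v i \<in> V i) \<Longrightarrow> (\<Sum>i<n. v i) = 0 \<Longrightarrow> i < n \<Longrightarrow> v i = 0"
proof -
  note ds' = ds[unfolded internal_direct_sum_iff]
  show "i < n \<Longrightarrow> left_ideal (V i)"
    by (rule conjunct1[OF ds', rule_format])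
  show "u \<in> T \<Longrightarrow> \<exists>v. (\<forall>i<n. v i \<in> V i) \<and> u = (\<Sum>i<n. v i)"
    by (rule conjunct1[OF conjunct2[OF ds'], rule_format])
  show "(\<And>i. i < n \<Longrightarrow> v i \<in> V i) \<Longrightarrow> (\<Sum>i<n. v i) = 0 \<Longrightarrow> i < n \<Longrightarrow> v i = 0"
    by (rule conjunct2[OF conjunct2[OF ds'], rule_format]) blast+
qed

lemma independent_family:
  assumes "finite I" "\<And>c i. (\<Sum>i\<in>I. mat_scale (c i) (b i)) = 0 \<Longrightarrow> i \<in> I \<Longrightarrow> c i = 0"
  shows "inj_on b I" "mat_space.independent (b ` I)"
proof -
  show inj: "inj_on b I"
  proof (rule inj_onI)
    fix i j assume ij: "i \<in> I" "j \<in> I" "b i = b j"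
    show "i = j"
    proof (rule ccontr)
      assume "i \<noteq> j"
      let ?c = "\<lambda>l. if l = i then 1 else if l = j then - 1 else 0"
      have "(\<Sum>l\<in>I. mat_scale (?c l) (b l)) = (\<Sum>l\<in>I. (if l = i then b i else 0) - (if l = j then b j else 0))"
        using \<open>i \<noteq> j\<close> by (intro sum.cong) auto
      also have "\<dots> = 0"
        using assms(1) ij by (simp add: sum_subtractf)
      finally show False
        using assms(2)[of ?c i] ij by simp
    qed
  qed
  show "mat_space.independent (b ` I)"
  proof (rule mat_space.independent_if_scalars_zero)
    fix c u assume "(\<Sum>u\<in>b ` I. mat_scale (c u) u) = 0" "u \<in> b ` I"
    then show "c u = 0"
      using assms(2)[of "c \<circ> b"] by (auto simp: sum.reindex[OF inj])
  qed (use assms in simp)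
qed

lemma direct_sum_independent:
  fixes n :: nat
  assumes ds: "internal_direct_sum TA (regular_module TA) {..<n} V"
    and K: "K \<subseteq> {..<n}" "\<And>i. i \<in> K \<Longrightarrow> u i \<in> V i \<and> u i \<noteq> 0"
  shows "inj_on u K" "mat_space.independent (u ` K)"
proof -
  have fin: "finite K"
    using K(1) finite_subset by blast
  have "c i = 0" if c: "(\<Sum>i\<in>K. mat_scale (c i) (u i)) = 0" and i: "i \<in> K" for c i
  proof -
    let ?v = "\<lambda>i. if i \<in> K then mat_scale (c i) (u i) else 0"
    have "(\<Sum>i<n. ?v i) = 0"
      using c K(1) by (simp add: sum.If_cases Int_absorb1)
    moreover have "?v l \<in> V l" if "l < n" for l
      using left_idealD(2,7)[OF internal_direct_sumD(1)[OF ds that]] K(2) by simp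
    ultimately have "?v i = 0"
      using i K(1) by (intro internal_direct_sumD(3)[OF ds, of ?v]) auto
    then have "mat_scale (c i) (u i) = 0"
      using i by simp
    then show ?thesis
      using K(2)[OF i] by simp
  qed
  then show "inj_on u K" "mat_space.independent (u ` K)"
    using independent_family[OF fin] by blast+
qed

text \<open>Dimension bounds the number of nonzero summands. In a decomposition with the maximal number of
  them, every summand is indecomposable, since a splitting could be used to refine it.\<close>

lemma indecomposable_decomposition:
  obtains n :: nat and V where "internal_direct_sum TA (regular_module TA) {..<n} V"
    "\<forall>i<n. indecomposable_module TA (summand (V i))"
proof -
  let ?P = "\<lambda>n :: nat. \<exists>V. internal_direct_sum TA (regular_module TA) {..<n} V \<and> (\<forall>i<n. V i \<noteq> {0})"
  obtain S :: "('f^'x^'x) set" where S: "finite S" "S \<subseteq> T" "T \<subseteq> mat_space.span S"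
    by (rule finite_spanning_subset)
  have bound: "n \<le> card S" if "?P n" for n
  proof -
    obtain V where ds: "internal_direct_sum TA (regular_module TA) {..<n} V" and ne: "\<forall>i<n. V i \<noteq> {0}"
      using \<open>?P n\<close> by blast
    have sub: "V i \<subseteq> T" "0 \<in> V i" if "i < n" for i
      by (rule left_idealD(1,2)[OF internal_direct_sumD(1)[OF ds that]])+
    have "\<forall>i. \<exists>u. i < n \<longrightarrow> u \<in> V i \<and> u \<noteq> 0"
      using ne sub(2) by blast
    then obtain u where u: "\<And>i. i < n \<Longrightarrow> u i \<in> V i \<and> u i \<noteq> 0"
      by metis
    have "u ` {..<n} \<subseteq> mat_space.span S"
      using u sub(1) S(3) by blast
    then have "card (u ` {..<n}) \<le> card S"
      using mat_space.independent_span_bound[OF S(1)] direct_sum_independent(2)[OF ds, of "{..<n}" u] u by simp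
    then show ?thesis
      using card_image[OF direct_sum_independent(1)[OF ds, of "{..<n}" u]] u by simp
  qed
  have one: "?P (Suc 0)"
  proof (intro exI conjI allI impI)
    have "left_ideal T"
      unfolding left_ideal_iff by (simp add: T_closed)
    moreover have "\<exists>v. (\<forall>i<Suc 0. v i \<in> T) \<and> u = (\<Sum>i<Suc 0. v i)" if "u \<in> T" for u
      using that by (intro exI[of _ "\<lambda>_. u"]) simp
    ultimately show "internal_direct_sum TA (regular_module TA) {..<Suc 0} (\<lambda>_. T)"
      unfolding internal_direct_sum_iff by simp
    show "T \<noteq> {0}"
      using outer_in_T[OF w_in_W w_in_W, of 0 0] outer_w_0_ne_0[of 0] by auto
  qed
  define n where "n = (GREATEST n. ?P n)"
  have n: "?P n" "m \<le> n" if "?P m" for m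
    unfolding n_def using GreatestI_nat[of ?P _ "card S", OF one] Greatest_le_nat[of ?P _ "card S", OF that] bound
    by blast+
  obtain V where ds: "internal_direct_sum TA (regular_module TA) {..<n} V" and ne: "\<forall>i<n. V i \<noteq> {0}"
    using n(1)[OF one] by blast
  have li: "left_ideal (V i)" if "i < n" for i
    by (rule internal_direct_sumD(1)[OF ds that])
  have ex: "\<exists>v. (\<forall>i<n. v i \<in> V i) \<and> u = (\<Sum>i<n. v i)" if "u \<in> T" for u
    by (rule internal_direct_sumD(2)[OF ds that])
  note uniq = internal_direct_sumD(3)[OF ds]
  have "indecomposable_module TA (summand (V i))" if i: "i < n" for i
    unfolding indecomposable_module_def
  proof (intro conjI allI impI)
    show "left_module TA (summand (V i))"
      by (rule left_module_summand[OF li[OF i]])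
    show "carrier (summand (V i)) \<noteq> {\<zero>\<^bsub>summand (V i)\<^esub>}"
      using ne i by simp
    fix N1 N2
    assume "Module.submodule N1 TA (summand (V i)) \<and> Module.submodule N2 TA (summand (V i)) \<and>
      N1 \<inter> N2 = {\<zero>\<^bsub>summand (V i)\<^esub>} \<and> N1 <+>\<^bsub>summand (V i)\<^esub> N2 = carrier (summand (V i))"
    then have N: "left_ideal N1" "left_ideal N2" "N1 \<inter> N2 = {0}"
      and sum: "{Y + Z | Y Z. Y \<in> N1 \<and> Z \<in> N2} = V i"
      unfolding submodule_summand_iff[OF li[OF i]] set_add_summand by simp_all
    show "N1 = {\<zero>\<^bsub>summand (V i)\<^esub>} \<or> N2 = {\<zero>\<^bsub>summand (V i)\<^esub>}"
    proof (rule ccontr)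
      assume "\<not> ?thesis"
      then have ne': "N1 \<noteq> {0}" "N2 \<noteq> {0}"
        by simp_all
      \<comment> \<open>\<open>N1\<close> replaces the \<open>i\<close>-th summand and \<open>N2\<close> is appended at the first free index \<open>n\<close>.\<close>
      let ?V = "V(i := N1, n := N2)"
      have split: "(\<Sum>l<Suc n. v l) = (\<Sum>l<n. (v(i := v i + v n)) l)" for v :: "nat \<Rightarrow> 'f^'x^'x"
      proof -
        have "(\<Sum>l<n. (v(i := v i + v n)) l) = (\<Sum>l<n. v l + (if l = i then v n else 0))"
          by (intro sum.cong) auto
        then show ?thesis
          using i by (simp add: sum.distrib)
      qed
      have "internal_direct_sum TA (regular_module TA) {..<Suc n} ?V"
        unfolding internal_direct_sum_iff
      proof (intro conjI allI ballI impI)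
        fix l assume "l < Suc n"
        then show "left_ideal (?V l)"
          using N li by auto
      next
        fix u assume "u \<in> T"
        from ex[OF this] obtain v where v: "\<forall>i<n. v i \<in> V i" "u = (\<Sum>i<n. v i)"
          by blast
        then have "v i \<in> {Y + Z | Y Z. Y \<in> N1 \<and> Z \<in> N2}"
          using sum i by simp
        then obtain Y Z where YZ: "Y \<in> N1" "Z \<in> N2" "v i = Y + Z"
          by blast
        let ?v = "v(i := Y, n := Z)"
        have "?v(i := ?v i + ?v n, n := v n) = v"
          using YZ(3) i by auto
        then have "(\<Sum>l<n. (?v(i := ?v i + ?v n)) l) = (\<Sum>l<n. v l)"
          by (intro sum.cong) (auto simp: fun_eq_iff split: if_splits)
        then have "u = (\<Sum>l<Suc n. ?v l)"
          unfolding split v(2) by simp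
        moreover have "\<forall>l<Suc n. ?v l \<in> ?V l"
          using v YZ by (auto simp: less_Suc_eq)
        ultimately show "\<exists>v. (\<forall>l<Suc n. v l \<in> ?V l) \<and> u = (\<Sum>l<Suc n. v l)"
          by blast
      next
        fix v l assume v: "(\<forall>l<Suc n. v l \<in> ?V l) \<and> (\<Sum>l<Suc n. v l) = 0" and l: "l < Suc n"
        have vi: "v i \<in> N1" and vn: "v n \<in> N2"
          using v i by (auto dest: spec[of _ i] spec[of _ n])
        let ?v = "v(i := v i + v n)"
        have "v i + v n \<in> V i"
          unfolding sum[symmetric] using vi vn by blast
        then have "?v l \<in> V l" if "l < n" for l
          using v that by (auto dest: spec[of _ l])
        moreover have "(\<Sum>l<n. ?v l) = 0"
          using v unfolding split by blast
        ultimately have zero: "?v l = 0" if "l < n" for l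
          using uniq[of ?v] that by blast
        have "v i = - v n"
          using zero[OF i] by (simp add: eq_neg_iff_add_eq_0)
        then have "v i \<in> N1 \<inter> N2"
          using vi left_idealD(5)[OF N(2) vn] by simp
        then have "v i = 0" "v n = 0"
          using N(3) \<open>v i = - v n\<close> by auto
        then show "v l = 0"
          using zero[of l] l by (cases "l = i"; cases "l = n") auto
      qed
      moreover have "\<forall>l<Suc n. ?V l \<noteq> {0}"
        using ne ne' by (auto simp: less_Suc_eq)
      ultimately have "Suc n \<le> n"
        by (intro n(2)) blast
      then show False by simp
    qed
  qed
  with ds that show ?thesis by blast
qed

section \<open>Summands isomorphic to the primary module\<close>

lemma E_0_mult: "E 0 ** Z = outer (w 0) (transpose Z *v w 0)"
  by (simp add: E_0 outer_mult del: transpose_matrix_vector)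

lemma E_0_idem: "E 0 ** (E 0 ** Z) = E 0 ** (Z :: 'f^'x^'x)"
  unfolding E_0_mult[of Z] E_0_outer ..

abbreviation first_row :: "nat \<Rightarrow> 'f^'x^'x" where "first_row j \<equiv> outer (w 0) (w j)"

lemma E_0_mult_in_span:
  assumes "Z \<in> T"
  shows "E 0 ** Z \<in> mat_space.span (first_row ` {..d})"
proof -
  define a where "a = transpose Z *v w 0"
  have a: "a \<in> W"
    unfolding a_def by (rule transpose_T_mult_W[OF assms w_in_W])
  have "outer (w 0) a = (\<Sum>j\<le>d. mat_scale (a $ rep j) (first_row j))"
  proof -
    have "outer (w 0) (\<Sum>j\<in>I. a $ rep j *s w j) = (\<Sum>j\<in>I. mat_scale (a $ rep j) (first_row j))" for I
      by (simp add: vec_eq_iff mat_scale_nth sum_distrib_left mult_ac)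
    from this[of "{..d}"] show ?thesis
      unfolding W_expand[OF a, symmetric] .
  qed
  also have "\<dots> \<in> mat_space.span (first_row ` {..d})"
    by (intro mat_space.span_sum mat_space.span_scale mat_space.span_base) auto
  finally show ?thesis
    unfolding E_0_mult a_def .
qed

lemma independent_first_row:
  "inj_on first_row {..d}" "mat_space.independent (first_row ` {..d})"
proof -
  have "c i = 0" if c: "(\<Sum>j\<le>d. mat_scale (c j) (first_row j)) = 0" and i: "i \<in> {..d}" for c i
  proof -
    have "(\<Sum>j\<le>d. mat_scale (c j) (first_row j)) $ x $ rep i = (\<Sum>j\<le>d. if i = j then c j else 0)"
      using i by (simp add: mat_scale_nth shell_eq_0_iff if_distrib[of "\<lambda>t. _ * t"] cong: if_cong)
    then show ?thesis
      unfolding c using i by simp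
  qed
  then show "inj_on first_row {..d}" "mat_space.independent (first_row ` {..d})"
    using independent_family[of "{..d}" first_row] by blast+
qed

text \<open>Nonzero vectors fixed by \<open>E 0\<close> in different summands are independent elements of \<open>E 0 T\<close>, which is
  spanned by \<open>d + 1\<close> matrices.\<close>

lemma card_thin_summands_le:
  fixes n :: nat
  assumes ds: "internal_direct_sum TA (regular_module TA) {..<n} V"
    and K: "K \<subseteq> {..<n}" "\<And>i. i \<in> K \<Longrightarrow> \<exists>u\<in>V i. u \<noteq> 0 \<and> E 0 ** u = u"
  shows "card K \<le> d + 1"
proof -
  obtain u where u: "\<And>i. i \<in> K \<Longrightarrow> u i \<in> V i \<and> u i \<noteq> 0 \<and> E 0 ** u i = u i"
    using K(2) by metis
  have "u i \<in> mat_space.span (first_row ` {..d})" if "i \<in> K" for i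
  proof -
    have "u i \<in> T"
      using left_idealD(1)[OF internal_direct_sumD(1)[OF ds]] u[OF that] K(1) that by blast
    then show ?thesis
      using E_0_mult_in_span[of "u i"] u[OF that] by simp
  qed
  then have "u ` K \<subseteq> mat_space.span (first_row ` {..d})"
    by blast
  moreover have "inj_on u K" "mat_space.independent (u ` K)"
    using direct_sum_independent[OF ds K(1)] u by blast+
  ultimately have "card K \<le> card (first_row ` {..d})"
    using mat_space.independent_span_bound[of "first_row ` {..d}" "u ` K"] by (simp add: card_image)
  then show ?thesis
    using card_image_le[of "{..d}" first_row] by simp
qed

text \<open>The vector \<open>u\<close> is the image of \<open>w 0\<close>. As \<open>E 0\<close> maps \<open>W\<close> to the multiples of \<open>w 0\<close>, it maps \<open>N\<close> to
  the multiples of \<open>u\<close>. Since \<open>w 0\<close> generates \<open>W\<close> under \<open>B\<close>, also \<open>N = B u \<subseteq> B\<close>.\<close>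

lemma summand_isomorphicE:
  assumes N: "left_ideal N" and iso: "modules_isomorphic TA (summand N) W0"
  obtains u where "u \<in> N" "u \<noteq> 0" "E 0 ** u = u" "N \<subseteq> B"
    "\<And>Z. Z \<in> N \<Longrightarrow> \<exists>c. E 0 ** Z = mat_scale c u"
proof -
  obtain g where g: "g \<in> module_hom TA W0 (summand N)" "bij_betw g W N"
    using modules_isomorphic_sym[OF left_module_summand[OF N] iso] by (auto simp: modules_isomorphic_def)
  have smult: "g (Z *v v) = Z ** g v" if "Z \<in> T" "v \<in> W" for Z v
    using module_hom_smult[OF g(1)] that by simp
  have E0: "E 0 \<in> T"
    by (rule generators_in_T) simp
  define u where "u = g (w 0)"
  show ?thesis
  proof
    show "u \<in> N"
      unfolding u_def using g(2) w_in_W by (auto simp: bij_betw_def)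
    show "u \<noteq> 0"
    proof
      assume "u = 0"
      then have "g (w 0) = g 0"
        using module_hom_zero[OF left_module_W0 left_module_summand[OF N] g(1)] by (simp add: u_def)
      then have "w 0 = 0"
        using g(2) W_closed(1) w_in_W by (auto simp: bij_betw_def dest: inj_onD)
      then show False
        using w_ne_0[of 0] by simp
    qed
    show "E 0 ** u = u"
      unfolding u_def smult[OF E0 w_in_W, symmetric] E_0_mult_vec by (simp add: shell_eq_0_iff)
    show "N \<subseteq> B"
    proof
      fix Z assume "Z \<in> N"
      then obtain v where v: "v \<in> W" "Z = g v"
        using g(2) by (auto simp: bij_betw_def)
      have "v = outer v (w 0) *v w 0"
        by (simp add: outer_mult_vec dot_w_w k_0)
      then have "Z = outer v (w 0) ** u"
        unfolding u_def v(2) using smult[OF outer_in_T[OF v(1) w_in_W] w_in_W] by metis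
      then show "Z \<in> B"
        using B_ideal(2)[OF _ outer_in_B[OF v(1) w_in_W]] \<open>u \<in> N\<close> left_idealD(1)[OF N] by blast
    qed
    fix Z assume "Z \<in> N"
    then obtain v where v: "v \<in> W" "Z = g v"
      using g(2) by (auto simp: bij_betw_def)
    have "E 0 ** Z = g (mat (v $ x) *v w 0)"
      unfolding v(2) smult[OF E0 v(1), symmetric] E_0_mult_vec scalar_mat_mult_vec ..
    also have "\<dots> = mat_scale (v $ x) u"
      using smult[OF T_closed(2) w_in_W] by (simp add: u_def scale_eq_mat_mult)
    finally show "\<exists>c. E 0 ** Z = mat_scale c u"
      by blast
  qed
qed

lemma dot_W_eq_0:
  assumes "\<And>j. j \<le> d \<Longrightarrow> dot (w j) a = 0" "b \<in> W"
  shows "dot b a = 0"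
proof -
  have "dot (\<Sum>j\<in>I. b $ rep j *s w j) a = (\<Sum>j\<in>I. b $ rep j * dot (w j) a)" for I
    by (induction I rule: infinite_finite_induct)
       (simp_all add: dot_add_left dot_scale_left, simp_all add: dot_def)
  from this[of "{..d}"] show ?thesis
    unfolding W_expand[OF assms(2), symmetric] using assms(1) by simp
qed

lemma column_mult: "column y (Y ** Z) = Y *v column y (Z :: 'f^'x^'x)"
  by (simp add: column_def vec_eq_iff matrix_matrix_mult_def matrix_vector_mult_def)

text \<open>Let \<open>u = E 0 ** u\<close> be a nonzero element of \<open>N\<close>, so \<open>u = outer (w 0) a\<close>. The copy of the primary
  module generated by \<open>u\<close> consists of all \<open>outer v a\<close>. If \<open>a $ y \<noteq> 0\<close>, then the elements of \<open>N\<close> whose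
  column \<open>y\<close> is orthogonal to \<open>W\<close> form a complement, because the form on \<open>W\<close> is nondegenerate.\<close>

lemma indecomposable_summand_isomorphic:
  assumes H: "nondegenerate" and N: "left_ideal N" and indec: "indecomposable_module TA (summand N)"
    and u: "u \<in> N" "u \<noteq> 0" "E 0 ** u = u"
  shows "modules_isomorphic TA (summand N) W0"
proof -
  let ?f = "\<lambda>v. outer v (w 0) ** u"
  define a where "a = transpose u *v w 0"
  have f_eq: "?f v = outer v a" for v
    by (simp add: a_def outer_mult del: transpose_matrix_vector)
  have f: "?f \<in> module_hom TA W0 (summand N)" "inj_on ?f W" "?f (w 0) = u"
    using hom_from_primary_module[OF left_module_summand[OF N], of 0 u] H u k_0 by simp_all
  have "a \<noteq> 0"
  proof
    assume "a = 0"
    then have "outer (w 0) a = 0"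
      by (simp add: vec_eq_iff)
    then show False
      using u(2) f(3) f_eq[of "w 0"] by simp
  qed
  then obtain y where y: "a $ y \<noteq> 0"
    by (auto simp: vec_eq_iff)
  let ?N1 = "?f ` W" and ?N2 = "{Z \<in> N. \<forall>b\<in>W. dot b (column y Z) = 0}"
  have col: "column y (outer v a) = a $ y *s v" for v
    by (simp add: column_def vec_eq_iff mult.commute)
  have N1: "left_ideal ?N1 \<and> ?N1 \<subseteq> N"
    using submodule_image[OF left_module_W0 left_module_summand[OF N] f(1)]
    unfolding submodule_summand_iff[OF N] by simp
  have N2: "left_ideal ?N2"
    unfolding left_ideal_iff
  proof (intro conjI ballI)
    show "?N2 \<subseteq> T"
      using left_idealD(1)[OF N] by blast
    show "0 \<in> ?N2"
      using left_idealD(2)[OF N] by (simp add: column_def dot_def)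
  next
    fix Y Z assume "Y \<in> ?N2" "Z \<in> ?N2"
    moreover have "column y (Y + Z) = column y Y + column y Z"
      by (simp add: column_def vec_eq_iff)
    ultimately show "Y + Z \<in> ?N2"
      using left_idealD(3)[OF N] by (simp add: dot_add_right)
  next
    fix Y Z assume Y: "Y \<in> T" and Z: "Z \<in> ?N2"
    have "dot b (column y (Y ** Z)) = 0" if "b \<in> W" for b
    proof -
      have "dot b (column y (Y ** Z)) = dot (transpose Y *v b) (column y Z)"
        unfolding column_mult dot_adjoint by (simp add: transpose_transpose)
      then show ?thesis
        using Z transpose_T_mult_W[OF Y that] by simp
    qed
    then show "Y ** Z \<in> ?N2"
      using left_idealD(4)[OF N Y] Z by simp
  qed
  have inter: "?N1 \<inter> ?N2 = {0}"
  proof -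
    have "?f v = 0" if "v \<in> W" "?f v \<in> ?N2" for v
    proof -
      have "dot b (column y (outer v a)) = 0" if "b \<in> W" for b
        using \<open>?f v \<in> ?N2\<close> that by (simp add: f_eq)
      then have "v = 0"
        using y unfolding col by (intro nondegenerate_dot[OF H that(1)]) (simp add: dot_scale_right)
      then show ?thesis
        by (simp add: f_eq vec_eq_iff)
    qed
    then show ?thesis
      using left_idealD(2) N1 N2 by blast
  qed
  have sum: "{Y + Z | Y Z. Y \<in> ?N1 \<and> Z \<in> ?N2} = N"
  proof (intro equalityI subsetI)
    fix Z assume "Z \<in> {Y + Z | Y Z. Y \<in> ?N1 \<and> Z \<in> ?N2}"
    then show "Z \<in> N"
      using N1 left_idealD(3)[OF N] by blast
  next
    fix Z assume Z: "Z \<in> N"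
    define v where "v = (\<chi> z. dot (w (shell z)) (column y Z) / (of_nat (k (shell z)) * a $ y))"
    have v: "v \<in> W"
      by (simp add: mem_W_iff v_def)
    have mem: "Z - outer v a \<in> N"
      using left_idealD(6)[OF N Z] N1 v f_eq[of v] by auto
    have colZ: "column y (Z - outer v a) + a $ y *s v = column y Z"
      by (simp add: column_def vec_eq_iff mult.commute)
    have "dot (w j) (column y (Z - outer v a)) = 0" if j: "j \<le> d" for j
    proof -
      have "dot (w j) (column y (Z - outer v a)) + a $ y * dot (w j) v = dot (w j) (column y Z)"
        unfolding colZ[symmetric] dot_add_right dot_scale_right ..
      moreover have "a $ y * dot (w j) v = dot (w j) (column y Z)"
        using j y nondegenerateD[OF H j] by (simp add: dot_w[OF v]) (simp add: v_def)
      ultimately show ?thesis by simp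
    qed
    then have "Z - outer v a \<in> ?N2"
      using mem dot_W_eq_0 by blast
    moreover have "Z = ?f v + (Z - outer v a)"
      by (simp add: f_eq)
    ultimately show "Z \<in> {Y + Z | Y Z. Y \<in> ?N1 \<and> Z \<in> ?N2}"
      using v by blast
  qed
  have "?N1 = {0} \<or> ?N2 = {0}"
    using indec N1 N2 inter sum
    unfolding indecomposable_module_def submodule_summand_iff[OF N] set_add_summand by simp
  moreover have "u \<in> ?N1"
    using f(3) by (intro image_eqI[of _ _ "w 0"]) simp_all
  ultimately have "?N2 = {0}"
    using u(2) by blast
  then have "?N1 = N"
    using sum N1 by auto
  then have "modules_isomorphic TA W0 (summand N)"
    using f by (auto simp: modules_isomorphic_def bij_betw_def)
  then show ?thesis
    by (rule modules_isomorphic_sym[OF left_module_W0])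
qed

text \<open>Applying \<open>E 0\<close> to the components of \<open>outer (w 0) (w j)\<close> shows that the vectors fixed by \<open>E 0\<close>, one
  from each copy of \<open>W\<close>, span \<open>E 0 T\<close>: the other summands are killed by \<open>E 0\<close>.\<close>

lemma nondegenerate_imp_card_summands:
  fixes n :: nat
  assumes H: "nondegenerate" and ds: "internal_direct_sum TA (regular_module TA) {..<n} V"
    and indec: "\<forall>i<n. indecomposable_module TA (summand (V i))"
  shows "card {i. i < n \<and> modules_isomorphic TA (summand (V i)) W0} = d + 1"
proof (rule antisym)
  let ?K = "{i. i < n \<and> modules_isomorphic TA (summand (V i)) W0}"
  have li: "left_ideal (V i)" if "i < n" for i
    by (rule internal_direct_sumD(1)[OF ds that])
  have ex: "\<exists>u. u \<in> V i \<and> u \<noteq> 0 \<and> E 0 ** u = u \<and> (\<forall>Z\<in>V i. \<exists>c. E 0 ** Z = mat_scale c u)" if "i \<in> ?K" for i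
  proof -
    from that have i: "i < n" "modules_isomorphic TA (summand (V i)) W0"
      by simp_all
    show ?thesis
      by (rule summand_isomorphicE[OF li[OF i(1)] i(2)]) blast
  qed
  define u where "u i = (SOME u. u \<in> V i \<and> u \<noteq> 0 \<and> E 0 ** u = u \<and> (\<forall>Z\<in>V i. \<exists>c. E 0 ** Z = mat_scale c u))" for i
  have u: "u i \<in> V i \<and> u i \<noteq> 0 \<and> E 0 ** u i = u i \<and> (\<forall>Z\<in>V i. \<exists>c. E 0 ** Z = mat_scale c (u i))"
    if "i \<in> ?K" for i
    unfolding u_def by (rule someI_ex[OF ex[OF that]])
  show "card ?K \<le> d + 1"
  proof (rule card_thin_summands_le[OF ds])
    show "\<exists>u\<in>V i. u \<noteq> 0 \<and> E 0 ** u = u" if "i \<in> ?K" for i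
      using u[OF that] by blast
  qed auto
  have fin: "finite ?K"
    by simp
  have "first_row j \<in> mat_space.span (u ` ?K)" for j
  proof -
    have "first_row j \<in> T"
      by (rule outer_in_T[OF w_in_W w_in_W])
    then obtain v where v: "\<forall>i<n. v i \<in> V i" "first_row j = (\<Sum>i<n. v i)"
      using internal_direct_sumD(2)[OF ds] by blast
    have "first_row j = E 0 ** (\<Sum>i<n. v i)"
      unfolding v(2)[symmetric] E_0_outer ..
    also have "\<dots> = (\<Sum>i<n. E 0 ** v i)"
      by (induction n) (simp_all add: matrix_add_ldistrib)
    also have "\<dots> \<in> mat_space.span (u ` ?K)"
    proof (rule mat_space.span_sum)
      fix i assume "i \<in> {..<n}"
      then have i: "i < n"
        by simp
      show "E 0 ** v i \<in> mat_space.span (u ` ?K)"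
      proof (cases "i \<in> ?K")
        case True
        then obtain c where "E 0 ** v i = mat_scale c (u i)"
          using u[OF True] v(1) i by blast
        then show ?thesis
          using True by (auto intro: mat_space.span_scale mat_space.span_base)
      next
        case False
        have "E 0 ** v i \<in> V i"
          using left_idealD(4)[OF li[OF i] generators_in_T(2)] v(1) i by simp
        moreover have "indecomposable_module TA (summand (V i))"
          using indec i by blast
        moreover have "\<not> modules_isomorphic TA (summand (V i)) W0"
          using False i by simp
        ultimately have "E 0 ** v i = 0"
          using indecomposable_summand_isomorphic[OF H li[OF i], of "E 0 ** v i"] E_0_idem[of "v i"]
          by metis
        then show ?thesis
          by (simp add: mat_space.span_zero)
      qed
    qed
    finally show ?thesis .
  qed
  then have "card (first_row ` {..d}) \<le> card (u ` ?K)"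
    using mat_space.independent_span_bound[OF finite_imageI[OF fin] independent_first_row(2)] by blast
  also have "\<dots> \<le> card ?K"
    by (rule card_image_le[OF fin])
  finally show "d + 1 \<le> card ?K"
    by (simp add: card_image[OF independent_first_row(1)])
qed

text \<open>The \<open>d + 1\<close> copies of \<open>W\<close> exhaust \<open>E 0 T\<close>, so \<open>E 0\<close> kills the remaining summands. If \<open>k j = 0\<close>, then
  \<open>outer (w 0) (w j)\<close> kills the copies of \<open>W\<close>, which lie in \<open>B\<close>, and also the other summands, being
  fixed by \<open>E 0\<close>; hence it kills the identity.\<close>

lemma card_summands_imp_nondegenerate:
  fixes n :: nat
  assumes ds: "internal_direct_sum TA (regular_module TA) {..<n} V"
    and card: "card {i. i < n \<and> modules_isomorphic TA (summand (V i)) W0} = d + 1"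
  shows "nondegenerate"
proof (rule ccontr)
  assume "\<not> nondegenerate"
  then obtain j where j: "j \<le> d" "(of_nat (k j) :: 'f) = 0"
    by (rule not_nondegenerateE)
  let ?K = "{i. i < n \<and> modules_isomorphic TA (summand (V i)) W0}"
  have li: "left_ideal (V i)" if "i < n" for i
    by (rule internal_direct_sumD(1)[OF ds that])
  have K: "\<exists>u\<in>V i. u \<noteq> 0 \<and> E 0 ** u = u" if "i \<in> ?K" for i
  proof -
    from that have i: "i < n" "modules_isomorphic TA (summand (V i)) W0"
      by simp_all
    show ?thesis
      by (rule summand_isomorphicE[OF li[OF i(1)] i(2)]) blast
  qed
  have KB: "V i \<subseteq> B" if "i \<in> ?K" for i
  proof -
    from that have i: "i < n" "modules_isomorphic TA (summand (V i)) W0"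
      by simp_all
    show ?thesis
      by (rule summand_isomorphicE[OF li[OF i(1)] i(2)]) blast
  qed
  have outside: "u = 0" if i: "i < n" "i \<notin> ?K" and u: "u \<in> V i" "E 0 ** u = u" for i u
  proof (rule ccontr)
    assume "u \<noteq> 0"
    then have "card (insert i ?K) \<le> d + 1"
      using K i u by (intro card_thin_summands_le[OF ds]) auto
    then show False
      using card i(2) by simp
  qed
  obtain v where v: "\<forall>i<n. v i \<in> V i" "mat 1 = (\<Sum>i<n. v i)"
    using internal_direct_sumD(2)[OF ds T_closed(2)] by blast
  have "first_row j = first_row j ** (\<Sum>i<n. v i)"
    unfolding v(2)[symmetric] by simp
  also have "\<dots> = (\<Sum>i<n. first_row j ** v i)"
    by (induction n) (simp_all add: matrix_add_ldistrib)
  also have "\<dots> = 0"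
  proof (rule sum.neutral, rule ballI)
    fix i assume "i \<in> {..<n}"
    then have i: "i < n" "v i \<in> V i"
      using v(1) by simp_all
    show "first_row j ** v i = 0"
    proof (cases "i \<in> ?K")
      case True
      then show ?thesis
        using degenerate_mult_B[OF j(2)] KB i by blast
    next
      case False
      have "first_row j ** v i \<in> V i"
        by (rule left_idealD(4)[OF li[OF i(1)] outer_in_T[OF w_in_W w_in_W] i(2)])
      moreover have "E 0 ** (first_row j ** v i) = first_row j ** v i"
        by (simp add: matrix_mul_assoc E_0_outer)
      ultimately show ?thesis
        using outside[OF i(1) False] by blast
    qed
  qed
  finally show False
    using outer_w_0_ne_0[OF j(1)] by simp
qed

lemma nondegenerate_iff_card_summands:
  "nondegenerate \<longleftrightarrow> (\<forall>(n::nat) V. internal_direct_sum TA (regular_module TA) {..<n} V \<and>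
     (\<forall>i<n. indecomposable_module TA ((regular_module TA)\<lparr>carrier := V i\<rparr>)) \<longrightarrow>
     card {i. i < n \<and> modules_isomorphic TA ((regular_module TA)\<lparr>carrier := V i\<rparr>) W0} = d + 1)"
proof
  assume r: "\<forall>(n::nat) V. internal_direct_sum TA (regular_module TA) {..<n} V \<and>
     (\<forall>i<n. indecomposable_module TA (summand (V i))) \<longrightarrow>
     card {i. i < n \<and> modules_isomorphic TA (summand (V i)) W0} = d + 1"
  obtain n :: nat and V where nV: "internal_direct_sum TA (regular_module TA) {..<n} V"
    "\<forall>i<n. indecomposable_module TA (summand (V i))"
    by (rule indecomposable_decomposition)
  then have "card {i. i < n \<and> modules_isomorphic TA (summand (V i)) W0} = d + 1"
    using r by blast
  then show nondegenerate
    by (rule card_summands_imp_nondegenerate[OF nV(1)])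
qed (use nondegenerate_imp_card_summands in blast)

end

theorem theorem4p21:
  fixes d p :: nat
    and R :: "nat \<Rightarrow> ('x::finite \<times> 'x) set"
    and x :: 'x
    and E :: "nat \<Rightarrow> 'f::field^'x^'x"
    and T :: "('f, 'f^'x^'x) module"
    and B\<^sub>0 :: "('f^'x^'x) set"
    and W\<^sub>0 :: "('f^'x^'x, 'f^'x) module"
    and emb :: "'f list \<Rightarrow> 'u"  (* 'u is any type large enough to carry a copy of each finitely
                                  generated T-module, i.e. of each finite-dimensional 'f-space *)
  assumes "association_scheme d R"
    and "CHAR('f) = p" and "p > 0"
    and "E = dual_idempotent R x"
    and "T = mat_algebra (terwilliger d R x)"
    and "B\<^sub>0 = primary_ideal d R x"
    and "W\<^sub>0 = vec_module (primary_space d R x)"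
    and "inj emb"
  shows "all_equivalent
    [ \<comment> \<open>(i)\<close>
      p'_valenced p d R,
      \<comment> \<open>(ii)\<close>
      \<exists>e\<in>B\<^sub>0. (\<forall>b\<in>B\<^sub>0. e ** b = b \<and> b ** e = b) \<and> (\<forall>Z\<in>carrier T. e ** Z = Z ** e),
      \<comment> \<open>(iii)\<close>
      \<exists>D. ideal D T \<and> B\<^sub>0 \<inter> D = {\<zero>\<^bsub>T\<^esub>} \<and> B\<^sub>0 <+>\<^bsub>T\<^esub> D = carrier T,
      \<comment> \<open>(iv)\<close>
      \<exists>n (\<Delta> :: ('f, 'u) module). n \<ge> 1 \<and> division_algebra \<Delta> \<and>
        algebras_isomorphic (mat_algebra B\<^sub>0) (full_matrix_algebra n \<Delta>),
      \<comment> \<open>(v)\<close>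
      \<forall>Z\<in>annihilator T W\<^sub>0. \<forall>i\<le>d. R i \<in> thin_radical d R \<longrightarrow> E i ** Z = 0 \<and> Z ** E i = 0,
      \<comment> \<open>(vi)\<close>
      \<forall>Z\<in>jacobson_radical T. \<forall>i\<le>d. R i \<in> thin_radical d R \<longrightarrow> E i ** Z = 0 \<and> Z ** E i = 0,
      \<comment> \<open>(vii)\<close>
      \<forall>(n::nat) V. internal_direct_sum T (regular_module T) {..<n} V \<and>
        (\<forall>i<n. indecomposable_module T ((regular_module T)\<lparr>carrier := V i\<rparr>)) \<longrightarrow>
        card {i. i < n \<and> modules_isomorphic T ((regular_module T)\<lparr>carrier := V i\<rparr>) W\<^sub>0} = d + 1,
      \<comment> \<open>(viii)\<close>
      irreducible_module T W\<^sub>0,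
      \<comment> \<open>(ix)\<close>
      modules_isomorphic T W\<^sub>0 (contragredient W\<^sub>0),
      \<comment> \<open>(x)\<close>
      \<forall>U :: ('f^'x^'x, 'u) module. fg_left_module T U \<longrightarrow>
        ((irreducible_module T U \<and>
          (\<exists>j\<le>d. R j \<in> thin_radical d R \<and> scalar_dim U ((\<lambda>u. E j \<odot>\<^bsub>U\<^esub> u) ` carrier U) > 0))
         \<longleftrightarrow> modules_isomorphic T U W\<^sub>0),
      \<comment> \<open>(xi)\<close>
      \<forall>U :: ('f^'x^'x, 'u) module. fg_left_module T U \<longrightarrow>
        ((\<exists>j\<le>d. R j \<in> thin_radical d R \<and>
          scalar_dim U (carrier U) = d + 1 \<and>
          d + 1 \<ge> scalar_dim U ((\<lambda>u. E j \<odot>\<^bsub>U\<^esub> u) ` carrier U) \<and>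
          scalar_dim U ((\<lambda>u. E j \<odot>\<^bsub>U\<^esub> u) ` carrier U) > 0)
         \<longleftrightarrow> modules_isomorphic T U W\<^sub>0)
    ]"
proof -
  interpret terwilliger_algebra d R x E
    using assms by unfold_locales simp_all
  have char: "p'_valenced p d R \<longleftrightarrow> nondegenerate"
    using p'_valenced_iff assms(2) by (simp add: nondegenerate_def)
  \<comment> \<open>Lists of length one carry a copy of the field.\<close>
  have emb1: "inj (\<lambda>c :: 'f. emb [c])"
    by (intro injI) (auto dest: injD[OF \<open>inj emb\<close>])
  note slice = slice_def[symmetric]
  show ?thesis
    unfolding assms(5,6,7) slice char
      nondegenerate_iff_unital[symmetric] nondegenerate_iff_complement[symmetric]
      nondegenerate_iff_matrix_algebra[OF emb1, symmetric]
      nondegenerate_iff_annihilator[symmetric] nondegenerate_iff_radical[symmetric]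
      nondegenerate_iff_card_summands[symmetric] nondegenerate_iff_irreducible[symmetric]
      nondegenerate_iff_self_contragredient[symmetric]
      nondegenerate_iff_irreducible_thin[OF \<open>inj emb\<close>, symmetric]
      nondegenerate_iff_dim_thin[OF \<open>inj emb\<close>, symmetric]
    by (simp add: all_equivalent_def)
qed

end
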